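(* Let $G$ be an ordered group and let $s$ be a positive integer. If $S$ is a finite subset of $G$ with $|S|\ge 2^{s+2}$ and $|S^2|=3|S|-2+s$, then $\langle S\rangle$ is metabelian. Moreover, if $G$ is nilpotent, then $\langle S\rangle$ is nilpotent of class at most $2$.
   Context: An ordered group is a group $G$ with a total order $\le$ such that $a\le b$ implies $xay\le xby$ for all $a,b,x,y\in G$. For a subset $S$, $S^2=\{x_1x_2 : x_1,x_2\in S\}$, and $\langle S\rangle$ is the subgroup generated by $S$. A group is metabelian if its derived subgroup is abelian. *)

theory Defs
  imports "HOL-Algebra.Algebra"
begin

locale ordered_group = group G for G (structure) +
  fixes le :: "'a rel"
  assumes linear_order: "linear_order_on (carrier G) le"
    and le_mult: "\<lbrakk> a \<in> carrier G; b \<in> carrier G; x \<in> carrier G; y \<in> carrier G; (a, b) \<in> le \<rbrakk>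
      \<Longrightarrow> (x \<otimes> a \<otimes> y, x \<otimes> b \<otimes> y) \<in> le"

definition metabelian :: "('a, 'b) monoid_scheme \<Rightarrow> bool" where
  "metabelian G \<longleftrightarrow> group G \<and> comm_group (G\<lparr>carrier := derived G (carrier G)\<rparr>)"

text \<open>
  The lower central series, indexed from 0: the term with index \<open>n\<close> is what is
  usually written \<open>\<gamma>\<close> with index \<open>n + 1\<close>. Commutators are written as in \<^const>\<open>derived\<close>.
\<close>

primrec lower_central :: "('a, 'b) monoid_scheme \<Rightarrow> nat \<Rightarrow> 'a set" where
  "lower_central G 0 = carrier G"
| "lower_central G (Suc n) =
     generate G (\<Union>x \<in> lower_central G n. \<Union>g \<in> carrier G.
       { x \<otimes>\<^bsub>G\<^esub> g \<otimes>\<^bsub>G\<^esub> inv\<^bsub>G\<^esub> x \<otimes>\<^bsub>G\<^esub> inv\<^bsub>G\<^esub> g })"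

definition nilpotent_group :: "('a, 'b) monoid_scheme \<Rightarrow> bool" where
  "nilpotent_group G \<longleftrightarrow> group G \<and> (\<exists>c. lower_central G c = {\<one>\<^bsub>G\<^esub>})"

text \<open>Meaningful only when \<^term>\<open>nilpotent_group G\<close> holds.\<close>

definition nilpotency_class :: "('a, 'b) monoid_scheme \<Rightarrow> nat" where
  "nilpotency_class G = (LEAST c. lower_central G c = {\<one>\<^bsub>G\<^esub>})"

lemma lower_central_1: "lower_central G (Suc 0) = derived G (carrier G)"
  by (simp add: derived_def)

end

theory Submission
  imports Defs
begin

text \<open>
  Write \<open>d(S) = |S\<^sup>2| - 3|S| + 2\<close>. If \<open>S\<close> does not commute, its maximum \<open>y\<close> contributes at least
  three products to \<open>S\<^sup>2\<close>, so \<open>d\<close> does not increase when extreme elements are removed as long as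
  the rest does not commute; moreover \<open>y\<close> lies in the subgroup generated by the rest once
  \<open>|S| \<ge> d(S) + 4\<close>. Hence it suffices to control one large initial or final segment.
  If such a segment commutes, take the first element \<open>y\<close> not commuting with it. Counting forces
  the ratios of its elements to be pairwise commensurable and two of these elements to be conjugated
  by \<open>y\<close> back into it, so \<open>y\<close> normalises an abelian group of rank one containing all commutators.
  If the lowest and the highest half both fail to commute, then \<open>d(T) + d(U) \<le> d(S)\<close> for two
  segments sharing one element gives a half with smaller \<open>d\<close>, and one concludes by induction on \<open>s\<close>.
  The induction starts with four elements and ten products, where comparing products leaves only
  relations of Baumslag-Solitar, Fibonacci and Heisenberg type.
\<close>

section \<open>Products in ordered groups\<close>

text \<open>The constant \<open>2 ^ (s + 2)\<close> comes from halving: the inductive step replaces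
  the set by one of half the guaranteed size and lowers \<open>s\<close> by one, until at
  \<open>s = 0\<close> a segment with four elements and \<open>3 * 4 - 2 = 10\<close> products is
  left. Two segments that share one element have sizes adding up to \<open>|S| + 1\<close> and at
  most one product in common, which is why the defects \<open>d\<close> add up correctly. However,
  \<open>d\<close> is nonnegative only on noncommuting sets (a geometric progression has
  \<open>d = 1 - |S|\<close>), so commuting segments need an argument of their own. That argument
  rests on uniqueness of roots in ordered groups: whatever commutes with a nonzero power of
  \<open>x\<close> commutes with \<open>x\<close>, and an abelian group of rank one that is closed
  under roots is normalised as soon as one of its nontrivial elements is conjugated into it. In a
  nilpotent group such an action must be trivial, since otherwise a nontrivial power of a fixed
  element would survive in every term of the lower central series.\<close>

lemma card_add_le:
  assumes "finite C" "A \<subseteq> C" "B \<subseteq> C" "A \<inter> B = {}"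
  shows "card A + card B \<le> card C"
  by (metis assms card_Un_disjoint card_mono finite_subset Un_least)

definition pairwise_commute :: "('a, 'b) monoid_scheme \<Rightarrow> 'a set \<Rightarrow> bool" where
  "pairwise_commute G S \<longleftrightarrow> (\<forall>x\<in>S. \<forall>y\<in>S. x \<otimes>\<^bsub>G\<^esub> y = y \<otimes>\<^bsub>G\<^esub> x)"

lemma pairwise_commuteD:
  "pairwise_commute G S \<Longrightarrow> x \<in> S \<Longrightarrow> y \<in> S \<Longrightarrow> x \<otimes>\<^bsub>G\<^esub> y = y \<otimes>\<^bsub>G\<^esub> x"
  by (auto simp: pairwise_commute_def)

lemma pairwise_commute_subset: "pairwise_commute G S \<Longrightarrow> T \<subseteq> S \<Longrightarrow> pairwise_commute G T"
  by (auto simp: pairwise_commute_def)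

lemma set_multI: "x \<in> A \<Longrightarrow> y \<in> B \<Longrightarrow> x \<otimes>\<^bsub>G\<^esub> y \<in> A <#>\<^bsub>G\<^esub> B"
  by (auto simp: set_mult_def)

lemma set_multE:
  assumes "z \<in> A <#>\<^bsub>G\<^esub> B"
  obtains x y where "x \<in> A" "y \<in> B" "z = x \<otimes>\<^bsub>G\<^esub> y"
  using assms by (auto simp: set_mult_def)

lemma finite_set_mult: "finite A \<Longrightarrow> finite B \<Longrightarrow> finite (A <#>\<^bsub>G\<^esub> B)"
  by (auto simp: set_mult_def)

context group
begin

lemma inv_cancel_left [simp]:
  "x \<in> carrier G \<Longrightarrow> y \<in> carrier G \<Longrightarrow> inv x \<otimes> (x \<otimes> y) = y"
  "x \<in> carrier G \<Longrightarrow> y \<in> carrier G \<Longrightarrow> x \<otimes> (inv x \<otimes> y) = y"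
  by (simp_all add: m_assoc [symmetric])

lemma subgroup_centralizer:
  assumes "A \<subseteq> carrier G"
  shows "subgroup {x \<in> carrier G. \<forall>a\<in>A. x \<otimes> a = a \<otimes> x} G"
proof
  fix x y assume xy: "x \<in> {x \<in> carrier G. \<forall>a\<in>A. x \<otimes> a = a \<otimes> x}"
    "y \<in> {x \<in> carrier G. \<forall>a\<in>A. x \<otimes> a = a \<otimes> x}"
  have "x \<otimes> y \<otimes> a = a \<otimes> (x \<otimes> y)" if a: "a \<in> A" for a
  proof -
    have "a \<in> carrier G" using a assms by auto
    moreover have "x \<in> carrier G" "y \<in> carrier G" "x \<otimes> a = a \<otimes> x" "y \<otimes> a = a \<otimes> y"
      using xy a by auto
    ultimately show ?thesis by (metis m_assoc)
  qed
  then show "x \<otimes> y \<in> {x \<in> carrier G. \<forall>a\<in>A. x \<otimes> a = a \<otimes> x}" using xy by auto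
next
  fix x assume x: "x \<in> {x \<in> carrier G. \<forall>a\<in>A. x \<otimes> a = a \<otimes> x}"
  have "inv x \<otimes> a = a \<otimes> inv x" if a: "a \<in> A" for a
  proof -
    have "a \<in> carrier G" using a assms by auto
    then have "x \<otimes> (a \<otimes> inv x) = a" using x a by (simp add: m_assoc [symmetric]) (simp add: m_assoc)
    then show ?thesis using x \<open>a \<in> carrier G\<close> by (metis (no_types, lifting) inv_closed inv_cancel_left(1) m_closed mem_Collect_eq)
  qed
  then show "inv x \<in> {x \<in> carrier G. \<forall>a\<in>A. x \<otimes> a = a \<otimes> x}" using x by auto
qed (use assms in auto)

lemma commute_generate:
  assumes "x \<in> carrier G" "A \<subseteq> carrier G" "\<And>a. a \<in> A \<Longrightarrow> a \<otimes> x = x \<otimes> a"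
    and "g \<in> generate G A"
  shows "g \<otimes> x = x \<otimes> g"
proof -
  have "generate G A \<subseteq> {g \<in> carrier G. \<forall>a\<in>{x}. g \<otimes> a = a \<otimes> g}"
    by (rule generate_subgroup_incl[OF _ subgroup_centralizer]) (use assms in auto)
  then show ?thesis using assms(4) by auto
qed

lemma generate_commute:
  assumes "A \<subseteq> carrier G" "pairwise_commute G A" "g \<in> generate G A" "h \<in> generate G A"
  shows "g \<otimes> h = h \<otimes> g"
proof (rule commute_generate[OF _ assms(1) _ assms(3)])
  show "h \<in> carrier G" using assms generate_in_carrier by blast
  fix a assume a: "a \<in> A"
  show "a \<otimes> h = h \<otimes> a"
    using commute_generate[OF _ assms(1) _ assms(4), of a] assms a
    by (auto simp: pairwise_commute_def)
qed

lemma generate_closure: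
  assumes "S \<subseteq> generate G T" "T \<subseteq> carrier G"
  shows "generate G S \<subseteq> generate G T"
  by (rule generate_subgroup_incl[OF assms(1) generate_is_subgroup[OF assms(2)]])

text \<open>Coincidences between products are exploited in this form: if three of the four factors
  lie in a subgroup, so does the fourth. Hence an element outside the subgroup creates new
  products.\<close>

lemma generate_quotient:
  assumes A: "A \<subseteq> carrier G" and "u \<in> generate G A" "v \<in> generate G A" "w \<in> generate G A"
    and "x \<in> carrier G" "w \<otimes> x = u \<otimes> v \<or> x \<otimes> w = u \<otimes> v"
  shows "x \<in> generate G A"
proof -
  have c: "u \<in> carrier G" "v \<in> carrier G" "w \<in> carrier G"
    using assms generate_in_carrier by blast+
  have "x = inv w \<otimes> (u \<otimes> v) \<or> x = (u \<otimes> v) \<otimes> inv w"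
    using assms(5,6) c by (metis inv_solve_left inv_solve_right m_closed)
  then show ?thesis
    using assms generate_m_inv_closed[OF A] generate.eng by metis
qed

lemma generate_cancel:
  assumes A: "A \<subseteq> carrier G" and "w \<in> generate G A" "x \<in> carrier G"
    and "x \<otimes> w \<in> generate G A \<or> w \<otimes> x \<in> generate G A"
  shows "x \<in> generate G A"
  using assms(4)
proof
  assume xw: "x \<otimes> w \<in> generate G A"
  show ?thesis
    by (rule generate_quotient[OF A xw generate.one assms(2,3)])
      (use assms generate_in_carrier[OF A xw] in simp)
next
  assume wx: "w \<otimes> x \<in> generate G A"
  show ?thesis
    by (rule generate_quotient[OF A wx generate.one assms(2,3)])
      (use assms generate_in_carrier[OF A wx] in simp)
qed

end

context ordered_group
begin

definition less :: "'a \<Rightarrow> 'a \<Rightarrow> bool" (infix \<open>\<lless>\<close> 50)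
  where "x \<lless> y \<longleftrightarrow> (x, y) \<in> le \<and> x \<noteq> y"

lemma less_carrier: "x \<lless> y \<Longrightarrow> x \<in> carrier G \<and> y \<in> carrier G"
  using linear_order by (auto simp: less_def order_on_defs)

lemma less_irrefl [simp]: "\<not> x \<lless> x"
  by (simp add: less_def)

lemma less_trans [trans]: "x \<lless> y \<Longrightarrow> y \<lless> z \<Longrightarrow> x \<lless> z"
  using linear_order unfolding less_def order_on_defs by (metis antisymD transD)

lemma less_asym: "x \<lless> y \<Longrightarrow> \<not> y \<lless> x"
  using less_trans less_irrefl by blast

lemma less_total: "x \<in> carrier G \<Longrightarrow> y \<in> carrier G \<Longrightarrow> x \<noteq> y \<Longrightarrow> x \<lless> y \<or> y \<lless> x"
  using linear_order unfolding less_def order_on_defs total_on_def by metis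

lemma mult_less_left: "x \<lless> y \<Longrightarrow> u \<in> carrier G \<Longrightarrow> u \<otimes> x \<lless> u \<otimes> y"
  using le_mult[of x y u "\<one>"] less_carrier[of x y] by (auto simp: less_def)

lemma mult_less_right: "x \<lless> y \<Longrightarrow> u \<in> carrier G \<Longrightarrow> x \<otimes> u \<lless> y \<otimes> u"
  using le_mult[of x y "\<one>" u] less_carrier[of x y] by (auto simp: less_def)

lemma mult_less: "x \<lless> y \<Longrightarrow> u \<lless> v \<Longrightarrow> x \<otimes> u \<lless> y \<otimes> v"
  by (meson less_carrier less_trans mult_less_left mult_less_right)

lemma mult_le_less:
  "x = y \<or> x \<lless> y \<Longrightarrow> u \<lless> v \<Longrightarrow> y \<in> carrier G \<Longrightarrow> x \<otimes> u \<lless> y \<otimes> v"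
  using mult_less mult_less_left by blast

lemma mult_less_le:
  "x \<lless> y \<Longrightarrow> u = v \<or> u \<lless> v \<Longrightarrow> v \<in> carrier G \<Longrightarrow> x \<otimes> u \<lless> y \<otimes> v"
  using mult_less mult_less_right by blast

text \<open>With the reversed order, every result about maxima and lower segments applies to minima
  and upper segments.\<close>

lemma ordered_group_converse: "ordered_group G (le\<inverse>)"
proof
  show "linear_order_on (carrier G) (le\<inverse>)" using linear_order by simp
qed (use le_mult in auto)

lemma less_converse: "ordered_group.less (le\<inverse>) x y \<longleftrightarrow> y \<lless> x"
  using ordered_group.less_def[OF ordered_group_converse] by (auto simp: less_def)

lemma ex_max:
  assumes "finite S" "S \<noteq> {}" "S \<subseteq> carrier G"
  obtains m where "m \<in> S" "\<forall>x\<in>S - {m}. x \<lless> m"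
proof -
  have "\<exists>m\<in>S. \<forall>x\<in>S - {m}. x \<lless> m"
    using assms
  proof (induction rule: finite_ne_induct)
    case (insert y F)
    then obtain m where m: "m \<in> F" "\<forall>x\<in>F - {m}. x \<lless> m" by auto
    consider "y = m" | "y \<lless> m" | "m \<lless> y"
      using less_total[of y m] insert.prems m(1) by blast
    then show ?case
    proof cases
      case 3
      then show ?thesis using m less_trans by (intro bexI[of _ y]) blast+
    qed (use m insert in blast)+
  qed auto
  then show thesis using that by blast
qed

lemma ex_min:
  assumes "finite S" "S \<noteq> {}" "S \<subseteq> carrier G"
  obtains m where "m \<in> S" "\<forall>x\<in>S - {m}. m \<lless> x"
  using ordered_group.ex_max[OF ordered_group_converse assms] less_converse by metis

lemma ex_max_satisfying:
  assumes "finite S" "S \<subseteq> carrier G" "x \<in> S" "P x"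
  obtains m where "m \<in> S" "P m" "\<And>x. x \<in> S \<Longrightarrow> m \<lless> x \<Longrightarrow> \<not> P x"
proof -
  obtain m where "m \<in> {x \<in> S. P x}" "\<forall>x\<in>{x \<in> S. P x} - {m}. x \<lless> m"
    using ex_max[of "{x \<in> S. P x}"] assms by auto
  then show thesis using that less_asym less_irrefl by blast
qed

text \<open>
  Let \<open>z\<close> be the largest element that fails to commute with something above it, so that everything
  above \<open>z\<close> commutes. New products are \<open>y\<close> squared, the product of \<open>y\<close> with the second largest element,
  and the larger one of \<open>z \<otimes> y\<close> and \<open>y \<otimes> z\<close>.
\<close>

lemma square_remove_max:
  assumes fin: "finite S" and S: "S \<subseteq> carrier G" and y: "y \<in> S" "\<And>x. x \<in> S - {y} \<Longrightarrow> x \<lless> y"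
    and nc: "\<not> pairwise_commute G S"
  shows "card ((S - {y}) <#> (S - {y})) + 3 \<le> card (S <#> S)"
proof -
  define T where "T = S - {y}"
  have Tc: "T \<subseteq> carrier G" "y \<in> carrier G" using S y by (auto simp: T_def)
  have T: "x \<lless> y" if "x \<in> T" for x using that y(2) by (auto simp: T_def)
  obtain w v where "w \<in> S" "v \<in> S" "w \<otimes> v \<noteq> v \<otimes> w" using nc by (auto simp: pairwise_commute_def)
  then have "\<exists>w\<in>S. \<exists>v\<in>S. w \<lless> v \<and> w \<otimes> v \<noteq> v \<otimes> w"
    using S less_total[of w v] by (metis subsetD)
  then obtain w where w: "w \<in> S" "\<exists>v\<in>S. w \<lless> v \<and> w \<otimes> v \<noteq> v \<otimes> w" by blast
  obtain z where z: "z \<in> S" "\<exists>v\<in>S. z \<lless> v \<and> z \<otimes> v \<noteq> v \<otimes> z"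
    and zm: "\<And>x. x \<in> S \<Longrightarrow> z \<lless> x \<Longrightarrow> \<not> (\<exists>v\<in>S. x \<lless> v \<and> x \<otimes> v \<noteq> v \<otimes> x)"
    using ex_max_satisfying[where P = "\<lambda>x. \<exists>v\<in>S. x \<lless> v \<and> x \<otimes> v \<noteq> v \<otimes> x", OF fin S w] by metis
  have com: "u \<otimes> v = v \<otimes> u" if "u \<in> S" "v \<in> S" "z \<lless> u" "z \<lless> v" for u v
    using zm[OF that(1,3)] zm[OF that(2,4)] that less_total[of u v] S by (metis subsetD)
  obtain r where r: "r \<in> S" "z \<lless> r" "z \<otimes> r \<noteq> r \<otimes> z" using z by auto
  have zT: "z \<in> T" using z(1) r y(2)[of r] less_asym by (auto simp: T_def)
  have zc: "z \<in> carrier G" using zT Tc by auto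
  define m where "m = (if z \<otimes> y \<lless> y \<otimes> z then y \<otimes> z else z \<otimes> y)"
  have m_mem: "m \<in> S <#> S" using z y by (auto simp: m_def intro: set_multI)
  have m_ge: "x \<lless> m" if "x \<lless> z \<otimes> y \<or> x \<lless> y \<otimes> z" for x
  proof (cases "z \<otimes> y \<lless> y \<otimes> z")
    case True
    then show ?thesis using that less_trans by (auto simp: m_def)
  next
    case False
    then have "z \<otimes> y = y \<otimes> z \<or> y \<otimes> z \<lless> z \<otimes> y" using zc Tc less_total by blast
    then show ?thesis using that less_trans False by (auto simp: m_def)
  qed
  \<comment> \<open>Everything above \<open>z\<close> commutes with \<open>r\<close>, because
    \<open>r\<close> itself lies above \<open>z\<close>; membership would make \<open>z\<close>
    commute with \<open>r\<close> too.\<close>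
  have not_gen: "z \<notin> generate G {u \<in> S. z \<lless> u}"
  proof
    assume "z \<in> generate G {u \<in> S. z \<lless> u}"
    then have "z \<otimes> r = r \<otimes> z"
      by (rule commute_generate[rotated 3]) (use S r com in auto)
    then show False using r by simp
  qed
  have notm: "m \<noteq> u \<otimes> v" if "u \<in> S" "v \<in> S" "z \<lless> u" "z \<lless> v" for u v
  proof
    assume "m = u \<otimes> v"
    then have "y \<otimes> z = u \<otimes> v \<or> z \<otimes> y = u \<otimes> v" by (auto simp: m_def split: if_splits)
    moreover have "y \<in> {u \<in> S. z \<lless> u}" using y T zT by auto
    ultimately have "z \<in> generate G {u \<in> S. z \<lless> u}"
      using that S zc generate_quotient[of "{u \<in> S. z \<lless> u}" u v y z] by (auto intro: generate.incl)
    then show False using not_gen by simp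
  qed
  \<comment> \<open>If \<open>u\<close> or \<open>v\<close> is at most \<open>z\<close>, then
    \<open>uv\<close> lies strictly below \<open>zy\<close> or \<open>yz\<close>, hence below
    \<open>m\<close>. So both factors lie above \<open>z\<close>, which \<open>notm\<close>
    excludes.\<close>
  have m_new: "m \<notin> T <#> T"
  proof
    assume "m \<in> T <#> T"
    then obtain u v where uv: "u \<in> T" "v \<in> T" "m = u \<otimes> v" by (rule set_multE)
    have uvc: "u \<in> carrier G" "v \<in> carrier G" using uv Tc by auto
    have "z \<lless> u"
    proof (rule ccontr)
      assume "\<not> z \<lless> u"
      then have "u \<otimes> v \<lless> z \<otimes> y" using mult_le_less[of u z v y] less_total[of u z] uv T zc uvc by auto
      then show False using m_ge uv(3) less_irrefl by metis
    qed
    moreover have "z \<lless> v"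
    proof (rule ccontr)
      assume "\<not> z \<lless> v"
      then have "u \<otimes> v \<lless> y \<otimes> z" using mult_less_le[of u y v z] less_total[of v z] uv T zc uvc by auto
      then show False using m_ge uv(3) less_irrefl by metis
    qed
    ultimately show False using notm uv by (auto simp: T_def)
  qed
  obtain y' where y': "y' \<in> T" "\<forall>x\<in>T - {y'}. x \<lless> y'"
    using ex_max[of T] fin zT Tc by (auto simp: T_def)
  have y'c: "y' \<in> carrier G" using y' Tc by auto
  have yy: "x \<lless> y \<otimes> y" if "x \<in> T <#> T \<or> x = y' \<otimes> y \<or> x = y \<otimes> y'" for x
    using that T Tc y' by (auto elim!: set_multE simp: mult_less mult_less_left mult_less_right)
  have y'y: "x \<lless> y \<otimes> y'" "x \<lless> y' \<otimes> y" if x: "x \<in> T <#> T" for x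
  proof -
    obtain u v where uv: "u \<in> T" "v \<in> T" "x = u \<otimes> v" using x by (rule set_multE)
    show "x \<lless> y \<otimes> y'" "x \<lless> y' \<otimes> y"
      using uv T y' y'c mult_less_le[of u y v y'] mult_le_less[of u y' v y] by blast+
  qed
  \<comment> \<open>If \<open>z\<close> is the second largest element, only \<open>y\<close> can be
    \<open>r\<close>, so \<open>zy\<close> and \<open>yz\<close> differ; otherwise \<open>m\<close>
    and \<open>y y'\<close> serve.\<close>
  have ex3: "\<exists>p q. p \<in> S <#> S \<and> q \<in> S <#> S \<and> p \<noteq> q \<and> p \<notin> T <#> T \<and> q \<notin> T <#> T
    \<and> p \<lless> y \<otimes> y \<and> q \<lless> y \<otimes> y"
  proof (cases "y' = z")
    case True
    have "r = y" using r y' True less_asym[of z r] by (auto simp: T_def)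
    then have "z \<otimes> y \<noteq> y \<otimes> z" using r by simp
    moreover have "z \<otimes> y \<notin> T <#> T" "y \<otimes> z \<notin> T <#> T" using y'y True less_irrefl by blast+
    ultimately show ?thesis
      using yy z(1) y(1) True
      by (intro exI[of _ "z \<otimes> y"] exI[of _ "y \<otimes> z"]) (auto intro: set_multI)
  next
    case False
    then have zy': "z \<lless> y'" using y'(2) zT by auto
    have "m \<noteq> y \<otimes> y'" using notm[of y y'] y y' zy' zT T by (auto simp: T_def)
    moreover have "m \<lless> y \<otimes> y" using zT T Tc mult_less_left mult_less_right by (auto simp: m_def)
    moreover have "y \<otimes> y' \<notin> T <#> T" using y'y less_irrefl by blast
    moreover have "y \<otimes> y' \<in> S <#> S" using y y' by (auto intro: set_multI simp: T_def)
    ultimately show ?thesis using m_new m_mem yy by blast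
  qed
  then obtain p q where pq: "p \<in> S <#> S" "q \<in> S <#> S" "p \<noteq> q" "p \<notin> T <#> T" "q \<notin> T <#> T"
    "p \<lless> y \<otimes> y" "q \<lless> y \<otimes> y" by blast
  have c3: "card {p, q, y \<otimes> y} = 3" using pq less_irrefl by (metis card_3_iff)
  have "card (T <#> T) + card {p, q, y \<otimes> y} \<le> card (S <#> S)"
  proof (rule card_add_le)
    show "T <#> T \<subseteq> S <#> S" by (rule mono_set_mult) (auto simp: T_def)
    show "{p, q, y \<otimes> y} \<subseteq> S <#> S" using pq y by (auto intro: set_multI)
    show "(T <#> T) \<inter> {p, q, y \<otimes> y} = {}" using pq yy less_irrefl by blast
  qed (use fin in \<open>simp add: finite_set_mult\<close>)
  then show ?thesis using c3 by (simp add: T_def)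
qed

end

section \<open>Commensurable elements and lower bounds for squares\<close>

context group
begin

lemma pow_commute:
  assumes "x \<in> carrier G" "y \<in> carrier G" "x \<otimes> y = y \<otimes> x"
  shows "x [^] (i::int) \<otimes> y = y \<otimes> x [^] i"
proof -
  have "x \<in> {x \<in> carrier G. \<forall>a\<in>{y}. x \<otimes> a = a \<otimes> x}" using assms by auto
  then have "x [^] i \<in> {x \<in> carrier G. \<forall>a\<in>{y}. x \<otimes> a = a \<otimes> x}"
    using subgroup_int_pow_closed[OF subgroup_centralizer] assms by blast
  then show ?thesis by auto
qed

lemma conj_mult:
  assumes "x \<in> carrier G" "y \<in> carrier G" "z \<in> carrier G"
  shows "(y \<otimes> x \<otimes> inv y) \<otimes> (y \<otimes> z \<otimes> inv y) = y \<otimes> (x \<otimes> z) \<otimes> inv y"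
  using assms by (simp add: m_assoc)

lemma conj_pow:
  assumes "x \<in> carrier G" "y \<in> carrier G"
  shows "(y \<otimes> x \<otimes> inv y) [^] (i::int) = y \<otimes> x [^] i \<otimes> inv y"
proof -
  have "(\<lambda>x. y \<otimes> x \<otimes> inv y) \<in> hom G G" using assms by (auto simp: hom_def conj_mult)
  then show ?thesis using hom_int_pow[of "\<lambda>x. y \<otimes> x \<otimes> inv y" G G x i] assms by (simp add: group_axioms is_group)
qed

lemma conj_commute_iff:
  assumes "x \<in> carrier G" "y \<in> carrier G"
  shows "y \<otimes> x \<otimes> inv y = x \<longleftrightarrow> x \<otimes> y = y \<otimes> x"
  using assms by (metis inv_solve_right m_closed)

lemma conj_eq_iff:
  assumes "x \<in> carrier G" "y \<in> carrier G" "z \<in> carrier G"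
  shows "y \<otimes> x \<otimes> inv y = z \<longleftrightarrow> y \<otimes> x = z \<otimes> y"
  using assms by (metis inv_solve_right' m_closed)

text \<open>The isolator of the cyclic group generated by \<open>e\<close>. Only \<open>i\<close>
  has to be nonzero, so the identity belongs to it with \<open>j = 0\<close>. In an ordered group it
  is an abelian subgroup of rank at most one, and it is trivial for
  \<open>e = \<one>\<close>.\<close>

definition isolator :: "'a \<Rightarrow> 'a set" where
  "isolator e = {x \<in> carrier G. \<exists>(i::int) j::int. i \<noteq> 0 \<and> x [^] i = e [^] j}"

lemma isolatorI: "x \<in> carrier G \<Longrightarrow> i \<noteq> 0 \<Longrightarrow> x [^] (i::int) = e [^] (j::int) \<Longrightarrow> x \<in> isolator e"
  by (auto simp: isolator_def)

lemma isolator_self: "e \<in> carrier G \<Longrightarrow> e \<in> isolator e"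
  by (rule isolatorI[where i = 1 and j = 1]) auto

lemma isolator_carrier: "x \<in> isolator e \<Longrightarrow> x \<in> carrier G"
  by (auto simp: isolator_def)

end

section \<open>Uniqueness of roots, isolators and elementary lower bounds\<close>

context ordered_group
begin

lemma pow_strict_mono: "x \<lless> y \<Longrightarrow> x [^] Suc n \<lless> y [^] Suc n"
proof (induction n)
  case 0
  then show ?case using less_carrier[OF 0] by simp
next
  case (Suc n)
  then show ?case using mult_less[of "x [^] Suc n" "y [^] Suc n" x y] by simp
qed

text \<open>Positive powers are strictly monotone; a negative exponent reduces to a positive one by
  inverting both sides.\<close>

lemma pow_inj:
  assumes "x \<in> carrier G" "y \<in> carrier G" "i \<noteq> 0" "x [^] (i::int) = y [^] i"
  shows "x = y"
proof -
  have nat: "x = y" if "x [^] Suc n = y [^] Suc n" for n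
    using less_total[OF assms(1,2)] pow_strict_mono[of x y n] pow_strict_mono[of y x n] that less_irrefl by metis
  obtain n where "i = int (Suc n) \<or> i = - int (Suc n)"
    using assms(3) by (metis int_cases3 Suc_pred)
  then have "x [^] Suc n = y [^] Suc n"
    using assms by (metis int_pow_int int_pow_neg_int inv_inv nat_pow_closed)
  then show ?thesis by (rule nat)
qed

lemma pow_eq_one: "x \<in> carrier G \<Longrightarrow> i \<noteq> 0 \<Longrightarrow> x [^] (i::int) = \<one> \<Longrightarrow> x = \<one>"
  using pow_inj[of x \<one> i] by simp

text \<open>The conjugate of \<open>x\<close> by \<open>y\<close> has the same \<open>i\<close>-th
  power as \<open>x\<close>, so by uniqueness of roots it equals \<open>x\<close>.\<close>

lemma root_commute:
  assumes "x \<in> carrier G" "y \<in> carrier G" "i \<noteq> 0" "x [^] (i::int) \<otimes> y = y \<otimes> x [^] i"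
  shows "x \<otimes> y = y \<otimes> x"
proof -
  have "(y \<otimes> x \<otimes> inv y) [^] i = x [^] i"
    using assms by (simp add: conj_pow conj_commute_iff)
  then have "y \<otimes> x \<otimes> inv y = x" using pow_inj[of "y \<otimes> x \<otimes> inv y" x i] assms by simp
  then show ?thesis using assms by (simp add: conj_commute_iff)
qed

lemma square_commute:
  assumes "x \<in> carrier G" "y \<in> carrier G" "x \<otimes> x \<otimes> y = y \<otimes> (x \<otimes> x)"
  shows "x \<otimes> y = y \<otimes> x"
proof -
  have "x [^] (2::int) = x \<otimes> x" using assms(1) int_pow_mult[of x 1 1] by simp
  then show ?thesis using root_commute[of x y 2] assms by simp
qed

lemma isolator_commute:
  assumes "e \<in> carrier G" "x \<in> isolator e" "y \<in> isolator e"
  shows "x \<otimes> y = y \<otimes> x"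
proof -
  obtain i j :: int where i: "i \<noteq> 0" "x [^] i = e [^] j" "x \<in> carrier G" using assms by (auto simp: isolator_def)
  obtain k l :: int where k: "k \<noteq> 0" "y [^] k = e [^] l" "y \<in> carrier G" using assms by (auto simp: isolator_def)
  have "e [^] j \<otimes> e [^] l = e [^] l \<otimes> e [^] j"
    using assms(1) by (simp add: int_pow_mult [symmetric] add.commute)
  then have "x [^] i \<otimes> y [^] k = y [^] k \<otimes> x [^] i" using i k by simp
  then have "x \<otimes> y [^] k = y [^] k \<otimes> x" using root_commute[of x "y [^] k" i] i(1,3) k(3) by simp
  then show ?thesis using root_commute[of y x k] i k by simp
qed

lemma subgroup_isolator:
  assumes e: "e \<in> carrier G"
  shows "subgroup (isolator e) G"
proof
  show "isolator e \<subseteq> carrier G" by (auto simp: isolator_def)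
  have "\<one> [^] (1::int) = e [^] (0::int)" by simp
  then show "\<one> \<in> isolator e" by (rule isolatorI[rotated 2]) auto
next
  fix x y assume xy: "x \<in> isolator e" "y \<in> isolator e"
  obtain i j :: int where i: "i \<noteq> 0" "x [^] i = e [^] j" "x \<in> carrier G" using xy by (auto simp: isolator_def)
  obtain k l :: int where k: "k \<noteq> 0" "y [^] k = e [^] l" "y \<in> carrier G" using xy by (auto simp: isolator_def)
  have "(x \<otimes> y) [^] (i * k) = x [^] (i * k) \<otimes> y [^] (k * i)"
    using int_pow_mult_distrib[OF isolator_commute[OF e xy]] i(3) k(3) by (simp add: mult.commute)
  also have "\<dots> = (x [^] i) [^] k \<otimes> (y [^] k) [^] i" using i(3) k(3) by (simp add: int_pow_pow)
  also have "\<dots> = e [^] (j * k + l * i)" using i k e by (simp add: int_pow_pow int_pow_mult)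
  finally show "x \<otimes> y \<in> isolator e" using i k by (intro isolatorI) auto
next
  fix x assume "x \<in> isolator e"
  then obtain i j :: int where i: "i \<noteq> 0" "x [^] i = e [^] j" "x \<in> carrier G" by (auto simp: isolator_def)
  then have "inv x [^] i = e [^] (- j)" using e by (simp add: int_pow_inv int_pow_neg)
  then show "inv x \<in> isolator e" using i by (intro isolatorI) auto
qed

text \<open>Every \<open>n\<close> in the isolator has a nonzero power that is a power of
  \<open>g\<close>; nontriviality of \<open>g\<close> makes \<open>j\<close>, hence the exponent
  \<open>k * j\<close>, nonzero.\<close>

lemma isolator_commute_extend:
  assumes e: "e \<in> carrier G" and g: "g \<in> isolator e" "g \<noteq> \<one>" and x: "x \<in> carrier G" "x \<otimes> g = g \<otimes> x"
    and n: "n \<in> isolator e"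
  shows "x \<otimes> n = n \<otimes> x"
proof -
  obtain i j :: int where i: "i \<noteq> 0" "g [^] i = e [^] j" "g \<in> carrier G" using g by (auto simp: isolator_def)
  obtain k l :: int where k: "k \<noteq> 0" "n [^] k = e [^] l" "n \<in> carrier G" using n by (auto simp: isolator_def)
  have "j \<noteq> 0" using pow_eq_one[of g i] i g by auto
  have "n [^] (k * j) = (g [^] i) [^] l"
    by (simp only: int_pow_pow [OF k(3), symmetric] k(2) i(2)) (simp add: e int_pow_pow mult.commute)
  also have "\<dots> = g [^] (i * l)" using i(3) by (simp add: int_pow_pow)
  finally have "n [^] (k * j) \<otimes> x = x \<otimes> n [^] (k * j)"
    using pow_commute[of g x "i * l"] x i by simp
  then have "n \<otimes> x = x \<otimes> n" using root_commute[of n x "k * j"] k \<open>j \<noteq> 0\<close> x by simp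
  then show ?thesis by simp
qed

text \<open>A nonzero power of \<open>n\<close> is a power of \<open>g\<close>, so conjugation by
  \<open>x\<close> turns it into a power of \<open>h\<close>. Thus the conjugate of \<open>n\<close>
  is a root of an element commensurable with \<open>e\<close>.\<close>

lemma isolator_normalize:
  assumes e: "e \<in> carrier G" and g: "g \<in> isolator e" "g \<noteq> \<one>" and h: "h \<in> isolator e"
    and x: "x \<in> carrier G" "x \<otimes> g = h \<otimes> x" and n: "n \<in> isolator e"
  shows "x \<otimes> n \<otimes> inv x \<in> isolator e"
proof -
  obtain i j :: int where i: "i \<noteq> 0" "g [^] i = e [^] j" "g \<in> carrier G" using g by (auto simp: isolator_def)
  obtain k l :: int where k: "k \<noteq> 0" "n [^] k = e [^] l" "n \<in> carrier G" using n by (auto simp: isolator_def)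
  obtain p q :: int where p: "p \<noteq> 0" "h [^] p = e [^] q" "h \<in> carrier G" using h by (auto simp: isolator_def)
  have j: "j \<noteq> 0" using pow_eq_one[of g i] i g by auto
  have xg: "x \<otimes> g \<otimes> inv x = h" using x i p conj_eq_iff by blast
  have "n [^] (k * j) = (e [^] l) [^] j" by (simp only: int_pow_pow [OF k(3), symmetric] k(2))
  also have "\<dots> = (e [^] j) [^] l" using e by (simp add: int_pow_pow mult.commute)
  also have "\<dots> = g [^] (i * l)" by (simp only: int_pow_pow [OF i(3), symmetric] i(2))
  finally have nk: "n [^] (k * j) = g [^] (i * l)" .
  have "(x \<otimes> n \<otimes> inv x) [^] (k * j) = (x \<otimes> g \<otimes> inv x) [^] (i * l)"
    using nk i(3) k(3) x(1) by (simp add: conj_pow)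
  then have "(x \<otimes> n \<otimes> inv x) [^] (k * j) = h [^] (i * l)" using xg by simp
  then have "((x \<otimes> n \<otimes> inv x) [^] (k * j)) [^] p = (h [^] (i * l)) [^] p" by simp
  also have "\<dots> = (h [^] p) [^] (i * l)" using p(3) by (simp add: int_pow_pow mult.commute)
  also have "\<dots> = e [^] (q * (i * l))" using p e by (simp add: int_pow_pow)
  finally have "(x \<otimes> n \<otimes> inv x) [^] (k * j * p) = e [^] (q * (i * l))"
    using k(3) x(1) by (simp add: int_pow_pow)
  then show ?thesis using k(1,3) j p(1) x(1) by (intro isolatorI[where i = "k * j * p"]) auto
qed

text \<open>Removing the maximum \<open>y\<close> loses \<open>y y'\<close> and \<open>y y\<close>,
  where \<open>y'\<close> is the second largest element: both exceed all remaining products.\<close>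

lemma square_card_ge:
  assumes "finite S" "S \<noteq> {}" "S \<subseteq> carrier G"
  shows "2 * card S \<le> card (S <#> S) + 1"
  using assms
proof (induction "card S" arbitrary: S rule: less_induct)
  case less
  obtain y where y: "y \<in> S" "\<forall>x\<in>S - {y}. x \<lless> y" using ex_max[OF less.prems] by blast
  define T where "T = S - {y}"
  have Tc: "finite T" "T \<subseteq> carrier G" "y \<in> carrier G" "card S = card T + 1"
    using less.prems y card.remove[of S y] by (auto simp: T_def)
  show ?case
  proof (cases "T = {}")
    case True
    then have "S = {y}" using y by (auto simp: T_def)
    then show ?thesis by (simp add: set_mult_def)
  next
    case False
    obtain y' where y': "y' \<in> T" "\<forall>x\<in>T - {y'}. x \<lless> y'" using ex_max[OF Tc(1) False Tc(2)] by blast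
    have IH: "2 * card T \<le> card (T <#> T) + 1" using less.hyps[of T] Tc False by auto
    have y'y: "y' \<lless> y" using y' y by (auto simp: T_def)
    then have neq: "y \<otimes> y' \<noteq> y \<otimes> y" using mult_less_left Tc less_irrefl by metis
    have new: "x \<lless> y \<otimes> y'" if x: "x \<in> T <#> T" for x
    proof -
      obtain u v where uv: "u \<in> T" "v \<in> T" "x = u \<otimes> v" using x by (rule set_multE)
      then show ?thesis using mult_less_le[of u y v y'] y y' Tc by (auto simp: T_def)
    qed
    have new2: "x \<lless> y \<otimes> y" if "x \<in> T <#> T" for x
      using new[OF that] mult_less_left[OF y'y, of y] Tc less_trans by blast
    have notin: "y \<otimes> y' \<notin> T <#> T" "y \<otimes> y \<notin> T <#> T"
      using new new2 less_irrefl by (metis, metis)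
    have "card (T <#> T) + card {y \<otimes> y', y \<otimes> y} \<le> card (S <#> S)"
    proof (rule card_add_le)
      show "T <#> T \<subseteq> S <#> S" by (rule mono_set_mult) (auto simp: T_def)
      show "{y \<otimes> y', y \<otimes> y} \<subseteq> S <#> S" using y y' by (auto simp: T_def intro: set_multI)
      show "(T <#> T) \<inter> {y \<otimes> y', y \<otimes> y} = {}" using notin by auto
    qed (use less.prems in \<open>simp add: finite_set_mult\<close>)
    then show ?thesis using IH Tc neq by simp
  qed
qed

text \<open>Conjugation by \<open>y\<close> preserves the order and permutes the finite chain
  \<open>T\<close>, so it fixes every element. Concretely, the largest moved \<open>m\<close> would
  have both its image \<open>p\<close> and its preimage \<open>q\<close> below \<open>m\<close>,
  which is contradictory.\<close>

lemma conj_permutes_imp_commute: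
  assumes T: "finite T" "T \<subseteq> carrier G" and y: "y \<in> carrier G"
    and eq: "(\<lambda>t. y \<otimes> t) ` T = (\<lambda>t. t \<otimes> y) ` T" and t: "t \<in> T"
  shows "y \<otimes> t = t \<otimes> y"
proof (rule ccontr)
  assume "y \<otimes> t \<noteq> t \<otimes> y"
  then obtain m where m: "m \<in> T" "y \<otimes> m \<noteq> m \<otimes> y"
    and mx: "\<And>x. x \<in> T \<Longrightarrow> m \<lless> x \<Longrightarrow> y \<otimes> x = x \<otimes> y"
    using ex_max_satisfying[where P = "\<lambda>t. y \<otimes> t \<noteq> t \<otimes> y", OF T t] by metis
  obtain p where p: "p \<in> T" "y \<otimes> m = p \<otimes> y" using eq m(1) by blast
  obtain q where q: "q \<in> T" "m \<otimes> y = y \<otimes> q" using eq m(1) by blast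
  have c: "m \<in> carrier G" "p \<in> carrier G" "q \<in> carrier G" using m p q T by auto
  have "p \<noteq> m" "q \<noteq> m" using m p q by auto
  have "\<not> m \<lless> p" using mx[of p] p c y \<open>p \<noteq> m\<close> by (metis l_cancel)
  then have "p \<lless> m" using less_total[of p m] c \<open>p \<noteq> m\<close> by blast
  then have "p \<otimes> y \<lless> m \<otimes> y" using y mult_less_right by blast
  then have "y \<otimes> m \<lless> y \<otimes> q" using p q by simp
  moreover have "\<not> m \<lless> q" using mx[of q] q c y \<open>q \<noteq> m\<close> by (metis r_cancel)
  then have "q \<lless> m" using less_total[of q m] c \<open>q \<noteq> m\<close> by blast
  then have "y \<otimes> q \<lless> y \<otimes> m" using y mult_less_left by blast
  ultimately show False using less_asym by blast
qed

lemma inj_on_mult: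
  assumes "T \<subseteq> carrier G" "y \<in> carrier G"
  shows "inj_on (\<lambda>t. y \<otimes> t) T" "inj_on (\<lambda>t. t \<otimes> y) T"
  using assms by (auto simp: inj_on_def subset_iff)

text \<open>Both translates have \<open>card T\<close> elements, so a union of that size would make
  them equal.\<close>

lemma card_translates_ge:
  assumes T: "finite T" "T \<subseteq> carrier G" and y: "y \<in> carrier G" and t: "t \<in> T" "y \<otimes> t \<noteq> t \<otimes> y"
  shows "card T + 1 \<le> card ((\<lambda>t. y \<otimes> t) ` T \<union> (\<lambda>t. t \<otimes> y) ` T)"
proof (rule ccontr)
  let ?A = "(\<lambda>t. y \<otimes> t) ` T" and ?B = "(\<lambda>t. t \<otimes> y) ` T"
  assume "\<not> ?thesis"
  then have le: "card (?A \<union> ?B) \<le> card T" by simp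
  have "card ?A = card T" "card ?B = card T" using inj_on_mult[OF T(2) y] by (auto simp: card_image)
  moreover have "finite (?A \<union> ?B)" using T by simp
  ultimately have "?A = ?A \<union> ?B" "?B = ?A \<union> ?B"
    using card_seteq[of "?A \<union> ?B" ?A] card_seteq[of "?A \<union> ?B" ?B] le by (metis Un_upper1, metis Un_upper2)
  then have "?A = ?B" by metis
  then show False using conj_permutes_imp_commute[OF T y] t by blast
qed

text \<open>All products from \<open>L\<close> lie in an abelian subgroup. It contains neither
  \<open>y\<close> nor, by uniqueness of square roots, \<open>y y\<close>; hence the translates of
  \<open>L\<close> by \<open>y\<close> and the square of \<open>y\<close> are new.\<close>

lemma square_insert_commuting:
  assumes L: "finite L" "L \<subseteq> carrier G" "pairwise_commute G L" and y: "y \<in> carrier G"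
    and nc: "\<not> pairwise_commute G (insert y L)"
  shows "card (L <#> L) + card ((\<lambda>t. y \<otimes> t) ` L \<union> (\<lambda>t. t \<otimes> y) ` L) + 1
    \<le> card (insert y L <#> insert y L)"
proof -
  let ?Y = "(\<lambda>t. y \<otimes> t) ` L \<union> (\<lambda>t. t \<otimes> y) ` L"
  obtain l where l: "l \<in> L" "y \<otimes> l \<noteq> l \<otimes> y" using nc L(3) by (auto simp: pairwise_commute_def)
  have gen: "g \<otimes> l = l \<otimes> g" if "g \<in> generate G L" for g
    using generate_commute[OF L(2,3) that, of l] l by (auto intro: generate.incl)
  have yg: "y \<notin> generate G L" using gen l by blast
  have yy: "y \<otimes> y \<notin> generate G L"
    using gen[of "y \<otimes> y"] square_commute[of y l] l y L by auto
  have LL: "L <#> L \<subseteq> generate G L"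
    by (auto elim!: set_multE intro: generate.eng generate.incl)
  have Y: "?Y \<inter> generate G L = {}"
  proof -
    have "y \<otimes> t \<notin> generate G L \<and> t \<otimes> y \<notin> generate G L" if t: "t \<in> L" for t
      using generate_cancel[OF L(2) generate.incl[OF t] y] yg by blast
    then show ?thesis by auto
  qed
  have yyY: "y \<otimes> y \<notin> ?Y"
  proof
    assume "y \<otimes> y \<in> ?Y"
    then have "y \<in> L" using y L by (auto simp: subset_iff)
    then show False using yg generate.incl by fast
  qed
  have Yfin: "finite ?Y" using L by simp
  have "card (L <#> L) + card (insert (y \<otimes> y) ?Y) \<le> card (insert y L <#> insert y L)"
  proof (rule card_add_le)
    show "L <#> L \<subseteq> insert y L <#> insert y L" by (rule mono_set_mult) auto
    show "insert (y \<otimes> y) ?Y \<subseteq> insert y L <#> insert y L" by (auto intro: set_multI)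
    show "(L <#> L) \<inter> insert (y \<otimes> y) ?Y = {}" using LL Y yy by blast
  qed (use L in \<open>simp add: finite_set_mult\<close>)
  then show ?thesis using yyY Yfin by simp
qed

text \<open>This is \<open>d(S) \<ge> 0\<close>. Removing maxima never increases \<open>d\<close>
  while the rest does not commute; once the rest \<open>T\<close> commutes, the count is
  \<open>(2|T| - 1) + (|T| + 1) + 1 = 3|S| - 2\<close>.\<close>

lemma noncommuting_square_card:
  assumes "finite S" "S \<subseteq> carrier G" "\<not> pairwise_commute G S"
  shows "3 * card S \<le> card (S <#> S) + 2"
  using assms
proof (induction "card S" arbitrary: S rule: less_induct)
  case less
  have "S \<noteq> {}" using less.prems by (auto simp: pairwise_commute_def)
  then obtain y where y: "y \<in> S" "\<forall>x\<in>S - {y}. x \<lless> y" using ex_max[OF less.prems(1) _ less.prems(2)] by blast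
  define T where "T = S - {y}"
  have Tc: "finite T" "T \<subseteq> carrier G" "y \<in> carrier G" "S = insert y T" "card S = card T + 1"
    using less.prems y card.remove[of S y] by (auto simp: T_def)
  show ?case
  proof (cases "pairwise_commute G T")
    case True
    obtain t where t: "t \<in> T" "y \<otimes> t \<noteq> t \<otimes> y"
      using True less.prems Tc by (auto simp: pairwise_commute_def)
    have "card (T <#> T) + card ((\<lambda>t. y \<otimes> t) ` T \<union> (\<lambda>t. t \<otimes> y) ` T) + 1 \<le> card (S <#> S)"
      using square_insert_commuting[of T y] Tc True less.prems by simp
    moreover have "card T + 1 \<le> card ((\<lambda>t. y \<otimes> t) ` T \<union> (\<lambda>t. t \<otimes> y) ` T)"
      using card_translates_ge Tc t by blast
    moreover have "2 * card T \<le> card (T <#> T) + 1" using square_card_ge[of T] Tc t by auto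
    ultimately show ?thesis using Tc by simp
  next
    case False
    have "card (T <#> T) + 3 \<le> card (S <#> S)"
      using square_remove_max[of S y] less.prems y by (simp add: T_def)
    then show ?thesis using less.hyps[of T] Tc False by simp
  qed
qed

text \<open>A coincidence \<open>yt = uv\<close> would put \<open>y\<close> into the subgroup
  generated by the rest. The square \<open>y y\<close> may lie in that subgroup, so it is separated
  by the order instead.\<close>

lemma square_remove_max_outside:
  assumes S: "finite S" "S \<subseteq> carrier G" and y: "y \<in> S" "\<And>x. x \<in> S - {y} \<Longrightarrow> x \<lless> y"
    and out: "y \<notin> generate G (S - {y})"
  shows "card ((S - {y}) <#> (S - {y})) + card S \<le> card (S <#> S)"
proof -
  define T where "T = S - {y}"
  have Tc: "finite T" "T \<subseteq> carrier G" "y \<in> carrier G" "S = insert y T" "y \<notin> generate G T"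
    "card S = card T + 1"
    using S y out card.remove[of S y] by (auto simp: T_def)
  let ?Y = "(\<lambda>t. y \<otimes> t) ` T"
  have yy: "y \<otimes> y \<notin> ?Y \<and> y \<otimes> y \<notin> T <#> T"
  proof -
    have "x \<lless> y \<otimes> y" if "x \<in> ?Y \<or> x \<in> T <#> T" for x
      using that
    proof
      assume "x \<in> T <#> T"
      then obtain u v where "u \<in> T" "v \<in> T" "x = u \<otimes> v" by (rule set_multE)
      then show ?thesis using y(2) mult_less by (auto simp: T_def)
    qed (use y(2) Tc(3) mult_less_left in \<open>auto simp: T_def\<close>)
    then show ?thesis using less_irrefl by metis
  qed
  have Y: "(T <#> T) \<inter> ?Y = {}"
  proof -
    have "y \<otimes> t \<noteq> u \<otimes> v" if "t \<in> T" "u \<in> T" "v \<in> T" for t u v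
      using generate_quotient[OF Tc(2), of u v t y] that Tc(3,5) generate.incl[of _ T G] by blast
    then show ?thesis by (fastforce elim!: set_multE)
  qed
  have "card (T <#> T) + card (insert (y \<otimes> y) ?Y) \<le> card (S <#> S)"
  proof (rule card_add_le)
    show "T <#> T \<subseteq> S <#> S" by (rule mono_set_mult) (auto simp: T_def)
    show "insert (y \<otimes> y) ?Y \<subseteq> S <#> S" using y(1) by (auto intro: set_multI simp: T_def)
    show "(T <#> T) \<inter> insert (y \<otimes> y) ?Y = {}" using Y yy by blast
  qed (use S in \<open>simp add: finite_set_mult\<close>)
  moreover have "card (insert (y \<otimes> y) ?Y) = card T + 1"
    using yy inj_on_mult(1)[OF Tc(2,3)] Tc(1) by (simp add: card_image)
  ultimately show ?thesis using Tc(6) by (simp add: T_def)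
qed

end

section \<open>A certificate for metabelian subgroups of class at most two\<close>

context group
begin

text \<open>Both conjugations are required because \<open>x N inv x \<subseteq> N\<close> alone is
  not inherited by inverses when \<open>N\<close> is infinite, as Baumslag-Solitar groups
  show.\<close>

lemma subgroup_normalizer:
  assumes N: "subgroup N G"
  shows "subgroup {x \<in> carrier G. \<forall>n\<in>N. x \<otimes> n \<otimes> inv x \<in> N \<and> inv x \<otimes> n \<otimes> x \<in> N} G"
    (is "subgroup ?M G")
proof
  fix x y assume xy: "x \<in> ?M" "y \<in> ?M"
  then have c: "x \<in> carrier G" "y \<in> carrier G" by auto
  have "x \<otimes> y \<otimes> n \<otimes> inv (x \<otimes> y) \<in> N \<and> inv (x \<otimes> y) \<otimes> n \<otimes> (x \<otimes> y) \<in> N" if n: "n \<in> N" for n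
  proof -
    have nc: "n \<in> carrier G" using n N subgroup.mem_carrier by fast
    have "x \<otimes> y \<otimes> n \<otimes> inv (x \<otimes> y) = x \<otimes> (y \<otimes> n \<otimes> inv y) \<otimes> inv x"
      using c nc by (simp add: inv_mult_group m_assoc)
    moreover have "inv (x \<otimes> y) \<otimes> n \<otimes> (x \<otimes> y) = inv y \<otimes> (inv x \<otimes> n \<otimes> x) \<otimes> y"
      using c nc by (simp add: inv_mult_group m_assoc)
    ultimately show ?thesis using xy n by auto
  qed
  then show "x \<otimes> y \<in> ?M" using c by auto
next
  show "\<one> \<in> ?M" using N subgroup.mem_carrier by fastforce
qed auto

text \<open>The centraliser of \<open>h\<close> modulo \<open>N\<close>. Closure rests on
  \<open>[xy, h] = x [y, h] inv x [x, h]\<close>, whose first factor stays in \<open>N\<close>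
  because \<open>M\<close> normalises \<open>N\<close>.\<close>

lemma subgroup_commute_modulo:
  assumes N: "subgroup N G" and M: "subgroup M G"
    and norm: "\<And>x n. x \<in> M \<Longrightarrow> n \<in> N \<Longrightarrow> x \<otimes> n \<otimes> inv x \<in> N" and h: "h \<in> M"
  shows "subgroup {g \<in> M. g \<otimes> h \<otimes> inv g \<otimes> inv h \<in> N} G" (is "subgroup ?C G")
proof
  have Mc: "x \<in> carrier G" if "x \<in> M" for x using that M subgroup.mem_carrier by fast
  show "?C \<subseteq> carrier G" using Mc by auto
  show "\<one> \<in> ?C" using Mc h M N by (auto simp: subgroup.one_closed)
  have hc: "h \<in> carrier G" using Mc h by auto
  fix x assume x: "x \<in> ?C"
  then have xc: "x \<in> carrier G" using Mc by auto
  have "inv x \<otimes> inv (x \<otimes> h \<otimes> inv x \<otimes> inv h) \<otimes> inv (inv x) \<in> N"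
    using x norm[of "inv x"] subgroup.m_inv_closed[OF M] subgroup.m_inv_closed[OF N] by blast
  moreover have "inv x \<otimes> inv (x \<otimes> h \<otimes> inv x \<otimes> inv h) \<otimes> inv (inv x) = inv x \<otimes> h \<otimes> inv (inv x) \<otimes> inv h"
    using xc hc by (simp add: inv_mult_group m_assoc)
  ultimately show "inv x \<in> ?C" using x subgroup.m_inv_closed[OF M] by simp
  fix y assume y: "y \<in> ?C"
  then have yc: "y \<in> carrier G" using Mc by auto
  have "x \<otimes> (y \<otimes> h \<otimes> inv y \<otimes> inv h) \<otimes> inv x \<otimes> (x \<otimes> h \<otimes> inv x \<otimes> inv h) \<in> N"
    using x y norm subgroup.m_closed[OF N] by blast
  moreover have "x \<otimes> (y \<otimes> h \<otimes> inv y \<otimes> inv h) \<otimes> inv x \<otimes> (x \<otimes> h \<otimes> inv x \<otimes> inv h)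
    = x \<otimes> y \<otimes> h \<otimes> inv (x \<otimes> y) \<otimes> inv h"
    using xc yc hc by (simp add: inv_mult_group m_assoc)
  ultimately show "x \<otimes> y \<in> ?C" using x y subgroup.m_closed[OF M] by simp
qed

lemma subgroup_lower_central: "subgroup (lower_central G n) G"
proof (induction n)
  case (Suc n)
  have "(\<Union>x \<in> lower_central G n. \<Union>g \<in> carrier G. {x \<otimes> g \<otimes> inv x \<otimes> inv g}) \<subseteq> carrier G"
    using subgroup.mem_carrier[OF Suc] by auto
  then show ?case using generate_is_subgroup by simp
qed (simp add: subgroup_self)

lemma lower_central_commutator:
  "x \<in> lower_central G n \<Longrightarrow> g \<in> carrier G \<Longrightarrow> x \<otimes> g \<otimes> inv x \<otimes> inv g \<in> lower_central G (Suc n)"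
  unfolding lower_central.simps(2) by (rule generate.incl) blast

text \<open>
  The data \<open>N\<close> witnesses both conclusions of the theorem and, unlike these, is inherited by the
  generated subgroup directly from a generating set.
\<close>

definition tame :: "'a set \<Rightarrow> bool" where
  "tame S \<longleftrightarrow> (\<exists>N. subgroup N G \<and> pairwise_commute G N
    \<and> (\<forall>x\<in>S. \<forall>n\<in>N. x \<otimes> n \<otimes> inv x \<in> N \<and> inv x \<otimes> n \<otimes> x \<in> N)
    \<and> (\<forall>x\<in>S. \<forall>y\<in>S. x \<otimes> y \<otimes> inv x \<otimes> inv y \<in> N)
    \<and> (nilpotent_group G \<longrightarrow> (\<forall>x\<in>S. \<forall>n\<in>N. x \<otimes> n = n \<otimes> x)))"

lemma tame_subset:
  assumes "tame T" "S \<subseteq> T"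
  shows "tame S"
proof -
  obtain N where N: "subgroup N G" "pairwise_commute G N"
    "\<forall>x\<in>T. \<forall>n\<in>N. x \<otimes> n \<otimes> inv x \<in> N \<and> inv x \<otimes> n \<otimes> x \<in> N"
    "\<forall>x\<in>T. \<forall>y\<in>T. x \<otimes> y \<otimes> inv x \<otimes> inv y \<in> N"
    "nilpotent_group G \<longrightarrow> (\<forall>x\<in>T. \<forall>n\<in>N. x \<otimes> n = n \<otimes> x)"
    using assms(1) unfolding tame_def by blast
  show ?thesis
    unfolding tame_def by (rule exI[of _ N], intro conjI) (use N assms(2) in blast)+
qed

text \<open>Centralisers modulo \<open>N\<close> are subgroups, so the commutator condition passes
  from \<open>S\<close> to the generated subgroup in one argument at a time; \<open>sym\<close>
  exchanges the arguments by inverting the commutator.\<close>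

lemma tame_generate:
  assumes S: "S \<subseteq> carrier G" and "tame S"
  shows "tame (generate G S)"
proof -
  obtain N where N: "subgroup N G" "pairwise_commute G N"
    and norm: "\<forall>x\<in>S. \<forall>n\<in>N. x \<otimes> n \<otimes> inv x \<in> N \<and> inv x \<otimes> n \<otimes> x \<in> N"
    and com: "\<forall>x\<in>S. \<forall>y\<in>S. x \<otimes> y \<otimes> inv x \<otimes> inv y \<in> N"
    and cen: "nilpotent_group G \<longrightarrow> (\<forall>x\<in>S. \<forall>n\<in>N. x \<otimes> n = n \<otimes> x)"
    using \<open>tame S\<close> unfolding tame_def by blast
  have Nc: "N \<subseteq> carrier G" using N(1) subgroup.subset by blast
  define M where "M = {x \<in> carrier G. \<forall>n\<in>N. x \<otimes> n \<otimes> inv x \<in> N \<and> inv x \<otimes> n \<otimes> x \<in> N}"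
  have M: "subgroup M G" unfolding M_def by (rule subgroup_normalizer[OF N(1)])
  have SM: "S \<subseteq> M" using S norm by (auto simp: M_def)
  have genM: "generate G S \<subseteq> M" by (rule generate_subgroup_incl[OF SM M])
  have C: "subgroup {g \<in> M. g \<otimes> h \<otimes> inv g \<otimes> inv h \<in> N} G" if "h \<in> M" for h
    by (rule subgroup_commute_modulo[OF N(1) M _ that]) (auto simp: M_def)
  have sym: "h \<otimes> g \<otimes> inv h \<otimes> inv g \<in> N" if "g \<otimes> h \<otimes> inv g \<otimes> inv h \<in> N" "g \<in> M" "h \<in> M" for g h
  proof -
    have "g \<in> carrier G" "h \<in> carrier G" using that by (auto simp: M_def)
    then have "inv (g \<otimes> h \<otimes> inv g \<otimes> inv h) = h \<otimes> g \<otimes> inv h \<otimes> inv g"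
      by (simp add: inv_mult_group m_assoc)
    then show ?thesis using subgroup.m_inv_closed[OF N(1) that(1)] by simp
  qed
  have 1: "g \<otimes> h \<otimes> inv g \<otimes> inv h \<in> N" if "g \<in> generate G S" "h \<in> S" for g h
  proof -
    have "S \<subseteq> {g \<in> M. g \<otimes> h \<otimes> inv g \<otimes> inv h \<in> N}" using com SM that by blast
    then have "generate G S \<subseteq> {g \<in> M. g \<otimes> h \<otimes> inv g \<otimes> inv h \<in> N}"
      using generate_subgroup_incl C that SM by blast
    then show ?thesis using that by blast
  qed
  have 2: "g \<otimes> h \<otimes> inv g \<otimes> inv h \<in> N" if "g \<in> generate G S" "h \<in> generate G S" for g h
  proof -
    have "S \<subseteq> {h \<in> M. h \<otimes> g \<otimes> inv h \<otimes> inv g \<in> N}" using 1 sym that SM genM by blast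
    then have "generate G S \<subseteq> {h \<in> M. h \<otimes> g \<otimes> inv h \<otimes> inv g \<in> N}"
      using generate_subgroup_incl C that genM by blast
    then show ?thesis using that sym genM by blast
  qed
  have 3: "\<forall>x\<in>generate G S. \<forall>n\<in>N. x \<otimes> n = n \<otimes> x" if nil: "nilpotent_group G"
  proof (intro ballI)
    fix x n assume x: "x \<in> generate G S" and n: "n \<in> N"
    show "x \<otimes> n = n \<otimes> x"
      by (rule commute_generate[OF _ S _ x]) (use n nil cen Nc in auto)
  qed
  show ?thesis
    unfolding tame_def
    by (rule exI[of _ N]) (use N 2 3 genM in \<open>auto simp: M_def\<close>)
qed

lemma tame_lift:
  assumes "T \<subseteq> carrier G" "tame T" "S \<subseteq> generate G T"
  shows "tame S"
  using tame_subset[OF tame_generate[OF assms(1,2)] assms(3)] .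

lemma tame_pairwise_commute:
  assumes "S \<subseteq> carrier G" "pairwise_commute G S"
  shows "tame S"
proof -
  have "x \<otimes> y \<otimes> inv x \<otimes> inv y = \<one>" if "x \<in> S" "y \<in> S" for x y
  proof -
    have c: "x \<in> carrier G" "y \<in> carrier G" using that assms by auto
    have "x \<otimes> y = y \<otimes> x" using that assms by (auto simp: pairwise_commute_def)
    then show ?thesis using c by (simp add: m_assoc)
  qed
  then show ?thesis
    unfolding tame_def
    by (intro exI[of _ "{\<one>}"]) (use assms triv_subgroup in \<open>auto simp: pairwise_commute_def subset_iff\<close>)
qed

text \<open>The derived subgroup of \<open>H\<close> lies in the abelian group
  \<open>N \<inter> H\<close>; the intersection is taken since \<open>N\<close> need not be
  contained in \<open>H\<close>. If \<open>G\<close> is nilpotent, \<open>H\<close> centralises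
  \<open>N\<close>, so commutators of weight three vanish.\<close>

lemma tame_subgroup:
  assumes H: "subgroup H G" and "tame H"
  shows "metabelian (G\<lparr>carrier := H\<rparr>)"
    and "nilpotent_group G \<Longrightarrow> nilpotent_group (G\<lparr>carrier := H\<rparr>) \<and> nilpotency_class (G\<lparr>carrier := H\<rparr>) \<le> 2"
proof -
  let ?H = "G\<lparr>carrier := H\<rparr>"
  have grp: "group ?H" by (rule subgroup_imp_group[OF H])
  have invH: "inv\<^bsub>?H\<^esub> x = inv x" if "x \<in> H" for x using m_inv_consistent[OF H that] .
  obtain N where N: "subgroup N G" "pairwise_commute G N"
    and com: "\<forall>x\<in>H. \<forall>y\<in>H. x \<otimes> y \<otimes> inv x \<otimes> inv y \<in> N"
    and cen: "nilpotent_group G \<longrightarrow> (\<forall>x\<in>H. \<forall>n\<in>N. x \<otimes> n = n \<otimes> x)"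
    using \<open>tame H\<close> unfolding tame_def by blast
  have Nc: "N \<subseteq> carrier G" using N(1) subgroup.subset by blast
  have NH: "subgroup (N \<inter> H) ?H"
    using subgroup_incl[OF subgroups_Inter_pair[OF N(1) H] H] by simp
  have D: "derived ?H H \<subseteq> N \<inter> H"
  proof -
    have "derived_set ?H H \<subseteq> N \<inter> H"
      using com invH H by (auto simp: subgroup.m_closed subgroup.m_inv_closed)
    then show ?thesis unfolding derived_def by (rule group.generate_subgroup_incl[OF grp _ NH])
  qed
  have sub: "subgroup (derived ?H H) ?H"
    unfolding derived_def using group.generate_is_subgroup[OF grp group.derived_set_in_carrier[OF grp]] by simp
  have "group (?H\<lparr>carrier := derived ?H H\<rparr>)"
    by (rule group.subgroup_imp_group[OF grp sub])
  then have "comm_group (?H\<lparr>carrier := derived ?H H\<rparr>)"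
    by (rule group.group_comm_groupI) (use D N in \<open>auto simp: pairwise_commute_def\<close>)
  then show "metabelian ?H" using grp by (simp add: metabelian_def)
  assume nil: "nilpotent_group G"
  have one: "lower_central ?H (Suc 0) = derived ?H H" using lower_central_1[of ?H] by simp
  have "x \<otimes> g \<otimes> inv x \<otimes> inv g = \<one>" if "x \<in> derived ?H H" "g \<in> H" for x g
  proof -
    have "x \<in> N" "x \<in> H" using that D by auto
    then have "x \<otimes> g = g \<otimes> x" using cen nil that by metis
    then have "x \<otimes> g \<otimes> inv x \<otimes> inv g = g \<otimes> x \<otimes> inv x \<otimes> inv g" by simp
    also have "\<dots> = \<one>"
      using subgroup.mem_carrier[OF H \<open>x \<in> H\<close>] subgroup.mem_carrier[OF H that(2)] by (simp add: m_assoc)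
    finally show ?thesis .
  qed
  note trivial = this
  have "(\<Union>x \<in> lower_central ?H (Suc 0). \<Union>g \<in> carrier ?H.
      {x \<otimes>\<^bsub>?H\<^esub> g \<otimes>\<^bsub>?H\<^esub> inv\<^bsub>?H\<^esub> x \<otimes>\<^bsub>?H\<^esub> inv\<^bsub>?H\<^esub> g}) \<subseteq> {\<one>}"
    unfolding one
  proof (intro UN_least)
    fix x g assume x: "x \<in> derived ?H H" and g: "g \<in> carrier ?H"
    then have "x \<in> H" "g \<in> H" using D by auto
    then show "{x \<otimes>\<^bsub>?H\<^esub> g \<otimes>\<^bsub>?H\<^esub> inv\<^bsub>?H\<^esub> x \<otimes>\<^bsub>?H\<^esub> inv\<^bsub>?H\<^esub> g} \<subseteq> {\<one>}"
      using invH trivial[OF x] by simp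
  qed
  note comm = this
  have "subgroup {\<one>} ?H" using group.triv_subgroup[OF grp] by simp
  \<comment> \<open>The series is indexed from 0, so index 2 is the third term in the usual
    numbering and its triviality means class at most 2.\<close>
  then have "lower_central ?H (Suc (Suc 0)) \<subseteq> {\<one>}"
    unfolding lower_central.simps(2)[of ?H "Suc 0"]
    by (rule group.generate_subgroup_incl[OF grp comm])
  moreover have "\<one> \<in> lower_central ?H (Suc (Suc 0))"
    unfolding lower_central.simps(2)[of ?H "Suc 0"] using generate.one[of ?H] by simp
  ultimately have "lower_central ?H 2 = {\<one>}" unfolding numeral_2_eq_2 by blast
  then have two: "lower_central ?H 2 = {\<one>\<^bsub>?H\<^esub>}" by (simp del: lower_central.simps)
  then have "nilpotent_group ?H" unfolding nilpotent_group_def using grp by blast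
  moreover have "nilpotency_class ?H \<le> 2"
    unfolding nilpotency_class_def using two by (rule Least_le)
  ultimately show "nilpotent_group ?H \<and> nilpotency_class ?H \<le> 2" ..
qed

end

context ordered_group
begin

text \<open>The commutator of \<open>e [^] (u * k)\<close> with \<open>x\<close> is
  \<open>e [^] ((u - v) * k)\<close>, so each step down the lower central series multiplies the
  exponent by \<open>w = u - v\<close>. The free factor \<open>m\<close> is needed because the step
  uses the induction hypothesis at \<open>u * m\<close>. At the trivial term, torsion-freeness
  forces \<open>w = 0\<close>.\<close>

lemma nilpotent_conj_pow:
  assumes nil: "nilpotent_group G" and e: "e \<in> carrier G" "e \<noteq> \<one>" and x: "x \<in> carrier G"
    and rel: "x \<otimes> e [^] (u::int) = e [^] (v::int) \<otimes> x"
  shows "u = v"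
proof -
  define w where "w = u - v"
  have mem: "e [^] (w ^ n * m) \<in> lower_central G n" for n m
  proof (induction n arbitrary: m)
    case (Suc n)
    define k where "k = w ^ n * m"
    have "e [^] (u * k) \<in> lower_central G n" using Suc[of "u * m"] by (simp add: k_def mult.left_commute)
    then have "e [^] (u * k) \<otimes> x \<otimes> inv (e [^] (u * k)) \<otimes> inv x \<in> lower_central G (Suc n)"
      using lower_central_commutator x by blast
    moreover have "x \<otimes> e [^] (- u * k) \<otimes> inv x = e [^] (- v * k)"
    proof -
      have "x \<otimes> e [^] u \<otimes> inv x = e [^] v" using rel e x by (intro iffD2[OF conj_eq_iff]) auto
      then have "(x \<otimes> e [^] u \<otimes> inv x) [^] (- k) = (e [^] v) [^] (- k)" by simp
      then have "x \<otimes> (e [^] u) [^] (- k) \<otimes> inv x = (e [^] v) [^] (- k)"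
        using conj_pow[of "e [^] u" x "- k"] e x by simp
      then show ?thesis using e by (simp add: int_pow_pow)
    qed
    ultimately have "e [^] (u * k) \<otimes> e [^] (- v * k) \<in> lower_central G (Suc n)"
      using e x by (simp add: m_assoc int_pow_neg)
    then show ?case using e by (simp add: int_pow_mult [symmetric] k_def w_def algebra_simps)
  qed (use e in simp_all)
  obtain c where c: "lower_central G c = {\<one>}" using nil by (auto simp: nilpotent_group_def)
  have "e [^] (w ^ c) = \<one>" using mem[of c 1] c by simp
  then have "w ^ c = 0" using pow_eq_one e by blast
  then show ?thesis by (simp add: w_def)
qed

text \<open>The witness is \<open>N = isolator e\<close>. For each \<open>x\<close>, one relation on
  a nontrivial \<open>g\<close> suffices: it propagates to the whole isolator, in both directions
  because \<open>h\<close> is nontrivial as well, and in a nilpotent group it forces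
  \<open>x\<close> to centralise \<open>e\<close>.\<close>

lemma tame_isolator:
  assumes e: "e \<in> carrier G" and A: "A \<subseteq> carrier G"
    and ex: "\<And>x. x \<in> A \<Longrightarrow> \<exists>g\<in>isolator e. \<exists>h\<in>isolator e. g \<noteq> \<one> \<and> x \<otimes> g = h \<otimes> x"
    and com: "\<And>x y. x \<in> A \<Longrightarrow> y \<in> A \<Longrightarrow> x \<otimes> y \<otimes> inv x \<otimes> inv y \<in> isolator e"
  shows "tame A"
proof -
  have norm: "x \<otimes> n \<otimes> inv x \<in> isolator e \<and> inv x \<otimes> n \<otimes> x \<in> isolator e"
    if x: "x \<in> A" and n: "n \<in> isolator e" for x n
  proof -
    obtain g h where gh: "g \<in> isolator e" "h \<in> isolator e" "g \<noteq> \<one>" "x \<otimes> g = h \<otimes> x"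
      using ex[OF x] by blast
    have c: "x \<in> carrier G" "g \<in> carrier G" "h \<in> carrier G"
      using x A gh isolator_carrier by auto
    have "h \<noteq> \<one>" using gh c by (metis l_one r_cancel_one r_one l_cancel_one)
    moreover have "inv x \<otimes> h = g \<otimes> inv x"
    proof -
      have "inv x \<otimes> (h \<otimes> x) \<otimes> inv x = inv x \<otimes> (x \<otimes> g) \<otimes> inv x" using gh by simp
      then show ?thesis using c by (simp add: m_assoc)
    qed
    ultimately have "inv x \<otimes> n \<otimes> inv (inv x) \<in> isolator e"
      using isolator_normalize[OF e gh(2) _ gh(1), of "inv x" n] c n by simp
    then show ?thesis using isolator_normalize[OF e gh(1,3,2) c(1) gh(4) n] c by simp
  qed
  have cen: "x \<otimes> n = n \<otimes> x" if nil: "nilpotent_group G" and x: "x \<in> A" and n: "n \<in> isolator e" for x n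
  proof -
    obtain g h where gh: "g \<in> isolator e" "h \<in> isolator e" "g \<noteq> \<one>" "x \<otimes> g = h \<otimes> x"
      using ex[OF x] by blast
    have c: "x \<in> carrier G" using x A by auto
    obtain i j :: int where i: "i \<noteq> 0" "g [^] i = e [^] j" "g \<in> carrier G" using gh by (auto simp: isolator_def)
    obtain k l :: int where k: "k \<noteq> 0" "h [^] k = e [^] l" "h \<in> carrier G" using gh by (auto simp: isolator_def)
    have j: "j \<noteq> 0" using pow_eq_one[of g i] i gh by auto
    have e1: "e \<noteq> \<one>" using pow_eq_one[of g i] i gh by auto
    \<comment> \<open>Raising the relation to the exponent \<open>i * k\<close> turns both sides
      into powers of \<open>e\<close>, the form to which nilpotency applies.\<close>
    have gk: "g [^] (i * k) = e [^] (j * k)"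
      using e by (simp only: int_pow_pow [OF i(3), symmetric] i(2)) (simp add: int_pow_pow)
    have hk: "h [^] (k * i) = e [^] (l * i)"
      using e by (simp only: int_pow_pow [OF k(3), symmetric] k(2)) (simp add: int_pow_pow)
    have "x \<otimes> g \<otimes> inv x = h" using gh(4) c i(3) k(3) conj_eq_iff by blast
    then have "x \<otimes> g [^] (i * k) \<otimes> inv x = h [^] (k * i)"
      using conj_pow[of g x "i * k"] i(3) c by (simp add: mult.commute)
    then have rel: "x \<otimes> e [^] (j * k) = e [^] (l * i) \<otimes> x"
      using gk hk c e iffD1[OF conj_eq_iff, of "e [^] (j * k)" x "e [^] (l * i)"] by simp
    then have eq: "j * k = l * i" by (rule nilpotent_conj_pow[OF nil e e1 c])
    have "e [^] (j * k) \<otimes> x = x \<otimes> e [^] (j * k)" using rel eq by simp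
    then have "e \<otimes> x = x \<otimes> e" using root_commute[of e x "j * k"] j k(1) e c by simp
    then show ?thesis using isolator_commute_extend[OF e isolator_self[OF e] e1 c _ n] by simp
  qed
  show ?thesis
    unfolding tame_def
    by (rule exI[of _ "isolator e"])
      (use subgroup_isolator[OF e] isolator_commute[OF e] norm com cen in \<open>auto simp: pairwise_commute_def\<close>)
qed

end

section \<open>Squares close to an abelian set\<close>

context ordered_group
begin

text \<open>The one case of Freiman's dimension inequality that is needed.\<close>

lemma commuting_not_commensurable_square_card:
  assumes "finite L" "L \<subseteq> carrier G" "pairwise_commute G L"
    and "\<And>c. c \<in> carrier G \<Longrightarrow> \<exists>x\<in>L. \<exists>z\<in>L. x \<otimes> inv z \<notin> isolator c"
  shows "3 * card L \<le> card (L <#> L) + 3"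
  using assms
proof (induction "card L" arbitrary: L rule: less_induct)
  case less
  have "L \<noteq> {}" using less.prems(4)[OF one_closed] by auto
  then obtain y where y: "y \<in> L" "\<forall>x\<in>L - {y}. x \<lless> y"
    using ex_max[OF less.prems(1) _ less.prems(2)] by metis
  define T where "T = L - {y}"
  have T: "finite T" "T \<subseteq> carrier G" "y \<in> carrier G" "T \<subseteq> L" "card L = card T + 1"
    using less.prems y card.remove[of L y] by (auto simp: T_def)
  have Ty: "t \<lless> y" if "t \<in> T" for t using y that by (auto simp: T_def)
  have comT: "pairwise_commute G T" using less.prems(3) T(4) by (rule pairwise_commute_subset)
  have com: "u \<otimes> v = v \<otimes> u" if "u \<in> L" "v \<in> L" for u v
    using less.prems(3) that by (rule pairwise_commuteD)
  have Lc: "u \<in> carrier G" if "u \<in> L" for u using less.prems(2) that by auto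
  \<comment> \<open>Since \<open>L\<close> commutes, an equation of products becomes an equation of
    ratios, which can be tested for membership in an isolator.\<close>
  have swap: "y \<otimes> inv u = v \<otimes> inv w" if "y \<otimes> w = u \<otimes> v" "u \<in> L" "v \<in> L" "w \<in> L" for u v w
  proof -
    have "w \<otimes> y = v \<otimes> u" using that com y(1) by metis
    then have "y = inv w \<otimes> (v \<otimes> u)" using Lc that y(1) by (metis inv_solve_left m_closed)
    then have "y \<otimes> inv u = inv w \<otimes> v" using Lc that by (simp add: m_assoc)
    also have "\<dots> = v \<otimes> inv w"
    proof -
      have "v \<in> generate G L" "inv w \<in> generate G L" using that by (auto intro: generate.intros)
      then show ?thesis using generate_commute[OF less.prems(2,3)] by blast
    qed
    finally show ?thesis .
  qed
  have top: "t \<otimes> u \<lless> y \<otimes> y" if "t \<in> T" "u \<in> T" for t u using Ty that mult_less by blast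
  have fin: "finite (L <#> L)" using less.prems(1) by (simp add: finite_set_mult)
  have TT: "T <#> T \<subseteq> L <#> L" using T(4) by (rule mono_set_mult[OF _ T(4)])
  show ?case
  proof (cases "\<exists>c\<in>carrier G. \<forall>x\<in>T. \<forall>z\<in>T. x \<otimes> inv z \<in> isolator c")
    \<comment> \<open>Here \<open>T\<close> lies in one coset of \<open>isolator c\<close> and
      \<open>y\<close> does not, so all \<open>|L| = |T| + 1\<close> products of \<open>y\<close>
      with \<open>L\<close> are new; together with \<open>2|T| - 1\<close> for \<open>T\<close> this
      is \<open>3|L| - 3\<close>.\<close>
    case True
    then obtain c where c: "c \<in> carrier G" "\<forall>x\<in>T. \<forall>z\<in>T. x \<otimes> inv z \<in> isolator c" by blast
    note I = subgroup_isolator[OF c(1)]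
    have out: "y \<otimes> inv t \<notin> isolator c" if t: "t \<in> T" for t
    proof
      assume yt: "y \<otimes> inv t \<in> isolator c"
      have tc: "t \<in> carrier G" using t T by auto
      have "x \<otimes> inv t \<in> isolator c" if "x \<in> L" for x using that yt c t by (cases "x = y") (auto simp: T_def)
      note all = this
      have "x \<otimes> inv z \<in> isolator c" if "x \<in> L" "z \<in> L" for x z
      proof -
        have "x \<otimes> inv t \<otimes> inv (z \<otimes> inv t) \<in> isolator c"
          using all that subgroup.m_closed[OF I] subgroup.m_inv_closed[OF I] by blast
        moreover have "x \<otimes> inv t \<otimes> inv (z \<otimes> inv t) = x \<otimes> inv z"
          using that Lc tc by (simp add: inv_mult_group m_assoc)
        ultimately show ?thesis by simp
      qed
      then show False using less.prems(4)[OF c(1)] by blast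
    qed
    have "T \<noteq> {}"
    proof
      assume "T = {}"
      then have "L = {y}" using y by (auto simp: T_def)
      then show False using less.prems(4)[OF one_closed] isolator_self[OF one_closed] T(3) by simp
    qed
    have dis: "y \<otimes> t \<notin> T <#> T" if t: "t \<in> T" for t
    proof
      assume "y \<otimes> t \<in> T <#> T"
      then obtain u v where uv: "u \<in> T" "v \<in> T" "y \<otimes> t = u \<otimes> v" by (rule set_multE)
      have "y \<otimes> inv u = v \<otimes> inv t" using swap[OF uv(3)] uv t T(4) by blast
      then show False using out[OF uv(1)] c(2) uv(2) t by simp
    qed
    have yy: "y \<otimes> y \<notin> T <#> T" using top less_irrefl by (metis set_multE)
    have "card (T <#> T) + card ((\<lambda>t. y \<otimes> t) ` L) \<le> card (L <#> L)"
    proof (rule card_add_le[OF fin TT])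
      show "(\<lambda>t. y \<otimes> t) ` L \<subseteq> L <#> L" using y by (auto intro: set_multI)
      have "y \<otimes> t \<notin> T <#> T" if "t \<in> L" for t using that dis yy by (cases "t = y") (auto simp: T_def)
      then show "(T <#> T) \<inter> (\<lambda>t. y \<otimes> t) ` L = {}" by blast
    qed
    moreover have "card ((\<lambda>t. y \<otimes> t) ` L) = card L"
      using inj_on_mult(1)[OF less.prems(2) T(3)] by (simp add: card_image)
    moreover have "2 * card T \<le> card (T <#> T) + 1" using square_card_ge[OF T(1) \<open>T \<noteq> {}\<close> T(2)] .
    ultimately show ?thesis using T(5) by simp
  next
    case False
    then have no: "\<exists>x\<in>T. \<exists>z\<in>T. x \<otimes> inv z \<notin> isolator c" if "c \<in> carrier G" for c using that by blast
    have "3 * card T \<le> card (T <#> T) + 3"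
      by (rule less.hyps[OF _ T(1,2) comT no]) (simp add: T(5))
    moreover have "T \<noteq> {}" using no[OF one_closed] by auto
    then obtain y' where y': "y' \<in> T" "\<forall>x\<in>T - {y'}. x \<lless> y'" using ex_max[OF T(1) _ T(2)] by metis
    have y'c: "y' \<in> carrier G" using y' T by auto
    \<comment> \<open>The isolator of the ratio of the two largest elements; \<open>w\<close> will
      be the largest element whose ratio to \<open>y\<close> escapes it. An equation
      \<open>yw = uv\<close> forces \<open>u\<close> and \<open>v\<close> above \<open>w\<close>,
      and then the ratio of \<open>y\<close> and \<open>w\<close> is a product of two ratios inside
      the isolator. So \<open>yw\<close>, \<open>y y'\<close> and \<open>y y\<close> are three new
      products.\<close>
    define c where "c = y \<otimes> inv y'"
    have c: "c \<in> carrier G" using T y'c by (simp add: c_def)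
    note I = subgroup_isolator[OF c]
    obtain a b where ab: "a \<in> L" "b \<in> L" "a \<otimes> inv b \<notin> isolator c" using less.prems(4)[OF c] by blast
    have "y \<otimes> inv a \<notin> isolator c \<or> y \<otimes> inv b \<notin> isolator c"
    proof (rule ccontr)
      assume "\<not> ?thesis"
      then have "inv (y \<otimes> inv a) \<otimes> (y \<otimes> inv b) \<in> isolator c"
        using subgroup.m_closed[OF I] subgroup.m_inv_closed[OF I] by blast
      then show False using ab Lc T(3) by (simp add: inv_mult_group m_assoc)
    qed
    then obtain w0 where "w0 \<in> L" "y \<otimes> inv w0 \<notin> isolator c" using ab by blast
    then obtain w where w: "w \<in> L" "y \<otimes> inv w \<notin> isolator c"
      and wmax: "\<And>x. x \<in> L \<Longrightarrow> w \<lless> x \<Longrightarrow> y \<otimes> inv x \<in> isolator c"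
      using ex_max_satisfying[where P = "\<lambda>w. y \<otimes> inv w \<notin> isolator c", OF less.prems(1,2)] by metis
    have wc: "w \<in> carrier G" using w Lc by auto
    have "w \<noteq> y" using w T(3) subgroup.one_closed[OF I] by auto
    then have wT: "w \<in> T" using w by (auto simp: T_def)
    have "w \<noteq> y'" using w isolator_self[OF c] by (auto simp: c_def)
    then have wy': "w \<lless> y'" using y' wT by auto
    have new_w: "y \<otimes> w \<notin> T <#> T"
    proof
      assume "y \<otimes> w \<in> T <#> T"
      then obtain u v where uv: "u \<in> T" "v \<in> T" "y \<otimes> w = u \<otimes> v" by (rule set_multE)
      have uvc: "u \<in> carrier G" "v \<in> carrier G" using uv T by auto
      have "w \<lless> v"
        using mult_less_le[OF Ty[OF uv(1)], of v w] less_total[OF uvc(2) wc] uv(3) wc less_irrefl by metis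
      moreover have "y \<otimes> w = v \<otimes> u" using uv com T(4) by (metis subsetD)
      then have "w \<lless> u"
        using mult_less_le[OF Ty[OF uv(2)], of u w] less_total[OF uvc(1) wc] wc less_irrefl by metis
      ultimately have "y \<otimes> inv u \<in> isolator c" "y \<otimes> inv v \<in> isolator c"
        using wmax uv T(4) by blast+
      moreover have "y \<otimes> inv w = (y \<otimes> inv v) \<otimes> (y \<otimes> inv u)"
        using swap[OF uv(3)] uv w T(3,4) uvc wc by (simp add: m_assoc subset_iff)
      ultimately show False using w subgroup.m_closed[OF I] by simp
    qed
    have lt: "u \<otimes> v \<lless> y \<otimes> y'" if "u \<in> T" "v \<in> T" for u v
      using mult_less_le[OF Ty[OF that(1)], of v y'] y'(2) y'c that(2) by blast
    then have new_y': "y \<otimes> y' \<notin> T <#> T" using less_irrefl by (metis set_multE)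
    have yy: "y \<otimes> y \<notin> T <#> T" using top less_irrefl by (metis set_multE)
    have lt3: "y \<otimes> w \<lless> y \<otimes> y'" "y \<otimes> y' \<lless> y \<otimes> y"
      using mult_less_left wy' Ty[OF y'(1)] T(3) by auto
    then have "card {y \<otimes> w, y \<otimes> y', y \<otimes> y} = 3"
      using less_trans less_irrefl by (metis card_3_iff)
    moreover have "card (T <#> T) + card {y \<otimes> w, y \<otimes> y', y \<otimes> y} \<le> card (L <#> L)"
    proof (rule card_add_le[OF fin TT])
      show "{y \<otimes> w, y \<otimes> y', y \<otimes> y} \<subseteq> L <#> L" using y w y' T(4) by (auto intro: set_multI)
      show "(T <#> T) \<inter> {y \<otimes> w, y \<otimes> y', y \<otimes> y} = {}" using new_w new_y' yy by blast
    qed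
    ultimately show ?thesis using T(5) by simp
  qed
qed

text \<open>Only ratios of elements of \<open>L\<close> are known to be commensurable, not the
  elements themselves. Hence two conjugations \<open>y p = q y\<close> and
  \<open>y p' = q' y\<close> are needed: their quotient gives a nontrivial element of the isolator
  conjugated into it, and one of them controls the commutators of \<open>y\<close> with
  \<open>L\<close>.\<close>

lemma tame_insert_commuting:
  assumes L: "finite L" "L \<subseteq> carrier G" "pairwise_commute G L" and y: "y \<in> carrier G"
    and nc: "\<not> pairwise_commute G (insert y L)"
    and size: "s + 3 \<le> card L"
    and small: "card (insert y L <#> insert y L) \<le> 3 * card L + 1 + s"
  shows "tame (insert y L)"
proof -
  let ?A = "(\<lambda>t. y \<otimes> t) ` L" and ?B = "(\<lambda>t. t \<otimes> y) ` L"
  obtain t where t: "t \<in> L" "y \<otimes> t \<noteq> t \<otimes> y" using nc L(3) by (auto simp: pairwise_commute_def)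
  have sum: "card (L <#> L) + card (?A \<union> ?B) + 1 \<le> 3 * card L + 1 + s"
    using square_insert_commuting[OF L y nc] small by simp
  have Lne: "L \<noteq> {}" using t by auto
  have "card L + 1 \<le> card (?A \<union> ?B)" by (rule card_translates_ge[OF L(1,2) y t])
  \<comment> \<open>From the translates, \<open>|L^2| \<le> 2|L| + s - 1\<close>, and
    \<open>s + 3 \<le> |L|\<close> brings this below \<open>3|L| - 3\<close>.\<close>
  then have "card (L <#> L) + 3 < 3 * card L" using sum size by simp
  then obtain c where c: "c \<in> carrier G" "\<forall>x\<in>L. \<forall>z\<in>L. x \<otimes> inv z \<in> isolator c"
    using commuting_not_commensurable_square_card[OF L] by (metis not_le)
  note I = subgroup_isolator[OF c(1)]
  have "card ?A = card L" "card ?B = card L" using inj_on_mult[OF L(2) y] by (auto simp: card_image)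
  moreover have "card (?A \<union> ?B) + card (?A \<inter> ?B) = card ?A + card ?B"
    using card_Un_Int[of ?A ?B] L(1) by simp
  moreover have "2 * card L \<le> card (L <#> L) + 1" by (rule square_card_ge[OF L(1) Lne L(2)])
  \<comment> \<open>The same count with \<open>|L^2| \<ge> 2|L| - 1\<close> leaves at least
    \<open>|L| - 1 - s \<ge> 2\<close> elements common to both translates.\<close>
  ultimately have "2 \<le> card (?A \<inter> ?B)" using sum size by simp
  then obtain g h where gh: "g \<in> ?A \<inter> ?B" "h \<in> ?A \<inter> ?B" "g \<noteq> h"
    by (metis card_2_iff' card_le_Suc0_iff_eq card.infinite not_less_eq_eq numeral_2_eq_2 zero_le)
  obtain p q where pq: "p \<in> L" "q \<in> L" "g = y \<otimes> p" "g = q \<otimes> y" using gh(1) by auto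
  obtain p' q' where pq': "p' \<in> L" "q' \<in> L" "h = y \<otimes> p'" "h = q' \<otimes> y" using gh(2) by auto
  have car: "p \<in> carrier G" "q \<in> carrier G" "p' \<in> carrier G" "q' \<in> carrier G" using pq pq' L by auto
  have "p \<noteq> p'" using gh pq pq' by auto
  have conj: "y \<otimes> p \<otimes> inv y = q" "y \<otimes> p' \<otimes> inv y = q'"
    using pq pq' car y by (auto simp: conj_eq_iff)
  define u where "u = p \<otimes> inv p'"
  define v where "v = q \<otimes> inv q'"
  have u: "u \<in> isolator c" "u \<in> carrier G" and v: "v \<in> isolator c" "v \<in> carrier G"
    using c pq pq' car by (auto simp: u_def v_def)
  have u1: "u \<noteq> \<one>" using \<open>p \<noteq> p'\<close> car by (metis u_def inv_equality inv_inv inv_closed r_inv r_cancel)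
  have yuv: "y \<otimes> u = v \<otimes> y"
  proof -
    have "y \<otimes> u \<otimes> inv y = (y \<otimes> p \<otimes> inv y) \<otimes> inv (y \<otimes> p' \<otimes> inv y)"
      using car y by (simp add: u_def inv_mult_group m_assoc)
    then show ?thesis using conj u v y by (simp add: conj_eq_iff v_def)
  qed
  have fixL: "x \<otimes> u = u \<otimes> x" if x: "x \<in> L" for x
  proof -
    have "u \<in> generate G L" "x \<in> generate G L"
      using pq pq' x by (auto simp: u_def intro: generate.intros)
    then show ?thesis using generate_commute[OF L(2,3)] by blast
  qed
  \<comment> \<open>Since \<open>q\<close> is the conjugate of \<open>p\<close>, the commutator of
    \<open>y\<close> and \<open>x\<close> is the conjugate of the ratio of \<open>x\<close> and
    \<open>p\<close>, times the ratio of \<open>q\<close> and \<open>x\<close>; both factors lie in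
    the isolator.\<close>
  have yx: "y \<otimes> x \<otimes> inv y \<otimes> inv x \<in> isolator c" if x: "x \<in> L" for x
  proof -
    have xc: "x \<in> carrier G" using x L by auto
    have "y \<otimes> (x \<otimes> inv p) \<otimes> inv y \<in> isolator c"
      using isolator_normalize[OF c(1) u(1) u1 v(1) y yuv] c(2) x pq by blast
    moreover have "q \<otimes> inv x \<in> isolator c" using c(2) x pq by blast
    ultimately have "y \<otimes> (x \<otimes> inv p) \<otimes> inv y \<otimes> (q \<otimes> inv x) \<in> isolator c"
      by (rule subgroup.m_closed[OF I])
    moreover have "y \<otimes> (x \<otimes> inv p) \<otimes> inv y \<otimes> (q \<otimes> inv x) = y \<otimes> x \<otimes> inv y \<otimes> inv x"
      unfolding conj(1)[symmetric] using xc car y by (simp add: m_assoc)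
    ultimately show ?thesis by simp
  qed
  have xy: "x \<otimes> y \<otimes> inv x \<otimes> inv y \<in> isolator c" if x: "x \<in> L" for x
  proof -
    have "inv (y \<otimes> x \<otimes> inv y \<otimes> inv x) \<in> isolator c" using subgroup.m_inv_closed[OF I] yx[OF x] .
    moreover have "x \<in> carrier G" using x L by auto
    ultimately show ?thesis using y by (simp add: inv_mult_group m_assoc)
  qed
  have xx: "x \<otimes> z \<otimes> inv x \<otimes> inv z = \<one>" if "x \<in> carrier G" "z \<in> carrier G" "x \<otimes> z = z \<otimes> x" for x z
  proof -
    have "x \<otimes> z \<otimes> inv x \<otimes> inv z = z \<otimes> x \<otimes> inv x \<otimes> inv z" using that by simp
    also have "\<dots> = \<one>" using that by (simp add: m_assoc)
    finally show ?thesis .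
  qed
  show ?thesis
  proof (rule tame_isolator[OF c(1)])
    show "insert y L \<subseteq> carrier G" using L y by auto
    show "\<exists>g\<in>isolator c. \<exists>h\<in>isolator c. g \<noteq> \<one> \<and> x \<otimes> g = h \<otimes> x" if "x \<in> insert y L" for x
      using that u v u1 yuv fixL by (cases "x = y") blast+
    show "x \<otimes> z \<otimes> inv x \<otimes> inv z \<in> isolator c" if xz: "x \<in> insert y L" "z \<in> insert y L" for x z
    proof (cases "x = y \<or> z = y")
      case False
      then have "x \<in> L" "z \<in> L" using xz by auto
      then have "x \<otimes> z \<otimes> inv x \<otimes> inv z = \<one>"
        using L(2) pairwise_commuteD[OF L(3)] by (intro xx) auto
      then show ?thesis using subgroup.one_closed[OF I] by simp
    next
      case True
      then show ?thesis using xz xy yx xx[of y y] y subgroup.one_closed[OF I] by (cases "x = z") auto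
    qed
  qed
qed

section \<open>Initial segments and the removal of extreme elements\<close>

definition lower_segment :: "'a set \<Rightarrow> 'a set \<Rightarrow> bool" where
  "lower_segment T S \<longleftrightarrow> T \<subseteq> S \<and> (\<forall>t\<in>T. \<forall>x\<in>S - T. t \<lless> x)"

lemma lower_segment_remove_max:
  assumes "lower_segment T S" "T \<noteq> S" "y \<in> S" "\<forall>x\<in>S - {y}. x \<lless> y"
  shows "y \<notin> T" "lower_segment T (S - {y})"
proof -
  obtain x where x: "x \<in> S - T" using assms by (auto simp: lower_segment_def)
  show yT: "y \<notin> T"
  proof
    assume "y \<in> T"
    then have "y \<lless> x" "x \<lless> y" using assms x by (auto simp: lower_segment_def)
    then show False using less_asym by blast
  qed
  then show "lower_segment T (S - {y})" using assms(1) by (auto simp: lower_segment_def)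
qed

lemma ex_lower_segment:
  assumes "finite S" "S \<subseteq> carrier G" "n \<le> card S"
  shows "\<exists>T. lower_segment T S \<and> card T = n"
  using assms
proof (induction "card S" arbitrary: S rule: less_induct)
  case less
  show ?case
  proof (cases "n = card S")
    case True
    then show ?thesis by (intro exI[of _ S]) (auto simp: lower_segment_def)
  next
    case False
    then have "S \<noteq> {}" using less.prems by auto
    then obtain y where y: "y \<in> S" "\<forall>x\<in>S - {y}. x \<lless> y"
      using ex_max[OF less.prems(1) _ less.prems(2)] by metis
    have "card S = Suc (card (S - {y}))" using card.remove[OF less.prems(1) y(1)] .
    then obtain T where "lower_segment T (S - {y})" "card T = n"
      using less.hyps[of "S - {y}"] less.prems False by auto
    then show ?thesis using y by (intro exI[of _ T]) (auto simp: lower_segment_def)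
  qed
qed

text \<open>If \<open>y\<close> lay outside, then
  \<open>|S^2| \<ge> (3(|S| - 1) - 2) + |S| = 4|S| - 5\<close>, and the upper bound would give
  \<open>|S| \<le> s + 3\<close>, contrary to \<open>size\<close>.\<close>

lemma in_generate_remove_max:
  assumes S: "finite S" "S \<subseteq> carrier G" and y: "y \<in> S" "\<forall>x\<in>S - {y}. x \<lless> y"
    and nc: "\<not> pairwise_commute G (S - {y})"
    and small: "card (S <#> S) + 2 \<le> 3 * card S + s" and size: "s + 3 \<le> card (S - {y})"
  shows "y \<in> generate G (S - {y})"
proof (rule ccontr)
  assume "\<not> ?thesis"
  then have "card ((S - {y}) <#> (S - {y})) + card S \<le> card (S <#> S)"
    using square_remove_max_outside[OF S y(1)] y(2) by blast
  moreover have "3 * card (S - {y}) \<le> card ((S - {y}) <#> (S - {y})) + 2"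
    using noncommuting_square_card[OF _ _ nc] S by blast
  moreover have "card S = Suc (card (S - {y}))" using card.remove[OF S(1) y(1)] .
  ultimately show False using small size by simp
qed

text \<open>This is \<open>d(T) \<le> d(S)\<close> in additive form. Elements above \<open>T\<close>
  are removed from the top, and each removal costs at least three products because \<open>T\<close>
  keeps the rest noncommuting.\<close>

lemma lower_segment_square_card:
  assumes "finite S" "S \<subseteq> carrier G" "lower_segment T S" "\<not> pairwise_commute G T"
  shows "card (T <#> T) + 3 * card S \<le> card (S <#> S) + 3 * card T"
  using assms
proof (induction "card S" arbitrary: S rule: less_induct)
  case less
  show ?case
  proof (cases "T = S")
    case False
    have TS: "T \<subseteq> S" using less.prems(3) by (simp add: lower_segment_def)
    then have "S \<noteq> {}" using less.prems(4) False by auto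
    then obtain y where y: "y \<in> S" "\<forall>x\<in>S - {y}. x \<lless> y"
      using ex_max[OF less.prems(1) _ less.prems(2)] by metis
    note seg = lower_segment_remove_max[OF less.prems(3) False y]
    have c: "card S = Suc (card (S - {y}))" using card.remove[OF less.prems(1) y(1)] .
    have "\<not> pairwise_commute G S" using pairwise_commute_subset TS less.prems(4) by blast
    then have "card ((S - {y}) <#> (S - {y})) + 3 \<le> card (S <#> S)"
      using square_remove_max[OF less.prems(1,2) y(1)] y(2) by blast
    moreover have "card (T <#> T) + 3 * card (S - {y}) \<le> card ((S - {y}) <#> (S - {y})) + 3 * card T"
      by (rule less.hyps[OF _ _ _ seg(2) less.prems(4)]) (use c less.prems in auto)
    ultimately show ?thesis using c by simp
  qed simp
qed

text \<open>Removing maxima does not increase \<open>d\<close>, so the same \<open>s\<close> serves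
  down to \<open>T\<close>, and each removed maximum lies in the subgroup generated by what is
  left.\<close>

lemma lower_segment_generates:
  assumes "finite S" "S \<subseteq> carrier G" "lower_segment T S" "\<not> pairwise_commute G T"
    and "card (S <#> S) + 2 \<le> 3 * card S + s" "s + 3 \<le> card T"
  shows "S \<subseteq> generate G T"
  using assms
proof (induction "card S" arbitrary: S rule: less_induct)
  case less
  show ?case
  proof (cases "T = S")
    case True
    then show ?thesis by (auto intro: generate.incl)
  next
    case False
    have TS: "T \<subseteq> S" using less.prems(3) by (simp add: lower_segment_def)
    then have "S \<noteq> {}" using less.prems(4) False by auto
    then obtain y where y: "y \<in> S" "\<forall>x\<in>S - {y}. x \<lless> y"
      using ex_max[OF less.prems(1) _ less.prems(2)] by metis
    note seg = lower_segment_remove_max[OF less.prems(3) False y]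
    have TS': "T \<subseteq> S - {y}" using TS seg(1) by blast
    have c: "card S = Suc (card (S - {y}))" using card.remove[OF less.prems(1) y(1)] .
    have nc: "\<not> pairwise_commute G S" "\<not> pairwise_commute G (S - {y})"
      using pairwise_commute_subset TS TS' less.prems(4) by blast+
    have "card ((S - {y}) <#> (S - {y})) + 3 \<le> card (S <#> S)"
      using square_remove_max[OF less.prems(1,2) y(1) _ nc(1)] y(2) by blast
    then have "S - {y} \<subseteq> generate G T"
      by (intro less.hyps[OF _ _ _ seg(2) less.prems(4)]) (use c less.prems in auto)
    moreover have "card T \<le> card (S - {y})" using TS' less.prems(1) by (intro card_mono) auto
    then have "y \<in> generate G (S - {y})"
      using in_generate_remove_max[OF less.prems(1,2) y nc(2) less.prems(5)] less.prems(6) by simp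
    moreover have "T \<subseteq> carrier G" using TS less.prems(2) by blast
    ultimately show ?thesis using generate_closure by blast
  qed
qed

lemma tame_commuting_lower_segment:
  assumes "finite S" "S \<subseteq> carrier G" "lower_segment T S" "pairwise_commute G T"
    and "card (S <#> S) + 2 \<le> 3 * card S + s" "s + 3 \<le> card T"
  shows "tame S"
  using assms
proof (induction "card S" arbitrary: S rule: less_induct)
  case less
  show ?case
  proof (cases "pairwise_commute G S")
    case True
    then show ?thesis using tame_pairwise_commute less.prems(2) by blast
  next
    case False
    then have neq: "T \<noteq> S" using less.prems(4) by blast
    have TS: "T \<subseteq> S" using less.prems(3) by (simp add: lower_segment_def)
    then have "S \<noteq> {}" using neq by blast
    then obtain y where y: "y \<in> S" "\<forall>x\<in>S - {y}. x \<lless> y"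
      using ex_max[OF less.prems(1) _ less.prems(2)] by metis
    note seg = lower_segment_remove_max[OF less.prems(3) neq y]
    have TS': "T \<subseteq> S - {y}" using TS seg(1) by blast
    have c: "card S = Suc (card (S - {y}))" using card.remove[OF less.prems(1) y(1)] .
    have cT: "card T \<le> card (S - {y})" using TS' less.prems(1) by (intro card_mono) auto
    have yS: "insert y (S - {y}) = S" using y(1) by blast
    have fin: "finite (S - {y})" "S - {y} \<subseteq> carrier G" "y \<in> carrier G" using less.prems y by auto
    show ?thesis
    proof (cases "pairwise_commute G (S - {y})")
      case True
      have "tame (insert y (S - {y}))"
        by (rule tame_insert_commuting[OF fin(1,2) True fin(3), where s = s])
          (use yS False c less.prems cT in auto)
      then show ?thesis using yS by simp
    next
      case nc: False
      have sq: "card ((S - {y}) <#> (S - {y})) + 3 \<le> card (S <#> S)"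
        using square_remove_max[OF less.prems(1,2) y(1) _ False] y(2) by blast
      have "tame (S - {y})"
        by (intro less.hyps[OF _ _ _ seg(2) less.prems(4)]) (use c less.prems sq in auto)
      moreover have "y \<in> generate G (S - {y})"
        using in_generate_remove_max[OF less.prems(1,2) y nc less.prems(5)] less.prems(6) cT by simp
      then have "S \<subseteq> generate G (S - {y})" using generate.incl[of _ "S - {y}" G] by blast
      ultimately show ?thesis using tame_lift fin by blast
    qed
  qed
qed

text \<open>Products from \<open>T\<close> are at most \<open>x x\<close> and products from the
  upper part are at least \<open>x x\<close>, so the two squares share only this element.\<close>

lemma square_card_split:
  assumes S: "finite S" "S \<subseteq> carrier G" and T: "lower_segment T S" and x: "x \<in> T" "\<forall>t\<in>T - {x}. t \<lless> x"
  shows "card (T <#> T) + card (insert x (S - T) <#> insert x (S - T)) \<le> card (S <#> S) + 1"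
proof -
  let ?U = "insert x (S - T)"
  have TS: "T \<subseteq> S" using T by (simp add: lower_segment_def)
  have xc: "x \<in> carrier G" using x TS S by blast
  have "(T <#> T) \<inter> (?U <#> ?U) \<subseteq> {x \<otimes> x}"
  proof
    fix w assume w: "w \<in> (T <#> T) \<inter> (?U <#> ?U)"
    obtain a b where ab: "a \<in> T" "b \<in> T" "w = a \<otimes> b" using w by (blast elim: set_multE)
    obtain c d where cd: "c \<in> ?U" "d \<in> ?U" "w = c \<otimes> d" using w by (blast elim: set_multE)
    have "a \<in> carrier G" "b \<in> carrier G" "c \<in> carrier G" "d \<in> carrier G" using ab cd TS S xc by auto
    note car = this
    have le: "a = x \<or> a \<lless> x" "b = x \<or> b \<lless> x" using ab x by auto
    have ge: "c = x \<or> x \<lless> c" "d = x \<or> x \<lless> d" using cd x T by (auto simp: lower_segment_def)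
    have "x \<otimes> x = c \<otimes> d \<or> x \<otimes> x \<lless> c \<otimes> d"
      using mult_le_less[of x c x d] mult_less_le[of x c x d] ge car by blast
    moreover have "a \<otimes> b = x \<otimes> x \<or> a \<otimes> b \<lless> x \<otimes> x"
      using mult_le_less[of a x b x] mult_less_le[of a x b x] le car xc by blast
    ultimately show "w \<in> {x \<otimes> x}" using ab cd less_trans less_asym less_irrefl by (metis singletonI)
  qed
  then have "card ((T <#> T) \<inter> (?U <#> ?U)) \<le> card {x \<otimes> x}" by (intro card_mono) auto
  moreover have "finite T" "finite ?U" using S TS finite_subset by auto
  then have "card (T <#> T) + card (?U <#> ?U)
      = card ((T <#> T) \<union> (?U <#> ?U)) + card ((T <#> T) \<inter> (?U <#> ?U))"
    by (intro card_Un_Int) (auto simp: finite_set_mult)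
  moreover have "(T <#> T) \<union> (?U <#> ?U) \<subseteq> S <#> S"
    using mono_set_mult[OF TS TS] mono_set_mult[of ?U S ?U S] x TS by blast
  then have "card ((T <#> T) \<union> (?U <#> ?U)) \<le> card (S <#> S)"
    using S by (intro card_mono) (auto simp: finite_set_mult)
  ultimately show ?thesis by simp
qed

end

section \<open>Sets of four elements\<close>

text \<open>Exchanging left and right preserves the order and the square of a set, so relations
  among four elements need to be derived only up to mirror images.\<close>

definition opposite :: "('a, 'b) monoid_scheme \<Rightarrow> ('a, 'b) monoid_scheme" where
  "opposite G = G\<lparr>mult := \<lambda>x y. y \<otimes>\<^bsub>G\<^esub> x\<rparr>"

lemma opposite_simps [simp]:
  "carrier (opposite G) = carrier G" "\<one>\<^bsub>opposite G\<^esub> = \<one>\<^bsub>G\<^esub>"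
  "x \<otimes>\<^bsub>opposite G\<^esub> y = y \<otimes>\<^bsub>G\<^esub> x"
  by (simp_all add: opposite_def)

lemma set_mult_opposite [simp]: "A <#>\<^bsub>opposite G\<^esub> B = B <#>\<^bsub>G\<^esub> A"
  by (auto simp: set_mult_def)

lemma pairwise_commute_opposite [simp]: "pairwise_commute (opposite G) S = pairwise_commute G S"
  by (auto simp: pairwise_commute_def)

lemma (in group) group_opposite: "group (opposite G)"
proof (rule groupI)
  fix x assume "x \<in> carrier (opposite G)"
  then show "\<exists>y\<in>carrier (opposite G). y \<otimes>\<^bsub>opposite G\<^esub> x = \<one>\<^bsub>opposite G\<^esub>"
    by (intro bexI[of _ "inv x"]) auto
qed (auto simp: m_assoc)

lemma (in ordered_group) ordered_group_opposite: "ordered_group (opposite G) le"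
proof -
  interpret op: group "opposite G" by (rule group_opposite)
  show ?thesis
  proof
    show "linear_order_on (carrier (opposite G)) le" using linear_order by simp
  qed (use le_mult in \<open>auto simp: m_assoc\<close>)
qed

context ordered_group
begin

text \<open>Conjugation by \<open>a\<close> takes \<open>c\<close> to \<open>b\<close> and
  \<open>b\<close> to \<open>c\<close>, so \<open>a a\<close> commutes with \<open>b\<close>, and
  square roots are unique.\<close>

lemma commute_if_double_conj:
  assumes "a \<in> carrier G" "b \<in> carrier G" "c \<in> carrier G" "a \<otimes> c = b \<otimes> a" "c \<otimes> a = a \<otimes> b"
  shows "a \<otimes> b = b \<otimes> a"
proof (rule square_commute)
  have "a \<otimes> a \<otimes> b = a \<otimes> (c \<otimes> a)" using assms by (simp add: m_assoc)
  also have "\<dots> = a \<otimes> c \<otimes> a" using assms(1-3) by (simp add: m_assoc)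
  also have "\<dots> = b \<otimes> (a \<otimes> a)" using assms by (simp add: m_assoc)
  finally show "a \<otimes> a \<otimes> b = b \<otimes> (a \<otimes> a)" .
qed (use assms in auto)

lemma commute_if_products_square:
  assumes "a \<in> carrier G" "b \<in> carrier G" "c \<in> carrier G" "a \<otimes> c = b \<otimes> b" "c \<otimes> a = b \<otimes> b"
  shows "a \<otimes> b = b \<otimes> a"
proof -
  have "b \<otimes> b \<otimes> a = a \<otimes> c \<otimes> a" using assms by simp
  also have "\<dots> = a \<otimes> (c \<otimes> a)" using assms(1-3) by (simp add: m_assoc)
  also have "\<dots> = a \<otimes> (b \<otimes> b)" using assms by simp
  finally show ?thesis using square_commute[of b a] assms by simp
qed

end

text \<open>The bound 10 is \<open>3 * 4 - 2\<close>, that is \<open>d \<le> 0\<close>. A commuting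
  triple at either end is excluded because it is a commuting segment of size \<open>0 + 3\<close>,
  which is handled separately.\<close>

locale four_elements = ordered_group +
  fixes a b c d
  assumes lt: "a \<lless> b" "b \<lless> c" "c \<lless> d"
    and small: "card ({a, b, c, d} <#> {a, b, c, d}) \<le> 10"
    and lower_nc: "\<not> pairwise_commute G {a, b, c}"
    and upper_nc: "\<not> pairwise_commute G {b, c, d}"
begin

lemma car [simp]: "a \<in> carrier G" "b \<in> carrier G" "c \<in> carrier G" "d \<in> carrier G"
  using lt less_carrier by auto

lemma opposite: "four_elements (opposite G) le a b c d"
proof -
  interpret op: ordered_group "opposite G" le by (rule ordered_group_opposite)
  show ?thesis by unfold_locales (use lt small lower_nc upper_nc in auto)
qed

lemma converse: "four_elements G (le\<inverse>) d c b a"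
proof -
  interpret rev: ordered_group G "le\<inverse>" by (rule ordered_group_converse)
  have eq: "{d, c, b, a} = {a, b, c, d}" "{d, c, b} = {b, c, d}" "{c, b, a} = {a, b, c}" by auto
  show ?thesis
  proof
    show "ordered_group.less (le\<inverse>) d c" "ordered_group.less (le\<inverse>) c b" "ordered_group.less (le\<inverse>) b a"
      using lt by (simp_all add: less_converse)
    show "card ({d, c, b, a} <#> {d, c, b, a}) \<le> 10" using small by (subst (1 2) eq(1))
    show "\<not> pairwise_commute G {d, c, b}" using upper_nc unfolding eq(2) .
    show "\<not> pairwise_commute G {c, b, a}" using lower_nc unfolding eq(3) .
  qed
qed

definition Q :: "'a set" where "Q = {a, b, c, d} <#> {a, b, c, d}"

lemma Q: "finite Q" "Q \<subseteq> carrier G" "card Q \<le> 10"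
  using small by (auto simp: Q_def set_mult_def)

lemma QI [simp]: "x \<in> {a, b, c, d} \<Longrightarrow> y \<in> {a, b, c, d} \<Longrightarrow> x \<otimes> y \<in> Q"
  unfolding Q_def by (rule set_multI)

text \<open>Ranks turn every comparison of products into linear arithmetic.\<close>

definition rk :: "'a \<Rightarrow> nat" where "rk x = card {y \<in> Q. y \<lless> x}"

lemma rk_less: "x \<in> Q \<Longrightarrow> x \<lless> y \<Longrightarrow> rk x < rk y"
  unfolding rk_def
proof (rule psubset_card_mono)
  assume "x \<in> Q" "x \<lless> y"
  then show "{z \<in> Q. z \<lless> x} \<subset> {z \<in> Q. z \<lless> y}"
    using less_trans less_irrefl by blast
qed (use Q in auto)

lemma rk_eq: "x \<in> Q \<Longrightarrow> y \<in> Q \<Longrightarrow> rk x = rk y \<longleftrightarrow> x = y"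
  using rk_less[of x y] rk_less[of y x] less_total[of x y] Q by (metis less_irrefl_nat subsetD)

lemma rk_rows:
  assumes "x \<in> {a, b, c, d}"
  shows "rk (x \<otimes> a) < rk (x \<otimes> b)" "rk (x \<otimes> b) < rk (x \<otimes> c)" "rk (x \<otimes> c) < rk (x \<otimes> d)"
    "rk (a \<otimes> x) < rk (b \<otimes> x)" "rk (b \<otimes> x) < rk (c \<otimes> x)" "rk (c \<otimes> x) < rk (d \<otimes> x)"
  using assms lt mult_less_left mult_less_right by (auto intro!: rk_less)

lemmas rk_table = rk_rows[of a, simplified] rk_rows[of b, simplified]
  rk_rows[of c, simplified] rk_rows[of d, simplified]

text \<open>Ten products of distinct ranks exhaust \<open>Q\<close>; any other product must coincide
  with one of them, and monotonicity then leaves few candidates.\<close>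

lemma Q_list:
  assumes "distinct (map rk xs)" "set xs \<subseteq> Q" "length xs = 10" "x \<in> Q"
  shows "x \<in> set xs"
proof -
  have "card (set xs) = 10" using assms(1,3) by (metis distinct_card distinct_map)
  then have "set xs = Q" using Q card_seteq[OF Q(1) assms(2)] by simp
  then show ?thesis using assms by simp
qed

text \<open>If \<open>b\<close> and \<open>c\<close> commute, then \<open>d\<close> is outside the
  subgroup they generate. At least three translates of \<open>b, c\<close> by \<open>d\<close>,
  together with \<open>d d\<close>, are then new to the square of \<open>{a, b, c}\<close>, which
  has at least 7 elements: 11 products in all.\<close>

lemma bc_noncommuting: "b \<otimes> c \<noteq> c \<otimes> b"
proof
  assume bc: "b \<otimes> c = c \<otimes> b"
  let ?L = "{b, c}" and ?T = "{a, b, c}"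
  let ?Y = "(\<lambda>t. d \<otimes> t) ` ?L \<union> (\<lambda>t. t \<otimes> d) ` ?L"
  have L: "?L \<subseteq> carrier G" "pairwise_commute G ?L" using bc by (auto simp: pairwise_commute_def)
  obtain t where t: "t \<in> ?L" "d \<otimes> t \<noteq> t \<otimes> d"
    using upper_nc bc unfolding pairwise_commute_def by (metis insert_iff singletonD)
  have bcne: "b \<noteq> c" "a \<noteq> b" "a \<noteq> c" using lt less_irrefl less_trans by blast+
  have "3 \<le> card ?Y" using card_translates_ge[OF _ L(1) car(4) t] bcne by simp
  have dg: "d \<notin> generate G ?L"
    using t generate_commute[OF L] generate.incl[OF t(1)] by blast
  have new: "z \<notin> ?T <#> ?T" if z: "z \<in> ?Y" for z
  proof
    assume "z \<in> ?T <#> ?T"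
    then obtain u v where uv: "u \<in> ?T" "v \<in> ?T" "z = u \<otimes> v" by (rule set_multE)
    have "z \<in> {d \<otimes> b, d \<otimes> c, b \<otimes> d, c \<otimes> d}" using z by auto
    then have big: "rk (b \<otimes> c) < rk z" using rk_table bc by auto
    have "u \<noteq> a \<and> v \<noteq> a"
    proof (rule ccontr)
      assume "\<not> ?thesis"
      then have "z \<in> {a \<otimes> a, a \<otimes> b, a \<otimes> c, b \<otimes> a, c \<otimes> a}" using uv by auto
      then have "rk z < rk (b \<otimes> c)" using rk_table bc by auto
      then show False using big by simp
    qed
    then have "u \<in> generate G ?L" "v \<in> generate G ?L" using uv by (auto intro: generate.incl)
    then have "z \<in> generate G ?L" using uv(3) generate.eng[of u G ?L v] by simp
    moreover obtain w where "w \<in> ?L" "z = d \<otimes> w \<or> z = w \<otimes> d" using z by auto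
    ultimately have "d \<in> generate G ?L"
      using generate_cancel[OF L(1) generate.incl car(4)] by metis
    then show False using dg by simp
  qed
  have "d \<otimes> d \<notin> (?T <#> ?T) \<union> ?Y"
  proof
    assume "d \<otimes> d \<in> (?T <#> ?T) \<union> ?Y"
    then have "d \<otimes> d \<in> {a \<otimes> a, a \<otimes> b, a \<otimes> c, b \<otimes> a, b \<otimes> b, b \<otimes> c, c \<otimes> a, c \<otimes> b, c \<otimes> c,
        d \<otimes> b, d \<otimes> c, b \<otimes> d, c \<otimes> d}"
      by (auto simp: set_mult_def)
    then have "rk (d \<otimes> d) < rk (d \<otimes> d)" using rk_table by auto
    then show False by simp
  qed
  then have "card (insert (d \<otimes> d) ?Y) = card ?Y + 1" "d \<otimes> d \<notin> ?T <#> ?T"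
    by (auto intro!: card_insert_disjoint simp del: insert_iff)
  moreover have "card (?T <#> ?T) + card (insert (d \<otimes> d) ?Y) \<le> card Q"
  proof (rule card_add_le[OF Q(1)])
    show "?T <#> ?T \<subseteq> Q" unfolding Q_def by (rule mono_set_mult) auto
    show "insert (d \<otimes> d) ?Y \<subseteq> Q" by auto
    show "(?T <#> ?T) \<inter> insert (d \<otimes> d) ?Y = {}" using new calculation(2) by blast
  qed
  moreover have "3 * card ?T \<le> card (?T <#> ?T) + 2"
    by (rule noncommuting_square_card) (use lower_nc in auto)
  then have "7 \<le> card (?T <#> ?T)" using bcne by simp
  ultimately show False using \<open>3 \<le> card ?Y\<close> Q(3) by simp
qed

lemma bc_rk: "rk (b \<otimes> c) \<noteq> rk (c \<otimes> b)"
  using bc_noncommuting by (simp add: rk_eq)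


lemma distinct_abcd [simp]:
  "a \<noteq> b" "b \<noteq> a" "a \<noteq> c" "c \<noteq> a" "a \<noteq> d" "d \<noteq> a" "b \<noteq> c" "c \<noteq> b" "b \<noteq> d" "d \<noteq> b" "c \<noteq> d" "d \<noteq> c"
  using lt less_trans less_irrefl by blast+

text \<open>The squares and the products of neighbours are ten different elements when no
  neighbouring pair commutes, so they are all of \<open>Q\<close>.\<close>

lemma step_relations:
  assumes ab: "a \<otimes> b \<noteq> b \<otimes> a" and cd: "c \<otimes> d \<noteq> d \<otimes> c"
  shows "x \<in> Q \<Longrightarrow> x \<in> set [a \<otimes> a, a \<otimes> b, b \<otimes> a, b \<otimes> b, b \<otimes> c, c \<otimes> b, c \<otimes> c, c \<otimes> d, d \<otimes> c, d \<otimes> d]"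
proof (erule Q_list[rotated 3])
  have "rk (a \<otimes> b) \<noteq> rk (b \<otimes> a)" "rk (c \<otimes> d) \<noteq> rk (d \<otimes> c)" using ab cd by (simp_all add: rk_eq)
  then show "distinct (map rk [a \<otimes> a, a \<otimes> b, b \<otimes> a, b \<otimes> b, b \<otimes> c, c \<otimes> b, c \<otimes> c, c \<otimes> d, d \<otimes> c, d \<otimes> d])"
    using rk_table bc_rk by auto
qed auto

text \<open>Of the nine combinations, three make \<open>a, b\<close> or \<open>b, c\<close> commute
  by the two preceding square-root arguments.\<close>

lemma lower_types:
  assumes "a \<otimes> c \<in> {b \<otimes> a, b \<otimes> b, c \<otimes> b}" "c \<otimes> a \<in> {a \<otimes> b, b \<otimes> b, b \<otimes> c}" "a \<otimes> b \<noteq> b \<otimes> a"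
  shows "a \<otimes> c = b \<otimes> a \<and> c \<otimes> a = b \<otimes> b \<or> a \<otimes> c = b \<otimes> a \<and> c \<otimes> a = b \<otimes> c
    \<or> a \<otimes> c = b \<otimes> b \<and> c \<otimes> a = a \<otimes> b \<or> a \<otimes> c = b \<otimes> b \<and> c \<otimes> a = b \<otimes> c
    \<or> a \<otimes> c = c \<otimes> b \<and> c \<otimes> a = a \<otimes> b \<or> a \<otimes> c = c \<otimes> b \<and> c \<otimes> a = b \<otimes> b"
  using assms commute_if_double_conj[of a b c] commute_if_products_square[of a b c]
    commute_if_double_conj[of c b a] bc_noncommuting by auto

text \<open>Up to mirror images these are the types left for \<open>a, b, c\<close> once the
  Baumslag-Solitar ones are set aside. Of the eight combinations with the types for
  \<open>b, c, d\<close>, only the Fibonacci one survives.\<close>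

lemma no_commuting_neighbours_half:
  assumes ab: "a \<otimes> b \<noteq> b \<otimes> a" and cd: "c \<otimes> d \<noteq> d \<otimes> c"
    and T: "a \<otimes> c = b \<otimes> a \<and> c \<otimes> a = b \<otimes> b \<or> a \<otimes> c = b \<otimes> b \<and> c \<otimes> a = b \<otimes> c"
    and U: "b \<otimes> d = c \<otimes> b \<and> d \<otimes> b = c \<otimes> c \<or> b \<otimes> d = c \<otimes> c \<and> d \<otimes> b = b \<otimes> c
      \<or> b \<otimes> d = c \<otimes> c \<and> d \<otimes> b = c \<otimes> d \<or> b \<otimes> d = d \<otimes> c \<and> d \<otimes> b = c \<otimes> c"
  shows "a \<otimes> c = b \<otimes> a \<and> c \<otimes> a = b \<otimes> b \<and> b \<otimes> d = c \<otimes> c \<and> d \<otimes> b = c \<otimes> d"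
proof -
  note E = step_relations[OF ab cd]
  have ad: "a \<otimes> d \<in> set [a \<otimes> a, a \<otimes> b, b \<otimes> a, b \<otimes> b, b \<otimes> c, c \<otimes> b, c \<otimes> c, c \<otimes> d, d \<otimes> c, d \<otimes> d]"
    and da: "d \<otimes> a \<in> set [a \<otimes> a, a \<otimes> b, b \<otimes> a, b \<otimes> b, b \<otimes> c, c \<otimes> b, c \<otimes> c, c \<otimes> d, d \<otimes> c, d \<otimes> d]"
    by (rule E; simp)+
  show ?thesis
    using T
  proof
    assume T: "a \<otimes> c = b \<otimes> a \<and> c \<otimes> a = b \<otimes> b"
    \<comment> \<open>Computing \<open>adb\<close> puts \<open>ad\<close> strictly between
      \<open>ba = ac\<close> and \<open>bb\<close>, where no listed product is available.\<close>
    have no_cc: False if "d \<otimes> b = c \<otimes> c" and bd: "b \<otimes> d = c \<otimes> b \<or> b \<otimes> d = d \<otimes> c"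
    proof -
      have "a \<otimes> d \<otimes> b = a \<otimes> c \<otimes> c" using that by (simp add: m_assoc)
      also have "\<dots> = b \<otimes> b \<otimes> a" using T by (simp add: m_assoc)
      also have "\<dots> \<lless> b \<otimes> b \<otimes> b" using lt by (simp add: mult_less_left)
      finally have less: "a \<otimes> d \<otimes> b \<lless> b \<otimes> b \<otimes> b" .
      have "a \<otimes> d \<lless> b \<otimes> b"
        using less less_total[of "a \<otimes> d" "b \<otimes> b"] mult_less_right[of "b \<otimes> b" "a \<otimes> d" b] less_asym less_irrefl
        by (metis car(1,2,4) m_closed)
      then have "rk (a \<otimes> d) < rk (b \<otimes> b)" by (simp add: rk_less)
      then show False using ad T rk_table by auto
    qed
    have no_bc: False if "b \<otimes> d = c \<otimes> c" "d \<otimes> b = b \<otimes> c"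
    proof -
      have "d \<otimes> a = c \<otimes> b" using da that T rk_table by auto
      then have "b \<otimes> (c \<otimes> b) = b \<otimes> d \<otimes> a" by (simp add: m_assoc)
      also have "\<dots> = c \<otimes> (c \<otimes> a)" using that by (simp add: m_assoc)
      also have "\<dots> = c \<otimes> b \<otimes> b" using T by (simp add: m_assoc)
      finally show False using bc_noncommuting by (simp add: m_assoc [symmetric])
    qed
    show ?thesis using U T no_cc no_bc by auto
  next
    assume T: "a \<otimes> c = b \<otimes> b \<and> c \<otimes> a = b \<otimes> c"
    have dac: "d \<otimes> a \<otimes> c = d \<otimes> b \<otimes> b" using T by (simp add: m_assoc)
    have no_cc: False if db: "d \<otimes> b = c \<otimes> c"
    proof -
      have "d \<otimes> a = c \<otimes> b" using da db T rk_table by auto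
      then have "c \<otimes> b \<otimes> c = c \<otimes> c \<otimes> b" using dac db by simp
      then show False using bc_noncommuting by (simp add: m_assoc)
    qed
    have no_cd: False if db: "d \<otimes> b = c \<otimes> d"
    proof -
      have eq: "d \<otimes> a \<otimes> c = c \<otimes> c \<otimes> d" using dac db by (simp add: m_assoc)
      have "d \<otimes> a = c \<otimes> b \<or> d \<otimes> a = c \<otimes> c \<or> d \<otimes> a = d \<otimes> c" using da db T rk_table by auto
      moreover have "d \<otimes> a \<noteq> d \<otimes> c" by simp
      moreover have "c \<otimes> b \<otimes> c \<noteq> c \<otimes> c \<otimes> d"
        using mult_less[OF lt(2) lt(3)] less_irrefl by (auto simp: m_assoc)
      moreover have "c \<otimes> c \<otimes> c \<noteq> c \<otimes> c \<otimes> d" by (simp add: m_assoc)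
      ultimately show False using eq by metis
    qed
    have no_bc: False if "d \<otimes> b = b \<otimes> c" using that T rk_table by auto
    show ?thesis using U no_cc no_cd no_bc by auto
  qed
qed

end

context group
begin

lemma commute_mult:
  assumes "x \<in> carrier G" "y \<in> carrier G" "z \<in> carrier G" "z \<otimes> x = x \<otimes> z" "z \<otimes> y = y \<otimes> z"
  shows "z \<otimes> (x \<otimes> y) = x \<otimes> y \<otimes> z"
  using assms by (metis m_assoc)

lemma commute_left_factor:
  assumes "x \<in> carrier G" "y \<in> carrier G" "z \<in> carrier G" "z \<otimes> (x \<otimes> y) = x \<otimes> y \<otimes> z" "z \<otimes> y = y \<otimes> z"
  shows "z \<otimes> x = x \<otimes> z"
proof -
  have "z \<otimes> x \<otimes> y = x \<otimes> z \<otimes> y" using assms by (simp add: m_assoc)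
  then show ?thesis using assms by (simp only: r_cancel m_closed)
qed

lemma commute_right_factor:
  assumes "x \<in> carrier G" "y \<in> carrier G" "z \<in> carrier G" "z \<otimes> (x \<otimes> y) = x \<otimes> y \<otimes> z" "z \<otimes> x = x \<otimes> z"
  shows "z \<otimes> y = y \<otimes> z"
proof -
  have "x \<otimes> (z \<otimes> y) = z \<otimes> (x \<otimes> y)" using assms(1-3) assms(5)[symmetric] by (simp add: m_assoc [symmetric])
  also have "\<dots> = x \<otimes> (y \<otimes> z)" using assms by (simp add: m_assoc)
  finally show ?thesis using assms by (simp only: l_cancel m_closed)
qed

end

text \<open>
  In order: Baumslag-Solitar relations for \<open>a, b, c\<close> and for \<open>b, c, d\<close>, Fibonacci relations,
  Heisenberg relations, each together with its mirror image in the opposite group.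
\<close>

definition four_relations :: "('a, 'b) monoid_scheme \<Rightarrow> 'a \<Rightarrow> 'a \<Rightarrow> 'a \<Rightarrow> 'a \<Rightarrow> bool" where
  "four_relations G a b c d \<longleftrightarrow>
    a \<otimes>\<^bsub>G\<^esub> c = b \<otimes>\<^bsub>G\<^esub> a \<and> c \<otimes>\<^bsub>G\<^esub> a = b \<otimes>\<^bsub>G\<^esub> c \<or> a \<otimes>\<^bsub>G\<^esub> c = c \<otimes>\<^bsub>G\<^esub> b \<and> c \<otimes>\<^bsub>G\<^esub> a = a \<otimes>\<^bsub>G\<^esub> b
  \<or> b \<otimes>\<^bsub>G\<^esub> d = c \<otimes>\<^bsub>G\<^esub> b \<and> d \<otimes>\<^bsub>G\<^esub> b = c \<otimes>\<^bsub>G\<^esub> d \<or> b \<otimes>\<^bsub>G\<^esub> d = d \<otimes>\<^bsub>G\<^esub> c \<and> d \<otimes>\<^bsub>G\<^esub> b = b \<otimes>\<^bsub>G\<^esub> c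
  \<or> a \<otimes>\<^bsub>G\<^esub> c = b \<otimes>\<^bsub>G\<^esub> a \<and> c \<otimes>\<^bsub>G\<^esub> a = b \<otimes>\<^bsub>G\<^esub> b \<and> b \<otimes>\<^bsub>G\<^esub> d = c \<otimes>\<^bsub>G\<^esub> c \<and> d \<otimes>\<^bsub>G\<^esub> b = c \<otimes>\<^bsub>G\<^esub> d
  \<or> c \<otimes>\<^bsub>G\<^esub> a = a \<otimes>\<^bsub>G\<^esub> b \<and> a \<otimes>\<^bsub>G\<^esub> c = b \<otimes>\<^bsub>G\<^esub> b \<and> d \<otimes>\<^bsub>G\<^esub> b = c \<otimes>\<^bsub>G\<^esub> c \<and> b \<otimes>\<^bsub>G\<^esub> d = d \<otimes>\<^bsub>G\<^esub> c
  \<or> a \<otimes>\<^bsub>G\<^esub> b = b \<otimes>\<^bsub>G\<^esub> a \<and> c \<otimes>\<^bsub>G\<^esub> d = d \<otimes>\<^bsub>G\<^esub> c \<and>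
    (c \<otimes>\<^bsub>G\<^esub> a = b \<otimes>\<^bsub>G\<^esub> c \<and> b \<otimes>\<^bsub>G\<^esub> d = c \<otimes>\<^bsub>G\<^esub> b \<and> a \<otimes>\<^bsub>G\<^esub> d = b \<otimes>\<^bsub>G\<^esub> c
      \<or> a \<otimes>\<^bsub>G\<^esub> c = c \<otimes>\<^bsub>G\<^esub> b \<and> d \<otimes>\<^bsub>G\<^esub> b = b \<otimes>\<^bsub>G\<^esub> c \<and> d \<otimes>\<^bsub>G\<^esub> a = c \<otimes>\<^bsub>G\<^esub> b)"

section \<open>Relations among four elements, according to which outer pairs commute\<close>

context four_elements
begin

text \<open>Otherwise \<open>c\<close> would commute with a product of \<open>b\<close> and
  \<open>d\<close> and with \<open>d\<close>, hence with \<open>b\<close>.\<close>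

lemma cc_noncommuting:
  assumes "c \<otimes> d = d \<otimes> c"
  shows "b \<otimes> d \<noteq> c \<otimes> c" "d \<otimes> b \<noteq> c \<otimes> c"
proof -
  show "b \<otimes> d \<noteq> c \<otimes> c"
  proof
    assume "b \<otimes> d = c \<otimes> c"
    then have "c \<otimes> (b \<otimes> d) = b \<otimes> d \<otimes> c" by (simp add: m_assoc)
    then show False using commute_left_factor[of b d c] assms bc_noncommuting by simp
  qed
  show "d \<otimes> b \<noteq> c \<otimes> c"
  proof
    assume "d \<otimes> b = c \<otimes> c"
    then have "c \<otimes> (d \<otimes> b) = d \<otimes> b \<otimes> c" by (simp add: m_assoc)
    then show False using commute_right_factor[of d b c] assms bc_noncommuting by simp
  qed
qed

lemma bb_noncommuting:
  assumes "a \<otimes> b = b \<otimes> a"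
  shows "a \<otimes> c \<noteq> b \<otimes> b" "c \<otimes> a \<noteq> b \<otimes> b"
  using four_elements.cc_noncommuting[OF converse] assms by simp_all

lemma neighbours_noncommuting_relations:
  assumes ab: "a \<otimes> b \<noteq> b \<otimes> a" and cd: "c \<otimes> d \<noteq> d \<otimes> c"
  shows "four_relations G a b c d"
proof -
  note E = step_relations[OF ab cd]
  have "a \<otimes> c \<in> {b \<otimes> a, b \<otimes> b, c \<otimes> b}" using E[of "a \<otimes> c"] rk_table by auto
  moreover have "c \<otimes> a \<in> {a \<otimes> b, b \<otimes> b, b \<otimes> c}" using E[of "c \<otimes> a"] rk_table by auto
  ultimately have T: "a \<otimes> c = b \<otimes> a \<and> c \<otimes> a = b \<otimes> b \<or> a \<otimes> c = b \<otimes> a \<and> c \<otimes> a = b \<otimes> c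
    \<or> a \<otimes> c = b \<otimes> b \<and> c \<otimes> a = a \<otimes> b \<or> a \<otimes> c = b \<otimes> b \<and> c \<otimes> a = b \<otimes> c
    \<or> a \<otimes> c = c \<otimes> b \<and> c \<otimes> a = a \<otimes> b \<or> a \<otimes> c = c \<otimes> b \<and> c \<otimes> a = b \<otimes> b"
    using lower_types ab by blast
  have bd: "b \<otimes> d \<in> {c \<otimes> b, c \<otimes> c, d \<otimes> c}" using E[of "b \<otimes> d"] rk_table by auto
  have db: "d \<otimes> b \<in> {b \<otimes> c, c \<otimes> c, c \<otimes> d}" using E[of "d \<otimes> b"] rk_table by auto
  have U: "b \<otimes> d = c \<otimes> b \<and> d \<otimes> b = c \<otimes> c \<or> b \<otimes> d = c \<otimes> b \<and> d \<otimes> b = c \<otimes> d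
    \<or> b \<otimes> d = c \<otimes> c \<and> d \<otimes> b = b \<otimes> c \<or> b \<otimes> d = c \<otimes> c \<and> d \<otimes> b = c \<otimes> d
    \<or> b \<otimes> d = d \<otimes> c \<and> d \<otimes> b = b \<otimes> c \<or> b \<otimes> d = d \<otimes> c \<and> d \<otimes> b = c \<otimes> c"
    using bd db commute_if_double_conj[of b c d] commute_if_products_square[of b c d]
      commute_if_double_conj[of d c b] bc_noncommuting cd by auto
  interpret op: four_elements "opposite G" le a b c d by (rule opposite)
  show ?thesis
    using T U no_commuting_neighbours_half[OF ab cd] op.no_commuting_neighbours_half ab cd
    unfolding four_relations_def opposite_simps by metis
qed

text \<open>The larger of \<open>bd\<close> and \<open>db\<close> exceeds both \<open>bc\<close> and
  \<open>cb\<close> and completes a list of ten products; the smaller one must then coincide with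
  \<open>cb\<close> or \<open>bc\<close> respectively.\<close>

lemma upper_commuting_types:
  assumes ab: "a \<otimes> b \<noteq> b \<otimes> a" and cd: "c \<otimes> d = d \<otimes> c" and bd: "b \<otimes> d \<noteq> d \<otimes> b"
  shows "b \<otimes> d = c \<otimes> b \<or> d \<otimes> b = b \<otimes> c"
proof -
  have ne: "rk (a \<otimes> b) \<noteq> rk (b \<otimes> a)" "rk (b \<otimes> d) \<noteq> rk (d \<otimes> b)" "rk (b \<otimes> d) \<noteq> rk (c \<otimes> c)" "rk (d \<otimes> b) \<noteq> rk (c \<otimes> c)"
    using ab bd cc_noncommuting[OF cd] by (simp_all add: rk_eq)
  have cd': "rk (c \<otimes> d) = rk (d \<otimes> c)" using cd by simp
  show ?thesis
  proof (cases "rk (b \<otimes> d) < rk (d \<otimes> b)")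
    case True
    have "b \<otimes> d \<in> set [a \<otimes> a, a \<otimes> b, b \<otimes> a, b \<otimes> b, b \<otimes> c, c \<otimes> b, c \<otimes> c, d \<otimes> b, c \<otimes> d, d \<otimes> d]"
      by (rule Q_list) (use True ne cd' rk_table bc_rk in auto)
    then show ?thesis using True ne rk_table by auto
  next
    case False
    then have lt': "rk (d \<otimes> b) < rk (b \<otimes> d)" using ne(2) by simp
    have "d \<otimes> b \<in> set [a \<otimes> a, a \<otimes> b, b \<otimes> a, b \<otimes> b, b \<otimes> c, c \<otimes> b, c \<otimes> c, b \<otimes> d, c \<otimes> d, d \<otimes> d]"
      by (rule Q_list) (use lt' ne cd' rk_table bc_rk in auto)
    then show ?thesis using lt' cc_noncommuting(2)[OF cd] cd' rk_table by auto
  qed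
qed

lemma upper_commuting_list:
  assumes ab: "a \<otimes> b \<noteq> b \<otimes> a" and cd: "c \<otimes> d = d \<otimes> c" and bd: "b \<otimes> d = c \<otimes> b \<or> b \<otimes> d = d \<otimes> b"
    and x: "x \<in> Q"
  shows "x \<in> {a \<otimes> a, a \<otimes> b, b \<otimes> a, b \<otimes> b, b \<otimes> c, c \<otimes> b, c \<otimes> c, d \<otimes> b, c \<otimes> d, d \<otimes> d}"
proof -
  have ne: "rk (a \<otimes> b) \<noteq> rk (b \<otimes> a)" "rk (d \<otimes> b) \<noteq> rk (c \<otimes> c)"
    using ab cc_noncommuting[OF cd] by (simp_all add: rk_eq)
  have cd': "rk (c \<otimes> d) = rk (d \<otimes> c)" using cd by simp
  have "rk (b \<otimes> c) < rk (d \<otimes> b)" using bd rk_table by auto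
  then have "x \<in> set [a \<otimes> a, a \<otimes> b, b \<otimes> a, b \<otimes> b, b \<otimes> c, c \<otimes> b, c \<otimes> c, d \<otimes> b, c \<otimes> d, d \<otimes> d]"
    by (intro Q_list[OF _ _ _ x]) (use ne cd' rk_table bc_rk in auto)
  then show ?thesis by simp
qed

text \<open>Since \<open>bd = cb\<close>, \<open>ad\<close> lies below \<open>cb\<close>, which
  leaves few values for \<open>ac\<close> and \<open>ad\<close>. Because \<open>c\<close> and
  \<open>d\<close> commute, \<open>adc\<close> can be computed in two ways; this refutes two of the
  remaining types, and \<open>bdb\<close> refutes the third.\<close>

lemma upper_commuting_conj:
  assumes ab: "a \<otimes> b \<noteq> b \<otimes> a" and cd: "c \<otimes> d = d \<otimes> c" and bd: "b \<otimes> d = c \<otimes> b"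
  shows False
proof -
  note E = upper_commuting_list[OF ab cd disjI1[OF bd]]
  have bd_rk: "rk (b \<otimes> d) = rk (c \<otimes> b)" using bd by simp
  have "a \<otimes> c \<in> {b \<otimes> a, b \<otimes> b}" using E[of "a \<otimes> c"] rk_table bd_rk by auto
  moreover have "c \<otimes> a \<in> {a \<otimes> b, b \<otimes> b, b \<otimes> c}" using E[of "c \<otimes> a"] rk_table by auto
  moreover have "a \<otimes> c = c \<otimes> b \<Longrightarrow> False" using rk_table bd_rk by auto
  ultimately have T: "a \<otimes> c = b \<otimes> a \<or> a \<otimes> c = b \<otimes> b \<and> c \<otimes> a = a \<otimes> b \<or> a \<otimes> c = b \<otimes> b \<and> c \<otimes> a = b \<otimes> c"
    using lower_types ab by blast
  have ad: "a \<otimes> d = b \<otimes> b \<or> a \<otimes> d = b \<otimes> c \<or> a \<otimes> d = b \<otimes> a"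
    using E[of "a \<otimes> d"] rk_table bd_rk by auto
  have adc: "a \<otimes> d \<otimes> c = a \<otimes> c \<otimes> d" using cd by (simp add: m_assoc)
  from T show False
  proof (elim disjE conjE)
    assume ac: "a \<otimes> c = b \<otimes> a"
    have "a \<otimes> d \<noteq> b \<otimes> a" using ac by (metis car distinct_abcd(11) l_cancel)
    moreover have "a \<otimes> d \<otimes> c = b \<otimes> (a \<otimes> d)" using adc ac by (simp add: m_assoc)
    moreover have "b \<otimes> b \<otimes> c \<noteq> b \<otimes> (b \<otimes> b)" "b \<otimes> c \<otimes> c \<noteq> b \<otimes> (b \<otimes> c)" by (simp_all add: m_assoc)
    ultimately show False using ad by metis
  next
    assume ac: "a \<otimes> c = b \<otimes> b" "c \<otimes> a = a \<otimes> b"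
    have "a \<otimes> d = b \<otimes> c" using ad ac(1) rk_table by auto
    moreover have "a \<otimes> d \<otimes> c = b \<otimes> (c \<otimes> b)" using adc ac bd by (simp add: m_assoc)
    ultimately show False by (simp add: m_assoc)
  next
    assume ac: "a \<otimes> c = b \<otimes> b" "c \<otimes> a = b \<otimes> c"
    have "b \<otimes> (d \<otimes> b) = c \<otimes> (a \<otimes> c)" using ac bd by (simp add: m_assoc [symmetric])
    also have "\<dots> = c \<otimes> a \<otimes> c" by (simp add: m_assoc)
    also have "\<dots> = b \<otimes> (c \<otimes> c)" using ac(2) by (simp add: m_assoc)
    finally have "d \<otimes> b = c \<otimes> c" by simp
    then show False using cc_noncommuting[OF cd] by simp
  qed
qed

text \<open>In every type, \<open>ac\<close> or \<open>ca\<close> is a word in \<open>b\<close> and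
  \<open>c\<close>, with which \<open>d\<close> commutes; cancelling \<open>c\<close> shows that
  \<open>d\<close> commutes with \<open>a\<close>.\<close>

lemma upper_central_types:
  assumes ab: "a \<otimes> b \<noteq> b \<otimes> a" and cd: "c \<otimes> d = d \<otimes> c" and bd: "b \<otimes> d = d \<otimes> b"
  shows "a \<otimes> c = b \<otimes> a \<and> c \<otimes> a = b \<otimes> b \<or> a \<otimes> c = b \<otimes> a \<and> c \<otimes> a = b \<otimes> c
    \<or> a \<otimes> c = b \<otimes> b \<and> c \<otimes> a = a \<otimes> b \<or> a \<otimes> c = b \<otimes> b \<and> c \<otimes> a = b \<otimes> c
    \<or> a \<otimes> c = c \<otimes> b \<and> c \<otimes> a = a \<otimes> b \<or> a \<otimes> c = c \<otimes> b \<and> c \<otimes> a = b \<otimes> b"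
    and "a \<otimes> d = d \<otimes> a"
    and "a \<otimes> d = b \<otimes> b \<or> a \<otimes> d = b \<otimes> c \<or> a \<otimes> d = c \<otimes> b \<or> a \<otimes> d = c \<otimes> c"
proof -
  note E = upper_commuting_list[OF ab cd disjI2[OF bd]]
  have bd_rk: "rk (b \<otimes> d) = rk (d \<otimes> b)" "rk (c \<otimes> d) = rk (d \<otimes> c)" using bd cd by simp_all
  have "a \<otimes> c \<in> {b \<otimes> a, b \<otimes> b, c \<otimes> b}" using E[of "a \<otimes> c"] rk_table bd_rk by auto
  moreover have "c \<otimes> a \<in> {a \<otimes> b, b \<otimes> b, b \<otimes> c}" using E[of "c \<otimes> a"] rk_table bd_rk by auto
  ultimately show T: "a \<otimes> c = b \<otimes> a \<and> c \<otimes> a = b \<otimes> b \<or> a \<otimes> c = b \<otimes> a \<and> c \<otimes> a = b \<otimes> c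
    \<or> a \<otimes> c = b \<otimes> b \<and> c \<otimes> a = a \<otimes> b \<or> a \<otimes> c = b \<otimes> b \<and> c \<otimes> a = b \<otimes> c
    \<or> a \<otimes> c = c \<otimes> b \<and> c \<otimes> a = a \<otimes> b \<or> a \<otimes> c = c \<otimes> b \<and> c \<otimes> a = b \<otimes> b"
    using lower_types ab by blast
  have comm: "d \<otimes> (x \<otimes> y) = x \<otimes> y \<otimes> d" if "x \<in> {b, c}" "y \<in> {b, c}" for x y
    using that bd cd by (intro commute_mult) auto
  have "d \<otimes> (c \<otimes> a) = c \<otimes> a \<otimes> d \<or> d \<otimes> (a \<otimes> c) = a \<otimes> c \<otimes> d"
    using T comm[of b b] comm[of b c] comm[of c b] by auto
  then show da: "a \<otimes> d = d \<otimes> a"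
    using commute_right_factor[of c a d] commute_left_factor[of a c d] cd by auto
  then have "rk (a \<otimes> d) = rk (d \<otimes> a)" by simp
  then show "a \<otimes> d = b \<otimes> b \<or> a \<otimes> d = b \<otimes> c \<or> a \<otimes> d = c \<otimes> b \<or> a \<otimes> d = c \<otimes> c"
    using E[of "a \<otimes> d"] rk_table bd_rk by auto
qed

lemma upper_central_bc:
  assumes ab: "a \<otimes> b \<noteq> b \<otimes> a" and cd: "c \<otimes> d = d \<otimes> c" and bd: "b \<otimes> d = d \<otimes> b"
    and ad: "a \<otimes> d = b \<otimes> c"
  shows False
proof -
  note T = upper_central_types(1)[OF ab cd bd]
  have acd: "a \<otimes> c \<otimes> d = b \<otimes> c \<otimes> c" using cd ad by (simp add: m_assoc) (simp add: m_assoc [symmetric])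
  have cad: "c \<otimes> a \<otimes> d = c \<otimes> b \<otimes> c" using ad by (simp add: m_assoc)
  have "a \<otimes> c \<noteq> b \<otimes> a"
  proof
    assume "a \<otimes> c = b \<otimes> a"
    then have "b \<otimes> (a \<otimes> d) = b \<otimes> c \<otimes> c" using acd by (simp add: m_assoc)
    then show False using ad by (simp add: m_assoc)
  qed
  moreover have "a \<otimes> c \<noteq> b \<otimes> b"
  proof
    assume "a \<otimes> c = b \<otimes> b"
    then have "b \<otimes> b \<otimes> d = b \<otimes> c \<otimes> c" using acd by simp
    then have "b \<otimes> d = c \<otimes> c" by (simp add: m_assoc)
    then show False using cc_noncommuting[OF cd] by simp
  qed
  ultimately have ac: "a \<otimes> c = c \<otimes> b" and ca: "c \<otimes> a = a \<otimes> b \<or> c \<otimes> a = b \<otimes> b" using T by auto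
  have bcc: "b \<otimes> c \<otimes> c = c \<otimes> b \<otimes> d" using acd ac by simp
  from ca show False
  proof
    assume "c \<otimes> a = a \<otimes> b"
    then have "c \<otimes> b \<otimes> c = a \<otimes> d \<otimes> b" using cad bd by (simp add: m_assoc)
    then have braid: "c \<otimes> b \<otimes> c = b \<otimes> c \<otimes> b" using ad by simp
    \<comment> \<open>By the relations, the square of this conjugate of \<open>c\<close> is
      \<open>cd\<close>, which commutes with \<open>c\<close>. So \<open>w\<close> commutes with
      \<open>c\<close>, and the braid relation then forces \<open>b = c\<close>.\<close>
    define w where "w = b \<otimes> c \<otimes> inv b"
    have w: "w \<in> carrier G" by (simp add: w_def)
    have "w \<otimes> w = b \<otimes> c \<otimes> c \<otimes> inv b" by (simp add: w_def m_assoc)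
    also have "\<dots> = c \<otimes> (d \<otimes> b) \<otimes> inv b" using bcc bd by (simp add: m_assoc)
    finally have "w \<otimes> w = c \<otimes> d" by (simp add: m_assoc)
    moreover have "c \<otimes> d \<otimes> c = c \<otimes> (c \<otimes> d)" using cd[symmetric] by (simp add: m_assoc)
    ultimately have "w \<otimes> c = c \<otimes> w" using square_commute[of w c] w by simp
    also have "c \<otimes> w = c \<otimes> b \<otimes> c \<otimes> inv b" by (simp add: w_def m_assoc)
    also have "\<dots> = b \<otimes> c" using braid by (simp add: m_assoc)
    finally have "inv b \<otimes> c = \<one>" by (simp add: w_def m_assoc)
    then have "c = b" by (metis car(2,3) inv_cancel_left(2) r_one)
    then show False by simp
  next
    assume "c \<otimes> a = b \<otimes> b"
    then have cbc: "c \<otimes> b \<otimes> c = b \<otimes> b \<otimes> d" using cad by simp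
    \<comment> \<open>Eliminating \<open>a\<close> leads to \<open>ccc = bdd\<close>; as
      \<open>c\<close> commutes with the cube and with \<open>dd\<close>, it commutes with
      \<open>b\<close>.\<close>
    have "b \<otimes> (c \<otimes> c \<otimes> c) = c \<otimes> b \<otimes> d \<otimes> c" using bcc by (simp add: m_assoc [symmetric])
    also have "\<dots> = c \<otimes> b \<otimes> c \<otimes> d" using cd by (simp add: m_assoc)
    also have "\<dots> = b \<otimes> (b \<otimes> (d \<otimes> d))" using cbc by (simp add: m_assoc)
    finally have ccc: "c \<otimes> c \<otimes> c = b \<otimes> (d \<otimes> d)" by simp
    have "c \<otimes> (c \<otimes> c \<otimes> c) = c \<otimes> c \<otimes> c \<otimes> c" by (simp add: m_assoc)
    then have "c \<otimes> (b \<otimes> (d \<otimes> d)) = b \<otimes> (d \<otimes> d) \<otimes> c" using ccc by simp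
    moreover have "c \<otimes> (d \<otimes> d) = d \<otimes> d \<otimes> c" using cd by (intro commute_mult) auto
    ultimately show False using commute_left_factor[of b "d \<otimes> d" c] bc_noncommuting by simp
  qed
qed

text \<open>If \<open>d\<close> does not commute with \<open>b\<close>, one mirror image of the
  conjugation relation holds. If it does, \<open>d\<close> also commutes with \<open>a\<close>, and
  each of the four possible values of \<open>ad\<close> is refuted.\<close>

lemma upper_commuting_lower_not:
  assumes ab: "a \<otimes> b \<noteq> b \<otimes> a" and cd: "c \<otimes> d = d \<otimes> c"
  shows False
proof -
  interpret op: four_elements "opposite G" le a b c d by (rule opposite)
  show False
  proof (cases "b \<otimes> d = d \<otimes> b")
    case False
    then show False
      using upper_commuting_types[OF ab cd] upper_commuting_conj[OF ab cd] op.upper_commuting_conj ab cd by auto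
  next
    case bd: True
    note T = upper_central_types[OF ab cd bd]
    have "a \<otimes> d \<noteq> b \<otimes> b"
    proof
      assume "a \<otimes> d = b \<otimes> b"
      then have "b \<otimes> (a \<otimes> d) = a \<otimes> d \<otimes> b" by (simp add: m_assoc)
      then show False using commute_left_factor[of a d b] bd ab by simp
    qed
    moreover have "a \<otimes> d \<noteq> c \<otimes> c"
    proof
      assume "a \<otimes> d = c \<otimes> c"
      then have "c \<otimes> (a \<otimes> d) = a \<otimes> d \<otimes> c" by (simp add: m_assoc)
      then have ac: "c \<otimes> a = a \<otimes> c" using commute_left_factor[of a d c] cd by simp
      then have "a \<otimes> c = b \<otimes> a \<and> (b \<otimes> a = b \<otimes> b \<or> b \<otimes> a = b \<otimes> c) \<or> a \<otimes> c = b \<otimes> b \<and> (b \<otimes> b = a \<otimes> b \<or> b \<otimes> b = b \<otimes> c)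
        \<or> a \<otimes> c = c \<otimes> b \<and> (c \<otimes> b = a \<otimes> b \<or> c \<otimes> b = b \<otimes> b)"
        using T(1) by auto
      then show False by auto
    qed
    moreover have "a \<otimes> d \<noteq> b \<otimes> c" using upper_central_bc[OF ab cd bd] by blast
    moreover have "a \<otimes> d \<noteq> c \<otimes> b" using op.upper_central_bc ab cd bd T(2) by auto
    ultimately show False using T(3) by blast
  qed
qed

lemma both_commuting_types:
  assumes ab: "a \<otimes> b = b \<otimes> a" and cd: "c \<otimes> d = d \<otimes> c"
  shows "a \<otimes> c = c \<otimes> a \<or> c \<otimes> a = b \<otimes> c \<or> a \<otimes> c = c \<otimes> b"
    and "a \<otimes> d \<in> {b \<otimes> b, b \<otimes> c, c \<otimes> b, c \<otimes> c}"
proof -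
  \<comment> \<open>The smaller of \<open>ac, ca\<close> lies below both \<open>bc\<close> and
    \<open>cb\<close>, and the larger of \<open>bd, db\<close> above both. This makes the ten listed
    products distinct without knowing how either pair is ordered.\<close>
  define p where "p = (if rk (a \<otimes> c) \<le> rk (c \<otimes> a) then a \<otimes> c else c \<otimes> a)"
  define q where "q = (if rk (b \<otimes> d) \<le> rk (d \<otimes> b) then d \<otimes> b else b \<otimes> d)"
  have rks: "rk p \<le> rk (a \<otimes> c)" "rk p \<le> rk (c \<otimes> a)" "rk (b \<otimes> d) \<le> rk q" "rk (d \<otimes> b) \<le> rk q"
    "p \<in> {a \<otimes> c, c \<otimes> a}" "q \<in> {b \<otimes> d, d \<otimes> b}" by (auto simp: p_def q_def)
  have ne: "rk (a \<otimes> c) \<noteq> rk (b \<otimes> b)" "rk (c \<otimes> a) \<noteq> rk (b \<otimes> b)" "rk (b \<otimes> d) \<noteq> rk (c \<otimes> c)" "rk (d \<otimes> b) \<noteq> rk (c \<otimes> c)"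
    using bb_noncommuting[OF ab] cc_noncommuting[OF cd] by (simp_all add: rk_eq)
  have eq: "rk (a \<otimes> b) = rk (b \<otimes> a)" "rk (c \<otimes> d) = rk (d \<otimes> c)" using ab cd by simp_all
  have E: "x \<in> set [a \<otimes> a, a \<otimes> b, p, b \<otimes> b, b \<otimes> c, c \<otimes> b, c \<otimes> c, q, c \<otimes> d, d \<otimes> d]" if "x \<in> Q" for x
    by (rule Q_list[OF _ _ _ that]) (use rks ne eq rk_table bc_rk in auto)
  have "a \<otimes> c \<in> {p, c \<otimes> b}" using E[of "a \<otimes> c"] bb_noncommuting[OF ab] rks(1-4) eq rk_table by auto
  moreover have "c \<otimes> a \<in> {p, b \<otimes> c}" using E[of "c \<otimes> a"] bb_noncommuting[OF ab] rks(1-4) eq rk_table by auto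
  ultimately show "a \<otimes> c = c \<otimes> a \<or> c \<otimes> a = b \<otimes> c \<or> a \<otimes> c = c \<otimes> b" using rks(5) by auto
  show "a \<otimes> d \<in> {b \<otimes> b, b \<otimes> c, c \<otimes> b, c \<otimes> c}" using E[of "a \<otimes> d"] rks(1-4) eq rk_table by auto
qed

text \<open>The relations give \<open>bcc = cba\<close>, and monotonicity yields the cycle
  \<open>cba < cca = acc < bcc\<close>.\<close>

lemma both_commuting_conj_order:
  assumes "a \<otimes> b = b \<otimes> a" "a \<otimes> c = c \<otimes> a" "a \<otimes> d = c \<otimes> c" "b \<otimes> d = c \<otimes> b"
  shows False
proof -
  have "b \<otimes> (c \<otimes> c) = b \<otimes> (a \<otimes> d)" using assms by simp
  also have "\<dots> = a \<otimes> (b \<otimes> d)" using assms(1) by (simp add: m_assoc [symmetric])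
  also have "\<dots> = c \<otimes> a \<otimes> b" using assms(2,4) by (simp add: m_assoc [symmetric])
  also have "\<dots> = c \<otimes> (b \<otimes> a)" using assms(1) by (simp add: m_assoc)
  also have "\<dots> \<lless> c \<otimes> (c \<otimes> a)" using lt by (simp add: mult_less_left mult_less_right)
  also have "\<dots> = c \<otimes> a \<otimes> c" using assms(2) by (simp add: m_assoc)
  also have "\<dots> = a \<otimes> (c \<otimes> c)" using assms(2)[symmetric] by (simp add: m_assoc)
  also have "\<dots> \<lless> b \<otimes> (c \<otimes> c)" using lt by (simp add: mult_less_right)
  finally show False by simp
qed

text \<open>If \<open>a\<close> and \<open>c\<close> commute, then \<open>c\<close> commutes with
  \<open>ad\<close>, so only \<open>ad = cc\<close> remains. The reversed order then offers three
  possibilities for \<open>b, d\<close>; each makes \<open>b, c\<close> commute or violates the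
  order.\<close>

lemma both_commuting_ac_noncommuting:
  assumes ab: "a \<otimes> b = b \<otimes> a" and cd: "c \<otimes> d = d \<otimes> c"
  shows "a \<otimes> c \<noteq> c \<otimes> a"
proof
  assume ac: "a \<otimes> c = c \<otimes> a"
  interpret op: four_elements "opposite G" le a b c d by (rule opposite)
  interpret rev: four_elements G "le\<inverse>" d c b a by (rule converse)
  have adc: "a \<otimes> d \<otimes> c = c \<otimes> (a \<otimes> d)" using commute_mult[of a d c] ac cd by simp
  have "a \<otimes> d \<noteq> b \<otimes> b"
    using adc square_commute[of b c] bc_noncommuting by auto
  moreover have "b \<otimes> c \<otimes> c \<noteq> c \<otimes> (b \<otimes> c)" using bc_noncommuting by (simp add: m_assoc [symmetric])
  then have "a \<otimes> d \<noteq> b \<otimes> c" using adc by auto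
  moreover have "c \<otimes> b \<otimes> c \<noteq> c \<otimes> (c \<otimes> b)" using bc_noncommuting by (simp add: m_assoc)
  then have "a \<otimes> d \<noteq> c \<otimes> b" using adc by auto
  ultimately have ad: "a \<otimes> d = c \<otimes> c" using both_commuting_types(2)[OF ab cd] by blast
  have "a \<otimes> (a \<otimes> d) = a \<otimes> d \<otimes> a" using ad commute_mult[of c c a] ac by simp
  then have da: "a \<otimes> d = d \<otimes> a" using commute_right_factor[of a d a] by simp
  have "b \<otimes> d = d \<otimes> b \<or> b \<otimes> d = c \<otimes> b \<or> d \<otimes> b = b \<otimes> c"
    using rev.both_commuting_types(1) ab cd by auto
  moreover have "b \<otimes> d \<noteq> d \<otimes> b"
  proof
    assume "b \<otimes> d = d \<otimes> b"
    then have "b \<otimes> (c \<otimes> c) = c \<otimes> c \<otimes> b" using commute_mult[of a d b] ab ad by simp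
    then show False using square_commute[of c b] bc_noncommuting by simp
  qed
  moreover have "b \<otimes> d \<noteq> c \<otimes> b" using both_commuting_conj_order ab ac ad by blast
  moreover have "d \<otimes> b \<noteq> b \<otimes> c" using op.both_commuting_conj_order ab ac ad da by auto
  ultimately show False by blast
qed

lemma both_commuting_half:
  assumes ab: "a \<otimes> b = b \<otimes> a" and cd: "c \<otimes> d = d \<otimes> c" and ca: "c \<otimes> a = b \<otimes> c" and bd: "b \<otimes> d = c \<otimes> b"
  shows "a \<otimes> d = b \<otimes> c"
proof -
  have "rk (b \<otimes> d) = rk (c \<otimes> b)" using bd by simp
  then have "a \<otimes> d = b \<otimes> b \<or> a \<otimes> d = b \<otimes> c"
    using both_commuting_types(2)[OF ab cd] rk_table by auto
  moreover have "a \<otimes> d \<noteq> b \<otimes> b"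
  proof
    assume "a \<otimes> d = b \<otimes> b"
    then have "b \<otimes> (a \<otimes> d) = a \<otimes> d \<otimes> b" by (simp add: m_assoc)
    then have "b \<otimes> d = d \<otimes> b" using commute_right_factor[of a d b] ab by simp
    then show False using bd by simp
  qed
  ultimately show ?thesis by blast
qed

lemma relations: "four_relations G a b c d"
proof -
  interpret op: four_elements "opposite G" le a b c d by (rule opposite)
  interpret rev: four_elements G "le\<inverse>" d c b a by (rule converse)
  show ?thesis
  proof (cases "a \<otimes> b = b \<otimes> a \<and> c \<otimes> d = d \<otimes> c")
    case True
    then have ab: "a \<otimes> b = b \<otimes> a" and cd: "c \<otimes> d = d \<otimes> c" by auto
    have T: "c \<otimes> a = b \<otimes> c \<or> a \<otimes> c = c \<otimes> b"
      using both_commuting_types(1)[OF ab cd] both_commuting_ac_noncommuting[OF ab cd] by blast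
    have U: "b \<otimes> d = c \<otimes> b \<or> d \<otimes> b = b \<otimes> c"
      using rev.both_commuting_types(1) rev.both_commuting_ac_noncommuting ab cd by auto
    \<comment> \<open>Monotonicity gives \<open>ca < da < db\<close> and
      \<open>ac < ad < bd\<close>, which rules out the mixed combinations.\<close>
    have "\<not> (c \<otimes> a = b \<otimes> c \<and> d \<otimes> b = b \<otimes> c)" using rk_table by auto
    moreover have "\<not> (a \<otimes> c = c \<otimes> b \<and> b \<otimes> d = c \<otimes> b)" using rk_table by auto
    ultimately have "c \<otimes> a = b \<otimes> c \<and> b \<otimes> d = c \<otimes> b \<or> a \<otimes> c = c \<otimes> b \<and> d \<otimes> b = b \<otimes> c"
      using T U by blast
    then show ?thesis
      using both_commuting_half[OF ab cd] op.both_commuting_half ab cd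
      unfolding four_relations_def opposite_simps by metis
  next
    case False
    then show ?thesis
      using upper_commuting_lower_not rev.upper_commuting_lower_not neighbours_noncommuting_relations by metis
  qed
qed

end

section \<open>The groups generated by four elements\<close>

context group
begin

lemma commutator_eq_one:
  assumes "x \<in> carrier G" "y \<in> carrier G" "x \<otimes> y = y \<otimes> x"
  shows "x \<otimes> y \<otimes> inv x \<otimes> inv y = \<one>"
proof -
  have "x \<otimes> y \<otimes> inv x \<otimes> inv y = y \<otimes> x \<otimes> inv x \<otimes> inv y" using assms by simp
  also have "\<dots> = \<one>" using assms by (simp add: m_assoc)
  finally show ?thesis .
qed

lemma inv_commutator:
  assumes "x \<in> carrier G" "y \<in> carrier G"
  shows "inv (x \<otimes> y \<otimes> inv x \<otimes> inv y) = y \<otimes> x \<otimes> inv y \<otimes> inv x"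
  using assms by (simp add: inv_mult_group m_assoc)

lemma subgroup_conj_preimage:
  assumes N: "subgroup N G" and g: "g \<in> carrier G"
  shows "subgroup {n \<in> carrier G. g \<otimes> n \<otimes> inv g \<in> N} G"
proof
  show "\<one> \<in> {n \<in> carrier G. g \<otimes> n \<otimes> inv g \<in> N}" using g subgroup.one_closed[OF N] by simp
next
  fix x assume x: "x \<in> {n \<in> carrier G. g \<otimes> n \<otimes> inv g \<in> N}"
  then have "inv (g \<otimes> x \<otimes> inv g) \<in> N" using subgroup.m_inv_closed[OF N] by blast
  then show "inv x \<in> {n \<in> carrier G. g \<otimes> n \<otimes> inv g \<in> N}"
    using x g by (simp add: inv_mult_group m_assoc)
  fix y assume y: "y \<in> {n \<in> carrier G. g \<otimes> n \<otimes> inv g \<in> N}"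
  then have "(g \<otimes> x \<otimes> inv g) \<otimes> (g \<otimes> y \<otimes> inv g) \<in> N" using x subgroup.m_closed[OF N] by blast
  then show "x \<otimes> y \<in> {n \<in> carrier G. g \<otimes> n \<otimes> inv g \<in> N}" using x y g by (simp add: conj_mult)
qed auto

text \<open>Conjugation by \<open>inv a\<close> acts on \<open>e, f\<close> like the Fibonacci matrix; nilpotency would push \<open>e\<close>
  and \<open>f\<close> arbitrarily deep into the lower central series.\<close>

lemma tame_fibonacci:
  assumes c: "a \<in> carrier G" "e \<in> carrier G" "f \<in> carrier G" and "e \<noteq> \<one>"
    and ef: "e \<otimes> f = f \<otimes> e" and ea: "e \<otimes> a = a \<otimes> f" and fa: "f \<otimes> a = a \<otimes> (f \<otimes> e)"
  shows "tame {a, e, f}"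
proof -
  define N where "N = generate G {e, f}"
  have efc: "{e, f} \<subseteq> carrier G" using c by auto
  have N: "subgroup N G" unfolding N_def by (rule generate_is_subgroup[OF efc])
  have Nc: "n \<in> carrier G" if "n \<in> N" for n using N that subgroup.mem_carrier by fast
  have mem: "e \<in> N" "f \<in> N" by (auto simp: N_def intro: generate.incl)
  have "pairwise_commute G {e, f}" using ef by (auto simp: pairwise_commute_def)
  note com = generate_commute[OF efc this, folded N_def]
  have afa: "a \<otimes> f \<otimes> inv a = e" using ea c by (metis conj_eq_iff)
  have "a \<otimes> (f \<otimes> e) \<otimes> inv a = f" using fa c by (intro iffD2[OF conj_eq_iff]) auto
  then have "(a \<otimes> f \<otimes> inv a) \<otimes> (a \<otimes> e \<otimes> inv a) = f" using c by (simp only: conj_mult)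
  then have eae: "e \<otimes> (a \<otimes> e \<otimes> inv a) = f" using afa by simp
  \<comment> \<open>The Fibonacci matrix has determinant -1, so the inverse action is integral as
    well and \<open>N\<close> is normalised in both directions.\<close>
  have aea: "a \<otimes> e \<otimes> inv a = inv e \<otimes> f"
  proof -
    have "inv e \<otimes> (e \<otimes> (a \<otimes> e \<otimes> inv a)) = inv e \<otimes> f" using eae by simp
    then show ?thesis using c by (simp only: inv_cancel_left m_closed inv_closed)
  qed
  have iea: "inv a \<otimes> e \<otimes> a = f" using ea c by (simp add: m_assoc)
  have ifa: "inv a \<otimes> f \<otimes> a = f \<otimes> e" using fa c by (simp add: m_assoc)
  have "{e, f} \<subseteq> {n \<in> carrier G. a \<otimes> n \<otimes> inv a \<in> N}"
    using c afa aea mem subgroup.m_closed[OF N] subgroup.m_inv_closed[OF N] by auto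
  from generate_subgroup_incl[OF this subgroup_conj_preimage[OF N c(1)]]
  have n1: "a \<otimes> n \<otimes> inv a \<in> N" if "n \<in> N" for n using that by (auto simp: N_def)
  have "{e, f} \<subseteq> {n \<in> carrier G. inv a \<otimes> n \<otimes> inv (inv a) \<in> N}"
    using c iea ifa mem subgroup.m_closed[OF N] by auto
  from generate_subgroup_incl[OF this subgroup_conj_preimage[OF N inv_closed[OF c(1)]]]
  have n2: "inv a \<otimes> n \<otimes> a \<in> N" if "n \<in> N" for n using that c by (auto simp: N_def)
  have n3: "x \<otimes> n \<otimes> inv x \<in> N" "inv x \<otimes> n \<otimes> x \<in> N" if "x \<in> N" "n \<in> N" for x n
    using that subgroup.m_closed[OF N] subgroup.m_inv_closed[OF N] by auto
  have k: "a \<otimes> x \<otimes> inv a \<otimes> inv x \<in> N" if "x \<in> N" for x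
    using that n1 subgroup.m_closed[OF N] subgroup.m_inv_closed[OF N] by blast
  have k': "x \<otimes> a \<otimes> inv x \<otimes> inv a \<in> N" if "x \<in> N" for x
    using subgroup.m_inv_closed[OF N k[OF that]] inv_commutator[OF c(1) Nc[OF that]] by simp
  have not_nil: "\<not> nilpotent_group G"
  proof
    assume "nilpotent_group G"
    then obtain m where m: "lower_central G m = {\<one>}" by (auto simp: nilpotent_group_def)
    have "e \<in> lower_central G n \<and> f \<in> lower_central G n" for n
    proof (induction n)
      case 0
      then show ?case using c by simp
    next
      case (Suc n)
      note sub = subgroup_lower_central[of n] and sub' = subgroup_lower_central[of "Suc n"]
      \<comment> \<open>The commutator of \<open>inv f\<close> and \<open>inv a\<close> is
        \<open>inv f (f e) = e\<close>; the one of \<open>inv e\<close> and \<open>inv a\<close>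
        below is \<open>inv e f\<close>, so both generators move one term further down.\<close>
      have "inv f \<otimes> inv a \<otimes> inv (inv f) \<otimes> inv (inv a) \<in> lower_central G (Suc n)"
        using Suc subgroup.m_inv_closed[OF sub] c by (intro lower_central_commutator) auto
      moreover have "inv f \<otimes> inv a \<otimes> inv (inv f) \<otimes> inv (inv a) = e"
        using c fa by (simp add: m_assoc)
      ultimately have e: "e \<in> lower_central G (Suc n)" by (simp del: lower_central.simps)
      have "inv e \<otimes> inv a \<otimes> inv (inv e) \<otimes> inv (inv a) \<in> lower_central G (Suc n)"
        using Suc subgroup.m_inv_closed[OF sub] c by (intro lower_central_commutator) auto
      moreover have "inv e \<otimes> inv a \<otimes> inv (inv e) \<otimes> inv (inv a) = inv e \<otimes> f"
        using c ea by (simp add: m_assoc)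
      ultimately have "e \<otimes> (inv e \<otimes> f) \<in> lower_central G (Suc n)"
        using e subgroup.m_closed[OF sub'] by simp
      then show ?case using e c by simp
    qed
    then show False using m \<open>e \<noteq> \<one>\<close> by blast
  qed
  have comm: "x \<otimes> y \<otimes> inv x \<otimes> inv y \<in> N" if "x \<in> {a, e, f}" "y \<in> {a, e, f}" for x y
  proof -
    have "a \<otimes> a \<otimes> inv a \<otimes> inv a \<in> N" using commutator_eq_one[OF c(1,1)] subgroup.one_closed[OF N] by simp
    moreover have "x \<otimes> y \<otimes> inv x \<otimes> inv y \<in> N" if "x \<in> N" "y \<in> N" for x y
      using that subgroup.m_closed[OF N] subgroup.m_inv_closed[OF N] by blast
    ultimately show ?thesis using that k k' mem by blast
  qed
  have commN: "pairwise_commute G N" unfolding pairwise_commute_def using com by blast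
  have norm: "\<forall>x\<in>{a, e, f}. \<forall>n\<in>N. x \<otimes> n \<otimes> inv x \<in> N \<and> inv x \<otimes> n \<otimes> x \<in> N"
  proof (intro ballI conjI)
    fix x n assume x: "x \<in> {a, e, f}" and n: "n \<in> N"
    have "x = a \<or> x \<in> N" using x mem by auto
    then show "x \<otimes> n \<otimes> inv x \<in> N" "inv x \<otimes> n \<otimes> x \<in> N" using n n1 n2 n3 by auto
  qed
  have comm': "\<forall>x\<in>{a, e, f}. \<forall>y\<in>{a, e, f}. x \<otimes> y \<otimes> inv x \<otimes> inv y \<in> N" using comm by blast
  have "nilpotent_group G \<longrightarrow> (\<forall>x\<in>{a, e, f}. \<forall>n\<in>N. x \<otimes> n = n \<otimes> x)" using not_nil by simp
  then show ?thesis unfolding tame_def using N commN norm comm' by (intro exI[of _ N] conjI)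
qed

end

context ordered_group
begin

text \<open>Either relation of type \<open>BS(1, 2)\<close> conjugates a nontrivial power of
  \<open>e\<close> to a power of \<open>e\<close>, so \<open>a\<close> normalises the
  isolator.\<close>

lemma tame_baumslag_solitar:
  assumes c: "a \<in> carrier G" "e \<in> carrier G" "e \<noteq> \<one>"
    and rel: "a \<otimes> (e \<otimes> e) = e \<otimes> a \<or> a \<otimes> e = e \<otimes> e \<otimes> a"
  shows "tame {a, e}"
proof -
  note I = subgroup_isolator[OF c(2)] and e = isolator_self[OF c(2)]
  have ee: "e \<otimes> e \<in> isolator e" using e subgroup.m_closed[OF I] by blast
  have "e \<otimes> e \<noteq> \<one>"
  proof
    assume "e \<otimes> e = \<one>"
    then have "e [^] (2::int) = \<one>" using int_pow_mult[OF c(2), of 1 1] c(2) by simp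
    then show False using pow_eq_one[of e 2] c by simp
  qed
  then obtain g h where gh: "g \<in> isolator e" "h \<in> isolator e" "g \<noteq> \<one>" "a \<otimes> g = h \<otimes> a"
    using rel e ee c(3) by metis
  have "a \<otimes> e \<otimes> inv a \<in> isolator e"
    using isolator_normalize[OF c(2) gh(1,3,2) c(1) gh(4) e] .
  then have k: "a \<otimes> e \<otimes> inv a \<otimes> inv e \<in> isolator e"
    using e subgroup.m_closed[OF I] subgroup.m_inv_closed[OF I] by blast
  then have k': "e \<otimes> a \<otimes> inv e \<otimes> inv a \<in> isolator e"
    using subgroup.m_inv_closed[OF I k] inv_commutator[OF c(1,2)] by simp
  show ?thesis
  proof (rule tame_isolator[OF c(2)])
    show "\<exists>g\<in>isolator e. \<exists>h\<in>isolator e. g \<noteq> \<one> \<and> x \<otimes> g = h \<otimes> x" if "x \<in> {a, e}" for x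
      using that gh e c(3) by blast
    show "x \<otimes> y \<otimes> inv x \<otimes> inv y \<in> isolator e" if "x \<in> {a, e}" "y \<in> {a, e}" for x y
      using that k k' commutator_eq_one[OF c(1,1)] commutator_eq_one[OF c(2,2)] subgroup.one_closed[OF I] by auto
  qed (use c in auto)
qed

text \<open>The hypotheses say that \<open>e\<close> is the commutator of \<open>b\<close> and
  \<open>a\<close> and commutes with both, so its isolator contains all commutators of the
  generators.\<close>

lemma tame_heisenberg:
  assumes c: "a \<in> carrier G" "b \<in> carrier G" "e \<in> carrier G" "e \<noteq> \<one>"
    and ae: "a \<otimes> e = e \<otimes> a" and be: "b \<otimes> e = e \<otimes> b" and ba: "b \<otimes> a = a \<otimes> (e \<otimes> b)"
  shows "tame {a, b, e}"
proof -
  note I = subgroup_isolator[OF c(3)] and e = isolator_self[OF c(3)]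
  have "b \<otimes> a \<otimes> inv b \<otimes> inv a = a \<otimes> e \<otimes> inv a" using ba c by (simp add: m_assoc)
  also have "\<dots> = e \<otimes> a \<otimes> inv a" using ae by simp
  also have "\<dots> = e" using c by (simp add: m_assoc)
  finally have k: "b \<otimes> a \<otimes> inv b \<otimes> inv a \<in> isolator e" using e by simp
  have k': "a \<otimes> b \<otimes> inv a \<otimes> inv b \<in> isolator e"
    using subgroup.m_inv_closed[OF I k] inv_commutator[OF c(2,1)] by simp
  have one: "x \<otimes> y \<otimes> inv x \<otimes> inv y \<in> isolator e" if "x \<in> carrier G" "y \<in> carrier G" "x \<otimes> y = y \<otimes> x" for x y
    using commutator_eq_one[OF that] subgroup.one_closed[OF I] by simp
  show ?thesis
  proof (rule tame_isolator[OF c(3)])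
    show "\<exists>g\<in>isolator e. \<exists>h\<in>isolator e. g \<noteq> \<one> \<and> x \<otimes> g = h \<otimes> x" if "x \<in> {a, b, e}" for x
      using that ae be e c(4) by blast
    show "x \<otimes> y \<otimes> inv x \<otimes> inv y \<in> isolator e" if "x \<in> {a, b, e}" "y \<in> {a, b, e}" for x y
      using that k k' one[OF c(1,1) refl] one[OF c(2,2) refl] one[OF c(3,3) refl] one[OF c(1,3) ae]
        one[OF c(3,1) ae [symmetric]] one[OF c(2,3) be] one[OF c(3,2) be [symmetric]] by blast
  qed (use c in auto)
qed

text \<open>In the first case \<open>b = ae\<close> and \<open>c = ea\<close>, and the remaining
  relation becomes \<open>aee = ea\<close>; the second case is the mirror image with
  \<open>b = ea\<close> and \<open>c = ae\<close>.\<close>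

lemma tame_three_relations:
  assumes c: "a \<in> carrier G" "b \<in> carrier G" "c \<in> carrier G" "a \<noteq> b"
    and rel: "a \<otimes> c = b \<otimes> a \<and> c \<otimes> a = b \<otimes> c \<or> a \<otimes> c = c \<otimes> b \<and> c \<otimes> a = a \<otimes> b"
  shows "tame {a, b, c}"
  using rel
proof
  assume r: "a \<otimes> c = b \<otimes> a \<and> c \<otimes> a = b \<otimes> c"
  define e where "e = inv a \<otimes> b"
  have ec: "e \<in> carrier G" using c by (simp add: e_def)
  have b: "b = a \<otimes> e" using c by (simp add: e_def)
  have "a \<otimes> c = a \<otimes> (e \<otimes> a)" using r b c ec by (simp add: m_assoc)
  then have c': "c = e \<otimes> a" using c ec by simp
  have "e \<otimes> a \<otimes> a = a \<otimes> (e \<otimes> e) \<otimes> a" using r unfolding b c' using c ec by (simp add: m_assoc)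
  then have "a \<otimes> (e \<otimes> e) = e \<otimes> a" using c ec by (metis r_cancel m_closed)
  moreover have "e \<noteq> \<one>" using b c by auto
  ultimately have "tame {a, e}" using tame_baumslag_solitar c ec by blast
  moreover have "{a, b, c} \<subseteq> generate G {a, e}"
    unfolding b c' by (auto intro: generate.incl generate.eng)
  ultimately show ?thesis using tame_lift[of "{a, e}"] c ec by simp
next
  assume r: "a \<otimes> c = c \<otimes> b \<and> c \<otimes> a = a \<otimes> b"
  define e where "e = b \<otimes> inv a"
  have ec: "e \<in> carrier G" using c by (simp add: e_def)
  have b: "b = e \<otimes> a" using c by (simp add: e_def m_assoc)
  have "c \<otimes> a = a \<otimes> e \<otimes> a" using r b c ec by (simp add: m_assoc)
  then have c': "c = a \<otimes> e" using c ec by (metis r_cancel m_closed)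
  have "a \<otimes> (a \<otimes> e) = a \<otimes> (e \<otimes> e \<otimes> a)" using r unfolding b c' using c ec by (simp add: m_assoc)
  then have "a \<otimes> e = e \<otimes> e \<otimes> a" using c ec by (metis l_cancel m_closed)
  moreover have "e \<noteq> \<one>" using b c by auto
  ultimately have "tame {a, e}" using tame_baumslag_solitar c ec by blast
  moreover have "{a, b, c} \<subseteq> generate G {a, e}"
    unfolding b c' by (auto intro: generate.incl generate.eng)
  ultimately show ?thesis using tame_lift[of "{a, e}"] c ec by simp
qed

text \<open>In terms of \<open>e = inv a b\<close> and \<open>f = inv a c\<close>, the first two
  relations give the Fibonacci action, the third gives \<open>d = aef\<close>, and the last says
  that \<open>e e\<close> commutes with \<open>f\<close>, hence so does \<open>e\<close>.\<close>

lemma tame_fibonacci_relations: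
  assumes c: "a \<in> carrier G" "b \<in> carrier G" "c \<in> carrier G" "d \<in> carrier G" "a \<noteq> b"
    and r: "a \<otimes> c = b \<otimes> a" "c \<otimes> a = b \<otimes> b" "b \<otimes> d = c \<otimes> c" "d \<otimes> b = c \<otimes> d"
  shows "tame {a, b, c, d}"
proof -
  define e where "e = inv a \<otimes> b"
  define f where "f = inv a \<otimes> c"
  define x where "x = inv a \<otimes> d"
  have car: "e \<in> carrier G" "f \<in> carrier G" "x \<in> carrier G" using c by (simp_all add: e_def f_def x_def)
  have abs: "b = a \<otimes> e" "c = a \<otimes> f" "d = a \<otimes> x" using c by (simp_all add: e_def f_def x_def)
  have ea: "e \<otimes> a = a \<otimes> f" using r(1) c(1) car unfolding abs by (simp add: m_assoc)
  have ea': "e \<otimes> (a \<otimes> z) = a \<otimes> (f \<otimes> z)" if "z \<in> carrier G" for z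
    using ea c(1) car that by (metis m_assoc)
  have "f \<otimes> a = e \<otimes> (a \<otimes> e)" using r(2) c(1) car unfolding abs by (simp add: m_assoc)
  then have fa: "f \<otimes> a = a \<otimes> (f \<otimes> e)" using ea' car by simp
  have fa': "f \<otimes> (a \<otimes> z) = a \<otimes> (f \<otimes> (e \<otimes> z))" if "z \<in> carrier G" for z
    using fa c(1) car that by (metis m_assoc m_closed)
  have x: "x = e \<otimes> f" using r(3) c(1) car unfolding abs by (simp add: m_assoc ea' fa')
  have "e \<otimes> e \<otimes> f = f \<otimes> (e \<otimes> e)"
    using r(4)[symmetric] c(1) car unfolding abs x by (simp add: m_assoc ea' fa')
  then have ef: "e \<otimes> f = f \<otimes> e" using square_commute car by blast
  have "e \<noteq> \<one>" using abs c by auto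
  then have "tame {a, e, f}" using tame_fibonacci c car ef ea fa by blast
  moreover have "{a, b, c, d} \<subseteq> generate G {a, e, f}"
    unfolding abs x by (auto intro!: generate.eng intro: generate.incl)
  ultimately show ?thesis using tame_lift[of "{a, e, f}"] c car by simp
qed

text \<open>With ratios taken on the right, conjugation by \<open>a\<close> itself is the Fibonacci
  action, so \<open>inv a\<close> takes the place of \<open>a\<close>.\<close>

lemma tame_fibonacci_relations':
  assumes c: "a \<in> carrier G" "b \<in> carrier G" "c \<in> carrier G" "d \<in> carrier G" "a \<noteq> b"
    and r: "c \<otimes> a = a \<otimes> b" "a \<otimes> c = b \<otimes> b" "d \<otimes> b = c \<otimes> c" "b \<otimes> d = d \<otimes> c"
  shows "tame {a, b, c, d}"
proof -
  define e where "e = b \<otimes> inv a"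
  define f where "f = c \<otimes> inv a"
  define x where "x = d \<otimes> inv a"
  have car: "e \<in> carrier G" "f \<in> carrier G" "x \<in> carrier G" using c by (simp_all add: e_def f_def x_def)
  have abs: "b = e \<otimes> a" "c = f \<otimes> a" "d = x \<otimes> a" using c by (simp_all add: e_def f_def x_def m_assoc)
  have "f \<otimes> a \<otimes> a = a \<otimes> e \<otimes> a" using r(1) c(1) car unfolding abs by (simp add: m_assoc)
  then have ae: "a \<otimes> e = f \<otimes> a" using c(1) car by (metis r_cancel m_closed)
  have ae': "z \<otimes> a \<otimes> e = z \<otimes> f \<otimes> a" if "z \<in> carrier G" for z
    using ae c(1) car that by (simp add: m_assoc)
  have "a \<otimes> f \<otimes> a = e \<otimes> a \<otimes> e \<otimes> a" using r(2) c(1) car unfolding abs by (simp add: m_assoc)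
  then have "a \<otimes> f = e \<otimes> a \<otimes> e" using c(1) car by (metis r_cancel m_closed)
  then have af: "a \<otimes> f = e \<otimes> f \<otimes> a" using ae' car by simp
  have af': "z \<otimes> a \<otimes> f = z \<otimes> e \<otimes> f \<otimes> a" if "z \<in> carrier G" for z
    using af c(1) car that by (simp add: m_assoc)
  have "x \<otimes> a \<otimes> e \<otimes> a = f \<otimes> a \<otimes> f \<otimes> a" using r(3) c(1) car unfolding abs by (simp add: m_assoc)
  then have "x \<otimes> f \<otimes> a \<otimes> a = f \<otimes> e \<otimes> f \<otimes> a \<otimes> a" using ae' af' car by simp
  then have x: "x = f \<otimes> e" using c(1) car by (metis r_cancel m_closed)
  have "e \<otimes> a \<otimes> f \<otimes> e \<otimes> a = f \<otimes> e \<otimes> a \<otimes> f \<otimes> a"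
    using r(4) c(1) car unfolding abs x by (simp add: m_assoc)
  then have "e \<otimes> e \<otimes> f \<otimes> f \<otimes> a \<otimes> a = f \<otimes> e \<otimes> e \<otimes> f \<otimes> a \<otimes> a" using ae' af' c(1) car by simp
  then have "e \<otimes> e \<otimes> f = f \<otimes> e \<otimes> e" using c(1) car by (metis r_cancel m_closed)
  then have ef: "e \<otimes> f = f \<otimes> e" using square_commute[of e f] car by (simp add: m_assoc)
  have "e \<noteq> \<one>" using abs c by auto
  moreover have "e \<otimes> inv a = inv a \<otimes> f"
  proof -
    have "inv a \<otimes> (a \<otimes> e) \<otimes> inv a = inv a \<otimes> (f \<otimes> a) \<otimes> inv a" using ae by simp
    then show ?thesis using c(1) car by (simp add: m_assoc)
  qed
  moreover have "f \<otimes> inv a = inv a \<otimes> (f \<otimes> e)"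
  proof -
    have "inv a \<otimes> (a \<otimes> f) \<otimes> inv a = inv a \<otimes> (e \<otimes> f \<otimes> a) \<otimes> inv a" using af by simp
    then show ?thesis using c(1) car ef by (simp add: m_assoc)
  qed
  ultimately have "tame {inv a, e, f}" using tame_fibonacci c car ef by simp
  moreover have "{a, b, c, d} \<subseteq> generate G {inv a, e, f}"
  proof -
    have "a \<in> generate G {inv a, e, f}" using generate.inv[of "inv a" "{inv a, e, f}" G] c(1) by simp
    then show ?thesis unfolding abs x by (auto intro!: generate.eng intro: generate.incl)
  qed
  ultimately show ?thesis using tame_lift[of "{inv a, e, f}"] c car by simp
qed

text \<open>The ratio \<open>e\<close> of \<open>a\<close> and \<open>b\<close> commutes with
  \<open>a\<close> because \<open>b\<close> does. The relations give \<open>d = ec\<close> or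
  \<open>d = ce\<close>, so commutation of \<open>c\<close> and \<open>d\<close> makes
  \<open>e\<close> commute with \<open>c\<close>.\<close>

lemma tame_heisenberg_relations:
  assumes c: "a \<in> carrier G" "b \<in> carrier G" "c \<in> carrier G" "d \<in> carrier G" "a \<noteq> b"
    and ab: "a \<otimes> b = b \<otimes> a" and cd: "c \<otimes> d = d \<otimes> c"
    and rel: "c \<otimes> a = b \<otimes> c \<and> a \<otimes> d = b \<otimes> c \<or> a \<otimes> c = c \<otimes> b \<and> d \<otimes> a = c \<otimes> b"
  shows "tame {a, b, c, d}"
proof -
  define e where "e = inv a \<otimes> b"
  have ec: "e \<in> carrier G" using c by (simp add: e_def)
  have b: "b = a \<otimes> e" using c by (simp add: e_def)
  have ae: "a \<otimes> e = e \<otimes> a"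
  proof -
    have "a \<otimes> (a \<otimes> e) = a \<otimes> (e \<otimes> a)" using ab unfolding b using c ec by (simp add: m_assoc)
    then show ?thesis using c ec by (metis l_cancel m_closed)
  qed
  have e1: "e \<noteq> \<one>" using b c by auto
  have main: "tame {a, c, e} \<and> d \<in> generate G {a, c, e}"
    using rel
  proof
    assume r: "c \<otimes> a = b \<otimes> c \<and> a \<otimes> d = b \<otimes> c"
    then have "a \<otimes> d = a \<otimes> (e \<otimes> c)" unfolding b using c ec by (simp add: m_assoc)
    then have d: "d = e \<otimes> c" using c ec by (metis l_cancel m_closed)
    have "c \<otimes> e \<otimes> c = e \<otimes> c \<otimes> c" using cd unfolding d using c ec by (simp add: m_assoc)
    then have ce: "c \<otimes> e = e \<otimes> c" using c ec by (metis r_cancel m_closed)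
    have "c \<otimes> a = a \<otimes> (e \<otimes> c)" using r unfolding b using c ec by (simp add: m_assoc)
    then have "tame {a, c, e}" using tame_heisenberg[OF c(1,3) ec e1 ae ce] by simp
    then show ?thesis unfolding d by (auto intro: generate.eng generate.incl)
  next
    assume r: "a \<otimes> c = c \<otimes> b \<and> d \<otimes> a = c \<otimes> b"
    then have "d \<otimes> a = c \<otimes> e \<otimes> a" unfolding b ae using c ec by (simp add: m_assoc)
    then have d: "d = c \<otimes> e" using c ec by (metis r_cancel m_closed)
    have "c \<otimes> (c \<otimes> e) = c \<otimes> (e \<otimes> c)" using cd unfolding d using c ec by (simp add: m_assoc)
    then have ce: "c \<otimes> e = e \<otimes> c" using c ec by (metis l_cancel m_closed)
    have "a \<otimes> c = c \<otimes> (e \<otimes> a)" using r unfolding b ae by simp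
    then have "tame {c, a, e}" using tame_heisenberg[OF c(3,1) ec e1 ce ae] by simp
    then have "tame {a, c, e}" by (simp add: insert_commute)
    then show ?thesis unfolding d by (auto intro: generate.eng generate.incl)
  qed
  then have "{a, b, c, d} \<subseteq> generate G {a, c, e}"
    unfolding b by (auto intro: generate.eng generate.incl)
  then show ?thesis using tame_lift[of "{a, c, e}"] main c ec by simp
qed

end

context four_elements
begin

lemma generated_by_lower: "{a, b, c, d} \<subseteq> generate G {a, b, c}"
proof (rule lower_segment_generates[where s = 0])
  have "a \<lless> d" "b \<lless> d" using lt less_trans by blast+
  then show "lower_segment {a, b, c} {a, b, c, d}" using lt by (auto simp: lower_segment_def)
  have "card {a, b, c, d} = 4" by simp
  then show "card ({a, b, c, d} <#> {a, b, c, d}) + 2 \<le> 3 * card {a, b, c, d} + 0" using small by linarith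
  have "card {a, b, c} = 3" by simp
  then show "0 + 3 \<le> card {a, b, c}" by linarith
  show "\<not> pairwise_commute G {a, b, c}" by (rule lower_nc)
qed simp_all

lemma tame_all: "tame {a, b, c, d}"
proof -
  interpret rev: four_elements G "le\<inverse>" d c b a by (rule converse)
  have up: "{a, b, c, d} \<subseteq> generate G {b, c, d}"
    using rev.generated_by_lower by (simp add: insert_commute)
  note low = generated_by_lower
  have 1: ?thesis if "a \<otimes> c = b \<otimes> a \<and> c \<otimes> a = b \<otimes> c \<or> a \<otimes> c = c \<otimes> b \<and> c \<otimes> a = a \<otimes> b"
    using tame_lift[OF _ tame_three_relations low] that by simp
  have 2: ?thesis if "b \<otimes> d = c \<otimes> b \<and> d \<otimes> b = c \<otimes> d \<or> b \<otimes> d = d \<otimes> c \<and> d \<otimes> b = b \<otimes> c"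
    using tame_lift[OF _ tame_three_relations up] that by simp
  have 3: ?thesis if "a \<otimes> c = b \<otimes> a \<and> c \<otimes> a = b \<otimes> b \<and> b \<otimes> d = c \<otimes> c \<and> d \<otimes> b = c \<otimes> d"
    by (rule tame_fibonacci_relations) (use that in auto)
  have 4: ?thesis if "c \<otimes> a = a \<otimes> b \<and> a \<otimes> c = b \<otimes> b \<and> d \<otimes> b = c \<otimes> c \<and> b \<otimes> d = d \<otimes> c"
    by (rule tame_fibonacci_relations') (use that in auto)
  have 5: ?thesis if "a \<otimes> b = b \<otimes> a" "c \<otimes> d = d \<otimes> c"
    "c \<otimes> a = b \<otimes> c \<and> a \<otimes> d = b \<otimes> c \<or> a \<otimes> c = c \<otimes> b \<and> d \<otimes> a = c \<otimes> b"
    by (rule tame_heisenberg_relations[OF car distinct_abcd(1) that])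
  show ?thesis using relations 1 2 3 4 5 unfolding four_relations_def by blast
qed

end

section \<open>The base case and the induction on \<open>s\<close>\<close>

context ordered_group
begin

text \<open>The four smallest elements either commute or generate \<open>S\<close> while inheriting
  \<open>d \<le> 0\<close>. In the latter case a commuting triple at either end is long enough for
  the commuting-segment argument with \<open>s = 0\<close>; otherwise the four-element analysis
  applies.\<close>

lemma tame_base:
  assumes S: "finite S" "S \<subseteq> carrier G" and size: "4 \<le> card S"
    and small: "card (S <#> S) + 2 \<le> 3 * card S"
  shows "tame S"
proof -
  obtain T where T: "lower_segment T S" "card T = 4" using ex_lower_segment[OF S size] by blast
  have TS: "T \<subseteq> S" using T by (simp add: lower_segment_def)
  have Tf: "finite T" "T \<subseteq> carrier G" using TS S finite_subset by auto
  show ?thesis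
  proof (cases "pairwise_commute G T")
    case True
    then show ?thesis using tame_commuting_lower_segment[OF S T(1), of 0] small T(2) by simp
  next
    case nc: False
    have gen: "S \<subseteq> generate G T" using lower_segment_generates[OF S T(1) nc, of 0] small T(2) by simp
    have TT: "card (T <#> T) \<le> 10" using lower_segment_square_card[OF S T(1) nc] small T(2) by simp
    have min: "\<exists>m\<in>W. \<forall>x\<in>W - {m}. m \<lless> x" if "W \<subseteq> T" "card W \<noteq> 0" for W
    proof -
      have "finite W" "W \<noteq> {}" "W \<subseteq> carrier G" using that Tf finite_subset by auto
      then obtain m where "m \<in> W" "\<forall>x\<in>W - {m}. m \<lless> x" using ex_min[of W] by metis
      then show ?thesis by blast
    qed
    obtain a where a: "a \<in> T" "\<forall>x\<in>T - {a}. a \<lless> x" using min[of T] T(2) by auto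
    have T3: "card (T - {a}) = 3" using a(1) T(2) by simp
    then obtain b where b: "b \<in> T - {a}" "\<forall>x\<in>T - {a} - {b}. b \<lless> x"
      using min[of "T - {a}"] by auto
    have T2: "card (T - {a} - {b}) = 2" using b(1) T3 by (simp only: card_Diff_singleton)
    then obtain c where c: "c \<in> T - {a} - {b}" "\<forall>x\<in>T - {a} - {b} - {c}. c \<lless> x"
      using min[of "T - {a} - {b}"] by auto
    have "card (T - {a} - {b} - {c}) = 1" using c(1) T2 by (simp only: card_Diff_singleton)
    then obtain d where d: "T - {a} - {b} - {c} = {d}" by (meson card_1_singletonE)
    have Teq: "T = {a, b, c, d}" using a(1) b(1) c(1) d by blast
    have lt: "a \<lless> b" "b \<lless> c" "c \<lless> d" using a b c d by auto
    have sm: "card (T <#> T) + 2 \<le> 3 * card T + 0" using TT T(2) by simp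
    have neq: "a \<noteq> b" "a \<noteq> c" "a \<noteq> d" "b \<noteq> c" "b \<noteq> d" "c \<noteq> d"
      using lt less_trans less_irrefl by blast+
    have lts: "a \<lless> c" "a \<lless> d" "b \<lless> d" using lt less_trans by blast+
    consider "pairwise_commute G {a, b, c}" | "pairwise_commute G {b, c, d}"
      | "\<not> pairwise_commute G {a, b, c}" "\<not> pairwise_commute G {b, c, d}" by blast
    then have "tame T"
    proof cases
      case 1
      have "lower_segment {a, b, c} T" using lt lts by (auto simp: lower_segment_def Teq)
      then show ?thesis using tame_commuting_lower_segment[OF Tf _ 1 sm] neq by simp
    next
      case 2
      have "ordered_group.lower_segment (le\<inverse>) {b, c, d} T"
        unfolding ordered_group.lower_segment_def[OF ordered_group_converse] less_converse
        using lt lts by (auto simp: Teq)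
      then show ?thesis
        using ordered_group.tame_commuting_lower_segment[OF ordered_group_converse Tf _ 2 sm] neq by simp
    next
      case 3
      interpret four_elements G le a b c d
        by unfold_locales (use lt TT 3 Teq in auto)
      show ?thesis using tame_all Teq by simp
    qed
    then show ?thesis using tame_lift[OF Tf(2)] gen by blast
  qed
qed

text \<open>It guarantees that a half of size \<open>2 ^ (s + 2)\<close> is long enough for the
  segment lemmas with parameter \<open>Suc s\<close>.\<close>

lemma exponential_bound: "s + 4 \<le> (2::nat) ^ (s + 2)"
  by (induction s) auto

theorem tame_small_square:
  assumes "finite S" "S \<subseteq> carrier G" "2 ^ (s + 2) \<le> card S" "card (S <#> S) + 2 \<le> 3 * card S + s"
  shows "tame S"
  using assms
proof (induction s arbitrary: S)
  case 0
  then show ?case using tame_base by simp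
next
  case (Suc s)
  note S = Suc.prems(1,2)
  define K :: nat where "K = 2 ^ (s + 2)"
  have K: "2 * K \<le> card S" "Suc s + 3 \<le> K"
    using Suc.prems(3) exponential_bound[of s] by (simp_all add: K_def)
  interpret rev: ordered_group G "le\<inverse>" by (rule ordered_group_converse)
  obtain T where T: "lower_segment T S" "card T = K" using ex_lower_segment[OF S, of K] K by auto
  obtain V where V: "rev.lower_segment V S" "card V = K" using rev.ex_lower_segment[OF S, of K] K by auto
  have TS: "T \<subseteq> S" using T by (simp add: lower_segment_def)
  have VS: "V \<subseteq> S" using V by (simp add: rev.lower_segment_def)
  have fin: "finite T" "T \<subseteq> carrier G" "finite V" "V \<subseteq> carrier G" using TS VS S finite_subset by auto
  show ?case
  proof (cases "pairwise_commute G T \<or> pairwise_commute G V")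
    case True
    then show ?thesis
      using tame_commuting_lower_segment[OF S T(1) _ Suc.prems(4)] K T(2)
        rev.tame_commuting_lower_segment[OF S V(1) _ Suc.prems(4)] V(2) by auto
  next
    case False
    then have nc: "\<not> pairwise_commute G T" "\<not> pairwise_commute G V" by auto
    have step: "tame S" if "S \<subseteq> generate G W" "finite W" "W \<subseteq> carrier G" "card W = K"
      "card (W <#> W) + 2 \<le> 3 * card W + s" for W
      using tame_lift[OF that(3) Suc.IH[OF that(2,3) _ that(5)] that(1)] that(4) by (simp add: K_def)
    have gen: "S \<subseteq> generate G T" "S \<subseteq> generate G V"
      using lower_segment_generates[OF S T(1) nc(1) Suc.prems(4)] T(2)
        rev.lower_segment_generates[OF S V(1) nc(2) Suc.prems(4)] V(2) K by auto
    show ?thesis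
    proof (rule ccontr)
      assume "\<not> tame S"
      then have "\<not> card (T <#> T) + 2 \<le> 3 * card T + s" "\<not> card (V <#> V) + 2 \<le> 3 * card V + s"
        using step[OF gen(1) fin(1,2) T(2)] step[OF gen(2) fin(3,4) V(2)] by blast+
      then have dT: "3 * K + s < card (T <#> T) + 2" and dV: "3 * K + s < card (V <#> V) + 2"
        using T(2) V(2) by simp_all
      have "T \<noteq> {}" using T(2) K by auto
      then obtain x where x: "x \<in> T" "\<forall>t\<in>T - {x}. t \<lless> x" using ex_max[OF fin(1) _ fin(2)] by metis
      define U where "U = insert x (S - T)"
      have split: "card (T <#> T) + card (U <#> U) \<le> card (S <#> S) + 1"
        unfolding U_def by (rule square_card_split[OF S T(1) x])
      have cU: "card U + K = card S + 1"
      proof -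
        have "card (S - T) = card S - K" using T(2) TS fin(1) by (simp add: card_Diff_subset)
        moreover have "card U = Suc (card (S - T))"
          unfolding U_def by (rule card_insert_disjoint) (use S(1) x(1) in auto)
        ultimately show ?thesis using K(1) by linarith
      qed
      have US: "U \<subseteq> S" using x TS by (auto simp: U_def)
      \<comment> \<open>If \<open>V\<close> met the part of \<open>T\<close> below \<open>x\<close>,
        it would contain that element and, being an upper segment, all of \<open>S - T\<close>,
        hence more than \<open>K\<close> elements.\<close>
      have "V \<subseteq> U"
      proof (rule ccontr)
        assume "\<not> V \<subseteq> U"
        then obtain v where v: "v \<in> V" "v \<in> T" using VS by (auto simp: U_def)
        have "S - T \<subseteq> V - {v}"
        proof
          fix w assume w: "w \<in> S - T"
          have "v \<lless> w" using T(1) v w by (auto simp: lower_segment_def)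
          moreover have "w \<lless> v" if "w \<notin> V"
            using V(1) v w that by (auto simp: rev.lower_segment_def less_converse)
          ultimately show "w \<in> V - {v}" using less_asym less_irrefl w v by blast
        qed
        then have "card (S - T) \<le> card (V - {v})" using fin by (intro card_mono) auto
        moreover have "card (V - {v}) < K" using v V(2) K by simp
        moreover have "card (S - T) = card S - K" using T(2) TS fin(1) by (simp add: card_Diff_subset)
        ultimately show False using K(1) by linarith
      qed
      then have "rev.lower_segment V U"
        using V(1) US by (auto simp: rev.lower_segment_def)
      then have "card (V <#> V) + 3 * card U \<le> card (U <#> U) + 3 * card V"
        using rev.lower_segment_square_card[OF _ _ _ nc(2), of U] US S finite_subset by auto
      \<comment> \<open>Both \<open>d(T)\<close> and \<open>d(V)\<close> are at least
        \<open>s + 1\<close>, and \<open>d(V) \<le> d(U)\<close>, so the sum exceeds the bound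
        \<open>d(S) \<le> s + 1\<close>.\<close>
      then show False using split dT dV cU V(2) Suc.prems(4) K by simp
    qed
  qed
qed

end

theorem theorem2p10:
  fixes G :: "('a, 'b) monoid_scheme" (structure)
    and le :: "'a rel"
    and S :: "'a set"
    and s :: nat
  assumes "ordered_group G le"
    and "s > 0"
    and "finite S"
    and "S \<subseteq> carrier G"
    and "card S \<ge> 2 ^ (s + 2)"
    and "card (S <#> S) = 3 * card S - 2 + s"
  shows "metabelian (G\<lparr>carrier := generate G S\<rparr>) \<and>
    (nilpotent_group G \<longrightarrow>
      nilpotent_group (G\<lparr>carrier := generate G S\<rparr>) \<and>
      nilpotency_class (G\<lparr>carrier := generate G S\<rparr>) \<le> 2)"
proof -
  interpret ordered_group G le by fact
  \<comment> \<open>In particular \<open>3 * card S\<close> is at least 2, so the truncated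
    subtraction in the hypothesis is exact.\<close>
  have "4 \<le> card S" using assms(5) exponential_bound[of s] by simp
  then have "tame S" using tame_small_square[of S s] assms by simp
  then have "tame (generate G S)" by (rule tame_generate[OF assms(4)])
  then show ?thesis using tame_subgroup[OF generate_is_subgroup[OF assms(4)]] by blast
qed

end
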